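(* Let $d=2h\ge 2$ be an even integer and work with $d\times d$ matrices over $\mathbb Q$. Let $X=(x_1,\dots,x_{d^2})$, $Y=(y_1,\dots,y_{d^2})$ be two sets of $d^2$ matrix variables, and let $G_1,G_2,\mathcal T_d,a_d,a_{h,h}$ and $\alpha_i,\beta_i$ $(i=1,2)$ be as defined in the context, so that, as functions on $d\times d$ matrices, $G_i(X,Y)=\mathcal T_d(X)\mathcal T_d(Y)\,(\alpha_i\,\mathrm{Id}+\beta_i\,(1,2))$. Then the tensor polynomial $-\alpha_2G_1(X,Y)+\alpha_1G_2(X,Y)$ is a balanced swap polynomial for $d\times d$ matrices, with value $$\mathcal T_d(X)\,\mathcal T_d(Y)\,(-\alpha_2\beta_1+\alpha_1\beta_2)\,(1,2).$$ Explicitly, as functions on $d\times d$ matrices, $$d\cdot a_{h,h}\,G_1(X,Y)+(a_d-d\cdot a_{h,h})\,G_2(X,Y)=\frac{a_{h,h}\,(d\cdot a_d-a_{h,h})}{(1-d)(1-d^2)\,d!^2}\;\mathcal T_d(X)\,\mathcal T_d(Y)\,(1,2).$$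
   Context: $M_d=M_d(\mathbb Q)$. A 2-tensor polynomial is an element of $\mathbb Q\langle Z\rangle^{\otimes 2}$, where $\mathbb Q\langle Z\rangle$ is the free associative algebra on the variables in play; evaluating the variables in $M_d$ gives a function with values in $M_d^{\otimes 2}$. $(1,2)\in M_d^{\otimes 2}=\mathrm{End}(\mathbb Q^d\otimes\mathbb Q^d)$ is the swap operator $u\otimes v\mapsto v\otimes u$, i.e. $(1,2)=\sum_{i,j}e_{i,j}\otimes e_{j,i}$, where $e_{i,j}$ are the elementary matrices, and $\mathrm{Id}$ is the identity of $M_d^{\otimes 2}$. A 2-tensor polynomial is a swap polynomial for $d\times d$ matrices if, evaluated on $M_d$, it is not identically zero and all its values are scalar multiples of $(1,2)$. A 2-tensor polynomial $\sum_i A_i\otimes B_i$ is balanced if all $A_i,B_i$ are homogeneous of the same degree. For $i=1,\dots,d$ set $m_i(X)=x_{(i-1)^2+1}x_{(i-1)^2+2}\cdots x_{i^2}$ (a monomial of degree $2i-1$), and likewise $m_i(Y)=y_{(i-1)^2+1}\cdots y_{i^2}$. $Alt_X$ denotes the alternation operator $\sum_{\sigma\in S_{d^2}}\epsilon_\sigma\,\sigma$ acting by permuting the variables $x_1,\dots,x_{d^2}$ ($\epsilon_\sigma$ the sign of $\sigma$), and similarly $Alt_Y$. Let $\mathcal T_d(X)=T_1\wedge T_3\wedge\cdots\wedge T_{2d-1}$, where $T_{2i-1}(x_1,\dots,x_{2i-1})=\sum_{\sigma\in S_{2i-1}}\epsilon_\sigma \mathrm{tr}(x_{\sigma(1)}\cdots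 x_{\sigma(2i-1)})$; it is normalized so that $\mathcal T_d(X)=Alt_X\big(\mathrm{tr}(m_1(X))\,\mathrm{tr}(m_2(X))\cdots \mathrm{tr}(m_d(X))\big)$. Define the monomials (each of degree $d^2$) $$A=m_1(X)m_2(Y)m_3(X)m_4(Y)\cdots m_{d-1}(X)m_d(Y),$$ $$B=m_d(X)m_{d-1}(Y)\cdots m_4(X) m_3(Y)m_2(X)m_1(Y),$$ $$C=m_1(Y)m_d(X)m_{d-1}(Y)\cdots m_3(Y)m_2(X)$$ (so for $d=2$: $A=m_1(X)m_2(Y)$, $B=m_2(X)m_1(Y)$, $C=m_1(Y)m_2(X)$), and set $G_1(X,Y)=Alt_XAlt_Y\,A\otimes B$, $G_2(X,Y)=Alt_XAlt_Y\,A\otimes C$. Each $G_i$, as a function on $d\times d$ matrices, is of the form $\mathcal T_d(X)\mathcal T_d(Y)(\alpha_i\,\mathrm{Id}+\beta_i(1,2))$ with unique constants $\alpha_i,\beta_i\in\mathbb Q$; this defines $\alpha_i,\beta_i$. The Weingarten function is $Wg(d,d)=\big(\sum_{\sigma\in S_d}d^{\,\#\mathrm{cycles}(\sigma)}\sigma^{-1}\big)^{-1}\in\mathbb Q[S_d]$, a central element; $a_d$ denotes its coefficient on a $d$-cycle, and $a_{h,h}$ its coefficient on a permutation with exactly two cycles, each of length $h$.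
   Formalization: The constant in the final explicit identity is corrected to a_{h,h}·a_d/d; the printed a_{h,h}(d·a_d−a_{h,h})/((1−d)(1−d²)d!²) is false, e.g. for d=2 it gives −1/54 where the true value is −1/36. *)

theory Defs
  imports
    "Jordan_Normal_Form.Matrix"
    "HOL-Library.Poly_Mapping"
    "HOL-Combinatorics.Orbits"
begin

section \<open>Tensor polynomials in the variables $x_i$, $y_i$\<close>

datatype var = VX nat | VY nat

text \<open>Words (lists) of variables are a basis of the free algebra, and pairs of words are a basis
  of its tensor square; so elements are finitely supported rational functions on these bases.
  Only the linear structure and the tensor product map are needed.\<close>

type_synonym ncpoly = "var list \<Rightarrow>\<^sub>0 rat"
type_synonym tpoly = "(var list \<times> var list) \<Rightarrow>\<^sub>0 rat"

definition tscale :: "rat \<Rightarrow> tpoly \<Rightarrow> tpoly" where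
  "tscale c t = Poly_Mapping.map ((*) c) t"

definition tens :: "ncpoly \<Rightarrow> ncpoly \<Rightarrow> tpoly" where
  "tens A B = (\<Sum>u\<in>Poly_Mapping.keys A. \<Sum>v\<in>Poly_Mapping.keys B.
     Poly_Mapping.single (u, v) (Poly_Mapping.lookup A u * Poly_Mapping.lookup B v))"

definition ncmono :: "var list \<Rightarrow> ncpoly" where
  "ncmono u = Poly_Mapping.single u 1"

definition homogeneous :: "nat \<Rightarrow> ncpoly \<Rightarrow> bool" where
  "homogeneous n A \<longleftrightarrow> (\<forall>u\<in>Poly_Mapping.keys A. length u = n)"

definition balanced :: "tpoly \<Rightarrow> bool" where
  "balanced t \<longleftrightarrow> (\<exists>n ABs. (\<forall>(A, B)\<in>set ABs. homogeneous n A \<and> homogeneous n B)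
     \<and> t = (\<Sum>(A, B)\<leftarrow>ABs. tens A B))"

text \<open>Linear extension of a substitution of variables by variables.\<close>

definition rename :: "(var \<Rightarrow> var) \<Rightarrow> tpoly \<Rightarrow> tpoly" where
  "rename f t = (\<Sum>(u, v)\<in>Poly_Mapping.keys t.
     Poly_Mapping.single (map f u, map f v) (Poly_Mapping.lookup t (u, v)))"

fun permX :: "(nat \<Rightarrow> nat) \<Rightarrow> var \<Rightarrow> var" where
  "permX \<sigma> (VX i) = VX (\<sigma> i)"
| "permX \<sigma> (VY i) = VY i"

fun permY :: "(nat \<Rightarrow> nat) \<Rightarrow> var \<Rightarrow> var" where
  "permY \<sigma> (VX i) = VX i"
| "permY \<sigma> (VY i) = VY (\<sigma> i)"

definition AltX :: "nat \<Rightarrow> tpoly \<Rightarrow> tpoly" where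
  "AltX d t = (\<Sum>\<sigma> | \<sigma> permutes {1..d\<^sup>2}. tscale (of_int (sign \<sigma>)) (rename (permX \<sigma>) t))"

definition AltY :: "nat \<Rightarrow> tpoly \<Rightarrow> tpoly" where
  "AltY d t = (\<Sum>\<sigma> | \<sigma> permutes {1..d\<^sup>2}. tscale (of_int (sign \<sigma>)) (rename (permY \<sigma>) t))"


section \<open>Evaluation on $d \times d$ matrices\<close>

definition mprod :: "nat \<Rightarrow> rat mat list \<Rightarrow> rat mat" where
  "mprod d Ms = foldr (*) Ms (1\<^sub>m d)"

definition tr :: "rat mat \<Rightarrow> rat" where
  "tr M = (\<Sum>i<dim_row M. M $$ (i, i))"

text \<open>$M_d \otimes M_d$ is identified with the $d^2 \times d^2$ matrices, the basis vector
  $e_i \otimes e_j$ of $\mathbb{Q}^d \otimes \mathbb{Q}^d$ (with $0 \le i, j < d$) having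
  index $id + j$.\<close>

definition kron :: "nat \<Rightarrow> rat mat \<Rightarrow> rat mat \<Rightarrow> rat mat" where
  "kron d A B = mat (d * d) (d * d)
     (\<lambda>(r, c). A $$ (r div d, c div d) * B $$ (r mod d, c mod d))"

text \<open>The operator $u \otimes v \mapsto v \otimes u$.\<close>

definition swap_mat :: "nat \<Rightarrow> rat mat" where
  "swap_mat d = mat (d * d) (d * d)
     (\<lambda>(r, c). if r div d = c mod d \<and> r mod d = c div d then 1 else 0)"

definition eval_word :: "nat \<Rightarrow> (nat \<Rightarrow> rat mat) \<Rightarrow> (nat \<Rightarrow> rat mat) \<Rightarrow> var list \<Rightarrow> rat mat" where
  "eval_word d X Y u = mprod d (map (\<lambda>z. case z of VX i \<Rightarrow> X i | VY i \<Rightarrow> Y i) u)"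

definition teval :: "nat \<Rightarrow> (nat \<Rightarrow> rat mat) \<Rightarrow> (nat \<Rightarrow> rat mat) \<Rightarrow> tpoly \<Rightarrow> rat mat" where
  "teval d X Y t = mat (d * d) (d * d) (\<lambda>rc. \<Sum>(u, v)\<in>Poly_Mapping.keys t.
     Poly_Mapping.lookup t (u, v) * kron d (eval_word d X Y u) (eval_word d X Y v) $$ rc)"

definition matrices :: "nat \<Rightarrow> (nat \<Rightarrow> rat mat) \<Rightarrow> bool" where
  "matrices d X \<longleftrightarrow> (\<forall>i. X i \<in> carrier_mat d d)"

definition swap_polynomial :: "nat \<Rightarrow> tpoly \<Rightarrow> bool" where
  "swap_polynomial d t \<longleftrightarrow>
     (\<exists>X Y. matrices d X \<and> matrices d Y \<and> teval d X Y t \<noteq> 0\<^sub>m (d * d) (d * d)) \<and>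
     (\<forall>X Y. matrices d X \<and> matrices d Y \<longrightarrow> (\<exists>c. teval d X Y t = c \<cdot>\<^sub>m swap_mat d))"


section \<open>The polynomials $G_1$, $G_2$ and the function $\mathcal{T}_d$\<close>

definition m_idx :: "nat \<Rightarrow> nat list" where
  "m_idx i = [(i - 1)\<^sup>2 + 1..<i\<^sup>2 + 1]"

definition mX :: "nat \<Rightarrow> var list" where "mX i = map VX (m_idx i)"
definition mY :: "nat \<Rightarrow> var list" where "mY i = map VY (m_idx i)"

definition wordA :: "nat \<Rightarrow> var list" where
  "wordA d = concat (map (\<lambda>i. if odd i then mX i else mY i) [1..<d + 1])"

definition wordB :: "nat \<Rightarrow> var list" where
  "wordB d = concat (map (\<lambda>i. if even i then mX i else mY i) (rev [1..<d + 1]))"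

definition wordC :: "nat \<Rightarrow> var list" where
  "wordC d = mY 1 @ concat (map (\<lambda>i. if even i then mX i else mY i) (rev [2..<d + 1]))"

definition G1 :: "nat \<Rightarrow> tpoly" where
  "G1 d = AltX d (AltY d (tens (ncmono (wordA d)) (ncmono (wordB d))))"

definition G2 :: "nat \<Rightarrow> tpoly" where
  "G2 d = AltX d (AltY d (tens (ncmono (wordA d)) (ncmono (wordC d))))"

definition alt_fun :: "nat \<Rightarrow> ((nat \<Rightarrow> rat mat) \<Rightarrow> rat) \<Rightarrow> (nat \<Rightarrow> rat mat) \<Rightarrow> rat" where
  "alt_fun d f X = (\<Sum>\<sigma> | \<sigma> permutes {1..d\<^sup>2}. of_int (sign \<sigma>) * f (X \<circ> \<sigma>))"

text \<open>The wedge product $T_1 \wedge T_3 \wedge \dots \wedge T_{2d-1}$ of the standard trace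
  polynomials, in its normalization as an alternated product of traces of monomials.\<close>

definition Td :: "nat \<Rightarrow> (nat \<Rightarrow> rat mat) \<Rightarrow> rat" where
  "Td d = alt_fun d (\<lambda>X. \<Prod>i=1..d. tr (mprod d (map X (m_idx i))))"

definition has_coeffs :: "nat \<Rightarrow> tpoly \<Rightarrow> rat \<Rightarrow> rat \<Rightarrow> bool" where
  "has_coeffs d G \<alpha> \<beta> \<longleftrightarrow> (\<forall>X Y. matrices d X \<and> matrices d Y \<longrightarrow>
     teval d X Y G = (Td d X * Td d Y) \<cdot>\<^sub>m (\<alpha> \<cdot>\<^sub>m 1\<^sub>m (d * d) + \<beta> \<cdot>\<^sub>m swap_mat d))"

definition id_swap_coeffs :: "nat \<Rightarrow> tpoly \<Rightarrow> rat \<times> rat" where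
  "id_swap_coeffs d G = (THE (\<alpha>, \<beta>). has_coeffs d G \<alpha> \<beta>)"

definition \<alpha>1 :: "nat \<Rightarrow> rat" where "\<alpha>1 d = fst (id_swap_coeffs d (G1 d))"
definition \<beta>1 :: "nat \<Rightarrow> rat" where "\<beta>1 d = snd (id_swap_coeffs d (G1 d))"
definition \<alpha>2 :: "nat \<Rightarrow> rat" where "\<alpha>2 d = fst (id_swap_coeffs d (G2 d))"
definition \<beta>2 :: "nat \<Rightarrow> rat" where "\<beta>2 d = snd (id_swap_coeffs d (G2 d))"


section \<open>The Weingarten function\<close>

text \<open>Cycles of a permutation of $\{1,\dots,d\}$, fixed points included.\<close>

definition cycles :: "nat \<Rightarrow> (nat \<Rightarrow> nat) \<Rightarrow> nat set set" where
  "cycles d \<pi> = orbit \<pi> ` {1..d}"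

text \<open>Elements of the group algebra $\mathbb{Q}[S_d]$ are functions vanishing off the permutations
  of $\{1,\dots,d\}$.\<close>

definition group_alg :: "nat \<Rightarrow> ((nat \<Rightarrow> nat) \<Rightarrow> rat) set" where
  "group_alg d = {f. \<forall>\<pi>. \<not> \<pi> permutes {1..d} \<longrightarrow> f \<pi> = 0}"

definition conv :: "nat \<Rightarrow> ((nat \<Rightarrow> nat) \<Rightarrow> rat) \<Rightarrow> ((nat \<Rightarrow> nat) \<Rightarrow> rat) \<Rightarrow> (nat \<Rightarrow> nat) \<Rightarrow> rat" where
  "conv d f g \<pi> = (\<Sum>(\<sigma>, \<tau>) | \<sigma> permutes {1..d} \<and> \<tau> permutes {1..d} \<and> \<sigma> \<circ> \<tau> = \<pi>. f \<sigma> * g \<tau>)"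

definition gdelta :: "(nat \<Rightarrow> nat) \<Rightarrow> (nat \<Rightarrow> nat) \<Rightarrow> rat" where
  "gdelta \<sigma> \<pi> = (if \<pi> = \<sigma> then 1 else 0)"

definition cycle_sum :: "nat \<Rightarrow> (nat \<Rightarrow> nat) \<Rightarrow> rat" where
  "cycle_sum d \<pi> = (\<Sum>\<sigma> | \<sigma> permutes {1..d}. of_nat d ^ card (cycles d \<sigma>) * gdelta (inv_into UNIV \<sigma>) \<pi>)"

definition Wg :: "nat \<Rightarrow> (nat \<Rightarrow> nat) \<Rightarrow> rat" where
  "Wg d = (THE w. w \<in> group_alg d \<and> conv d (cycle_sum d) w = gdelta id
     \<and> conv d w (cycle_sum d) = gdelta id)"

text \<open>Write $a_d$ and $a_{h,h}$ for the values of \<open>Wg d\<close> at a $d$-cycle and at a permutation with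
  two cycles of length $h = d/2$. The coefficients are $\alpha_1 = (d a_{h,h} - a_d)/(d^3 - d)$,
  $\beta_1 = (d a_d - a_{h,h})/(d^3 - d)$, $\alpha_2 = d a_{h,h}/(d^3 - d)$,
  $\beta_2 = - a_{h,h}/(d^3 - d)$, so the value of $d a_{h,h} G_1 + (a_d - d a_{h,h}) G_2$ is
  $(a_{h,h} a_d / d) \mathcal{T}_d(X) \mathcal{T}_d(Y) (1,2)$. The constant
  $a_{h,h} (d a_d - a_{h,h}) / ((1-d)(1-d^2) d!^2)$ found in the source differs from this
  already for $d = 2$, where it is $-1/54$ instead of $-1/36$.\<close>

end

theory Submission
  imports Defs "HOL-Combinatorics.Cycles" "Jordan_Normal_Form.Determinant"
begin

text \<open>
Write $V = \mathbb{Q}^d$. Multiplying out the monomials $A$, $B$, $C$ means contracting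
$Alt_X\, m_1(X) \otimes \dots \otimes m_d(X)$ with its counterpart in $Y$, both of which act on
$V^{\otimes d}$. Everything rests on the formula
  \[ Alt_X\, m_1(X) \otimes \dots \otimes m_d(X)
     = \mathcal{T}_d(X) \sum_{\tau \in S_d} Wg(d,d)(\tau)\, \tau \]
(lemma \<open>mono_tensor_Wg\<close>).

The left-hand side lies in the span of the permutation operators. It is obtained by partial traces
from $Alt_X\, x_1 \otimes \dots \otimes x_{d^2}$, whose entries are alternating functions of
the $d^2$ pairs (row index, column index). There are only $d^2$ such pairs, so an alternating
function is a multiple of any other one that does not vanish, and it suffices to find a single
nonzero alternating function in the span. It is built from a Young symmetrizer of the
$d \times d$ square, and it does not vanish because its value is a sum of squares up to a positive factor
(\<open>sum_row_col_coeff_col_row_coeff_pos\<close>, \<open>perm_span_if_alternating\<close>).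

An element of the span is determined by its traces against the permutations, because the trace
form is positive definite on the span (\<open>perm_span_eq_zero_if_traces_zero\<close>). The trace of
$Alt_X\, x_1 \otimes \dots \otimes x_{d^2}$ against $\sigma \in S_{d^2}$ changes by
$\epsilon_\tau$ when $\sigma$ is conjugated by $\tau$. It therefore vanishes if an odd
permutation commutes with $\sigma$, which leaves the $\sigma$ with distinct odd cycle lengths.
Cycles longer than $2d - 1$ are excluded by the theorem of Amitsur and Levitzki, here in the form
\<open>card_orbit_less\<close>. As $1 + 3 + \dots + (2d - 1) = d^2$, the cycle lengths must be
$1, 3, \dots, 2d - 1$. So tracing $Alt_X\, m_1(X) \otimes \dots \otimes m_d(X)$ against
$\tau \in S_d$ gives $\mathcal{T}_d(X)$ for $\tau = 1$, and it gives $0$ for all other $\tau$, which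
merge the $d$ blocks into fewer than $d$ cycles. By the definition of the Weingarten function
the right-hand side has the same traces. The same argument shows $\mathcal{T}_d \neq 0$ at the
matrix units: some trace is nonzero there, and its cycle type is that of $\mathcal{T}_d$.

With this formula $G_1$ and $G_2$ are contractions of permutation operators, that is,
$a\, \mathrm{Id} + b\, (1,2)$, and $a$, $b$ follow from two traces. Closing up $A$ and $B$, or
$A$ and $C$, to two separate cycles gives $\mathcal{T}_d(X) \mathcal{T}_d(Y)\, a_{h,h} = d^2 a + d b$ in both cases, since
$C$ is a rotation of $B$. Joining the two words to one cycle gives $d a + d^2 b$; this is
$\mathcal{T}_d(X) \mathcal{T}_d(Y)\, a_d$ for $A B$, but $0$ for $A C$, where $m_d(Y)$ and $m_1(Y)$
become neighbours (\<open>mono_tensor_cyclic_contraction\<close>). Solving for $a$ and $b$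
gives $\alpha_i$ and $\beta_i$.

Finally the combination that cancels the identity is a nonzero multiple of $(1,2)$ because
$a_d \neq 0 \neq a_{h,h}$: the element $\sum_\sigma d^{\#\mathrm{cycles}(\sigma)} \sigma$ is a
product of factors $d + J_k$ with Jucys--Murphy elements $J_k$, and inverting the factors one by
one shows that $Wg(d,d)(\tau)$ has the sign of $\tau$ (\<open>signed_inverse_exists\<close>).
\<close>

\<comment> \<open>Here inv denotes the inverse of a function, not of a group element.\<close>
unbundle no m_inv_syntax

section \<open>Tensors spanned by permutations\<close>

text \<open>The value at $(r, c)$ is the entry of a tensor with input slots $P$ and output slots $Q$, each of
dimension $d$, in row $r$ and column $c$. A bijection $\sigma$ stands for the operator that
connects output slot $q$ with input slot $\sigma\, q$. Slots carry names from arbitrary types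
rather than numbers, since they will be removed one at a time by contraction. The last rule makes
the notion depend on the values at indices below $d$ only.\<close>
inductive perm_span :: "nat \<Rightarrow> 'a set \<Rightarrow> 'b set \<Rightarrow> (('a \<Rightarrow> nat) \<Rightarrow> ('b \<Rightarrow> nat) \<Rightarrow> rat) \<Rightarrow> bool"
  for d P Q where
  delta: "bij_betw \<sigma> Q P \<Longrightarrow> perm_span d P Q (\<lambda>r c. a * of_bool (\<forall>q\<in>Q. c q = r (\<sigma> q)))"
| add: "perm_span d P Q f \<Longrightarrow> perm_span d P Q g \<Longrightarrow> perm_span d P Q (\<lambda>r c. f r c + g r c)"
| cong: "perm_span d P Q f \<Longrightarrow>
    (\<And>r c. (\<forall>p\<in>P. r p < d) \<Longrightarrow> (\<forall>q\<in>Q. c q < d) \<Longrightarrow> f r c = g r c) \<Longrightarrow> perm_span d P Q g"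

lemma perm_span_scale:
  assumes "perm_span d P Q f"
  shows "perm_span d P Q (\<lambda>r c. x * f r c)"
  using assms
proof induction
  case (delta \<sigma> a)
  then show ?case
    using perm_span.delta[of \<sigma> Q P d "x * a"] by (simp add: mult.assoc)
next
  case (add f g)
  then show ?case
    using perm_span.add[OF add.IH] by (simp add: distrib_left)
next
  case (cong f g)
  show ?case by (rule perm_span.cong[OF cong.IH]) (use cong.hyps(2) in simp)
qed

lemma perm_span_sum:
  assumes "finite I" "\<And>i. i \<in> I \<Longrightarrow> perm_span d P Q (f i)" "bij_betw \<sigma> Q P"
  shows "perm_span d P Q (\<lambda>r c. \<Sum>i\<in>I. f i r c)"
  using assms(1,2)
proof (induction I rule: finite_induct)
  case empty
  then show ?case using perm_span.delta[OF assms(3), of d 0] by simp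
next
  case (insert i I)
  have "perm_span d P Q (\<lambda>r c. f i r c + (\<Sum>i\<in>I. f i r c))"
    by (intro perm_span.add) (use insert in auto)
  then show ?case using insert by simp
qed

lemma perm_span_local:
  assumes "perm_span d P Q f" "\<forall>p\<in>P. r p < d" "\<forall>q\<in>Q. c q < d"
    "\<forall>p\<in>P. r p = r' p" "\<forall>q\<in>Q. c q = c' q"
  shows "f r c = f r' c'"
  using assms
proof induction
  case (delta \<sigma> a)
  then have "(\<forall>q\<in>Q. c q = r (\<sigma> q)) = (\<forall>q\<in>Q. c' q = r' (\<sigma> q))"
    by (auto simp: bij_betw_def)
  then show ?case by simp
next
  case (cong f g)
  have "f r c = g r c" using cong.hyps(2) cong.prems by blast
  moreover have "f r' c' = g r' c'" using cong.hyps(2)[of r' c'] cong.prems by auto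
  ultimately show ?case using cong by simp
qed auto

lemma perm_span_rename:
  assumes "perm_span d P Q f" "bij_betw \<phi> P P'" "bij_betw \<psi> Q Q'"
  shows "perm_span d P' Q' (\<lambda>r c. f (r \<circ> \<phi>) (c \<circ> \<psi>))"
  using assms(1)
proof induction
  case (delta \<sigma> a)
  define \<sigma>' where "\<sigma>' = \<phi> \<circ> \<sigma> \<circ> inv_into Q \<psi>"
  have bij: "bij_betw \<sigma>' Q' P'"
    unfolding \<sigma>'_def using delta assms(2,3) bij_betw_inv_into bij_betw_trans by metis
  have eq: "(\<forall>q\<in>Q. (c \<circ> \<psi>) q = (r \<circ> \<phi>) (\<sigma> q)) = (\<forall>q\<in>Q'. c q = r (\<sigma>' q))" for r c
  proof -
    have "Q' = \<psi> ` Q" using assms(3) by (simp add: bij_betw_def)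
    moreover have "inv_into Q \<psi> (\<psi> q) = q" if "q \<in> Q" for q
      using assms(3) that by (simp add: bij_betw_def)
    ultimately show ?thesis by (auto simp: \<sigma>'_def)
  qed
  show ?case unfolding eq by (rule perm_span.delta[OF bij])
next
  case (add f g)
  then show ?case by (simp add: perm_span.add)
next
  case (cong f g)
  show ?case
  proof (rule perm_span.cong[OF cong.IH])
    fix r :: "'c \<Rightarrow> nat" and c :: "'d \<Rightarrow> nat"
    assume "\<forall>p\<in>P'. r p < d" "\<forall>q\<in>Q'. c q < d"
    then show "f (r \<circ> \<phi>) (c \<circ> \<psi>) = g (r \<circ> \<phi>) (c \<circ> \<psi>)"
      using assms(2,3) by (intro cong.hyps(2)) (auto simp: bij_betw_def)
  qed
qed

lemma perm_span_mult:
  assumes "perm_span d P Q f" "perm_span d P' Q' g" "P \<inter> P' = {}" "Q \<inter> Q' = {}"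
  shows "perm_span d (P \<union> P') (Q \<union> Q') (\<lambda>r c. f r c * g r c)"
  using assms(1)
proof induction
  case (delta \<sigma> a)
  note outer = delta
  show ?case using assms(2)
  proof induction
    case (delta \<tau> b)
    define \<rho> where "\<rho> = (\<lambda>q. if q \<in> Q then \<sigma> q else \<tau> q)"
    have "bij_betw \<rho> Q P"
      using outer by (subst bij_betw_cong[where g = \<sigma>]) (auto simp: \<rho>_def)
    moreover have "bij_betw \<rho> Q' P'"
      using delta assms(4) by (subst bij_betw_cong[where g = \<tau>]) (auto simp: \<rho>_def)
    ultimately have bij: "bij_betw \<rho> (Q \<union> Q') (P \<union> P')"
      using assms(3) by (rule bij_betw_combine)
    have "(\<forall>q\<in>Q \<union> Q'. c q = r (\<rho> q)) = ((\<forall>q\<in>Q. c q = r (\<sigma> q)) \<and> (\<forall>q\<in>Q'. c q = r (\<tau> q)))"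
      for r :: "'a \<Rightarrow> nat" and c
      using assms(4) by (auto simp: \<rho>_def)
    then show ?case using perm_span.delta[OF bij, of d "a * b"]
      by (simp add: of_bool_conj mult_ac)
  next
    case (add f g)
    then show ?case using perm_span.add[OF add.IH] by (simp add: algebra_simps)
  next
    case (cong f g)
    show ?case by (rule perm_span.cong[OF cong.IH]) (use cong.hyps(2) in simp)
  qed
next
  case (add f g)
  then show ?case using perm_span.add[OF add.IH] by (simp add: algebra_simps)
next
  case (cong f g)
  show ?case by (rule perm_span.cong[OF cong.IH]) (use cong.hyps(2) in simp)
qed

text \<open>Connecting an output slot with an input slot again gives permutations: either $\sigma$ joins
these two slots already, and the closed loop contributes a factor $d$, or the two strands of
$\sigma$ that end in them are joined to one.\<close>
lemma perm_span_contract: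
  assumes "perm_span d (insert p P) (insert q Q) f" "p \<notin> P" "q \<notin> Q"
  shows "perm_span d P Q (\<lambda>r c. \<Sum>z<d. f (r(p := z)) (c(q := z)))"
  using assms(1)
proof induction
  case (delta \<sigma> a)
  show ?case
  proof (cases "\<sigma> q = p")
    case True
    have "\<sigma> ` Q = P"
    proof -
      have "insert p (\<sigma> ` Q) = insert p P" "p \<notin> \<sigma> ` Q"
        using delta assms(3) True by (auto simp: bij_betw_def)
      then show ?thesis using assms(2) by (metis insert_ident)
    qed
    then have bij: "bij_betw \<sigma> Q P" using delta by (auto simp: bij_betw_def)
    have iff: "(\<forall>q'\<in>insert q Q. (c(q := z)) q' = (r(p := z)) (\<sigma> q')) = (\<forall>q'\<in>Q. c q' = r (\<sigma> q'))"
      for r c and z :: nat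
    proof -
      have "q' \<noteq> q \<and> \<sigma> q' \<noteq> p" if "q' \<in> Q" for q'
        using that assms(2,3) bij by (auto simp: bij_betw_def)
      then show ?thesis using True by auto
    qed
    show ?thesis
      unfolding iff using perm_span.delta[OF bij, of d "of_nat d * a"] by (simp add: mult.assoc)
  next
    case False
    have "p \<in> \<sigma> ` insert q Q" using delta by (simp add: bij_betw_def)
    then obtain q1 where q1: "q1 \<in> Q" "\<sigma> q1 = p" using False by blast
    define p1 where "p1 = \<sigma> q"
    have p1: "p1 \<in> P" using delta False by (auto simp: p1_def bij_betw_def)
    define \<sigma>' where "\<sigma>' = \<sigma>(q1 := p1)"
    have bij: "bij_betw \<sigma>' Q P"
      unfolding bij_betw_def
    proof
      show "inj_on \<sigma>' Q" using delta q1 assms(3)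
        by (auto simp: inj_on_def bij_betw_def \<sigma>'_def p1_def)
      have "x \<in> \<sigma>' ` Q" if "x \<in> P" for x
      proof (cases "x = p1")
        case True then show ?thesis using q1 by (auto simp: \<sigma>'_def)
      next
        case False
        have "x \<in> \<sigma> ` insert q Q" using delta that by (simp add: bij_betw_def)
        then obtain y where "y \<in> insert q Q" "\<sigma> y = x" by blast
        then have "y \<in> Q" "\<sigma>' y = x"
          using False q1 that assms(2) by (auto simp: p1_def \<sigma>'_def)
        then show ?thesis by blast
      qed
      moreover have "\<sigma>' y \<in> P" if "y \<in> Q" for y
      proof (cases "y = q1")
        case False
        have "\<sigma> y \<in> insert p P" using delta that by (auto dest: bij_betwE)
        moreover have "\<sigma> y \<noteq> p"
          using that False delta q1 by (auto simp: bij_betw_def inj_on_def)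
        ultimately show ?thesis using False by (simp add: \<sigma>'_def)
      qed (use p1 in \<open>simp add: \<sigma>'_def\<close>)
      ultimately show "\<sigma>' ` Q = P" by blast
    qed
    have ne: "\<sigma> y \<noteq> p" "\<sigma> y \<in> P" if "y \<in> Q" "y \<noteq> q1" for y
    proof -
      show "\<sigma> y \<noteq> p" using that delta q1 by (auto simp: bij_betw_def inj_on_def)
      moreover have "\<sigma> y \<in> insert p P" using delta that by (auto dest: bij_betwE)
      ultimately show "\<sigma> y \<in> P" by simp
    qed
    have iff: "(\<forall>q'\<in>insert q Q. (c(q := z)) q' = (r(p := z)) (\<sigma> q'))
        = (z = r p1 \<and> (\<forall>q'\<in>Q. c q' = r (\<sigma>' q')))" for r c and z :: nat
    proof -
      have "(\<forall>q'\<in>insert q Q. (c(q := z)) q' = (r(p := z)) (\<sigma> q'))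
          = (z = r p1 \<and> c q1 = z \<and> (\<forall>q'\<in>Q - {q1}. c q' = r (\<sigma> q')))"
        using q1 assms(3) False ne p1 by (auto simp: p1_def)
      also have "\<dots> = (z = r p1 \<and> (\<forall>q'\<in>Q. c q' = r (\<sigma>' q')))"
        using q1 by (auto simp: \<sigma>'_def)
      finally show ?thesis .
    qed
    show ?thesis
    proof (rule perm_span.cong[OF perm_span.delta[OF bij, of d a]])
      fix r :: "'a \<Rightarrow> nat" and c :: "'b \<Rightarrow> nat"
      assume "\<forall>p\<in>P. r p < d"
      then have "r p1 < d" using p1 by blast
      then show "a * of_bool (\<forall>q\<in>Q. c q = r (\<sigma>' q))
        = (\<Sum>z<d. a * of_bool (\<forall>q'\<in>insert q Q. (c(q := z)) q' = (r(p := z)) (\<sigma> q')))"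
        unfolding iff by (simp add: of_bool_conj sum.delta flip: sum_distrib_left)
    qed
  qed
next
  case (add f g)
  then show ?case using perm_span.add[OF add.IH] by (simp add: sum.distrib)
next
  case (cong f g)
  show ?case
    by (rule perm_span.cong[OF cong.IH], intro sum.cong refl cong.hyps(2)) auto
qed

text \<open>The bilinear form $\sum_{r,c} f(r,c)\, g(r,c)$ pairs $g$ with a permutation to the trace in the
assumption. If all of these vanish, then $g$ is orthogonal to the whole span, hence to itself,
and a sum of rational squares is zero only if all its terms are. In this way no linear
independence of the permutations is required, which fails for more than $d$ slots.\<close>
lemma perm_span_eq_zero_if_traces_zero:
  assumes g: "perm_span d P Q g" and fin: "finite P" "finite Q"
    and traces: "\<And>\<sigma>. bij_betw \<sigma> Q P \<Longrightarrow> (\<Sum>r\<in>P \<rightarrow>\<^sub>E {..<d}. g r (r \<circ> \<sigma>)) = 0"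
    and "\<forall>p\<in>P. r p < d" "\<forall>q\<in>Q. c q < d"
  shows "g r c = 0"
proof -
  let ?R = "P \<rightarrow>\<^sub>E {..<d}" and ?C = "Q \<rightarrow>\<^sub>E {..<d}"
  have "(\<Sum>r\<in>?R. \<Sum>c\<in>?C. f r c * g r c) = 0" if "perm_span d P Q f" for f
    using that
  proof induction
    case (delta \<sigma> a)
    have "(\<Sum>c\<in>?C. a * of_bool (\<forall>q\<in>Q. c q = r (\<sigma> q)) * g r c) = a * g r (r \<circ> \<sigma>)" if r: "r \<in> ?R" for r
    proof -
      define c0 where "c0 = restrict (r \<circ> \<sigma>) Q"
      have c0: "c0 \<in> ?C" using delta r by (auto simp: c0_def bij_betw_def)
      have "(\<Sum>c\<in>?C. a * of_bool (\<forall>q\<in>Q. c q = r (\<sigma> q)) * g r c)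
          = (\<Sum>c\<in>?C. if c = c0 then a * g r c0 else 0)"
      proof (intro sum.cong refl)
        fix c assume "c \<in> ?C"
        then have "(\<forall>q\<in>Q. c q = r (\<sigma> q)) = (c = c0)"
          by (auto simp: c0_def PiE_def extensional_def fun_eq_iff restrict_def)
        then show "a * of_bool (\<forall>q\<in>Q. c q = r (\<sigma> q)) * g r c = (if c = c0 then a * g r c0 else 0)"
          by simp
      qed
      also have "\<dots> = a * g r c0" using c0 fin by (simp add: finite_PiE)
      also have "g r c0 = g r (r \<circ> \<sigma>)"
        by (rule perm_span_local[OF g]) (use r c0 in \<open>auto simp: c0_def PiE_iff\<close>)
      finally show ?thesis .
    qed
    then have "(\<Sum>r\<in>?R. \<Sum>c\<in>?C. a * of_bool (\<forall>q\<in>Q. c q = r (\<sigma> q)) * g r c) = (\<Sum>r\<in>?R. a * g r (r \<circ> \<sigma>))"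
      by (intro sum.cong refl)
    also have "\<dots> = 0" using traces[OF delta] by (simp flip: sum_distrib_left)
    finally show ?case .
  next
    case (add f f')
    then show ?case by (simp add: distrib_right sum.distrib)
  next
    case (cong f f')
    have "(\<Sum>r\<in>?R. \<Sum>c\<in>?C. f' r c * g r c) = (\<Sum>r\<in>?R. \<Sum>c\<in>?C. f r c * g r c)"
    proof (intro sum.cong refl)
      fix r c assume "r \<in> ?R" "c \<in> ?C"
      then have "f r c = f' r c" by (intro cong.hyps(2)) (auto simp: PiE_iff)
      then show "f' r c * g r c = f r c * g r c" by simp
    qed
    then show ?case using cong.IH by simp
  qed
  from this[OF g] have "(\<Sum>r\<in>?R. \<Sum>c\<in>?C. g r c * g r c) = 0" .
  then have zero: "g r c = 0" if "r \<in> ?R" "c \<in> ?C" for r c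
    using that fin by (auto simp: sum_nonneg_eq_0_iff sum_nonneg finite_PiE)
  have "g r c = g (restrict r P) (restrict c Q)"
    by (rule perm_span_local[OF g]) (use assms in auto)
  then show ?thesis using zero[of "restrict r P" "restrict c Q"] assms by auto
qed

section \<open>Products along words as contractions\<close>

fun word_entry :: "nat \<Rightarrow> ('a \<Rightarrow> nat \<Rightarrow> nat \<Rightarrow> rat) \<Rightarrow> 'a list \<Rightarrow> nat \<Rightarrow> nat \<Rightarrow> rat" where
  "word_entry d Z [] i j = of_bool (i = j)"
| "word_entry d Z (a # w) i j = (\<Sum>k<d. Z a i k * word_entry d Z w k j)"

lemma word_entry_single: "j < d \<Longrightarrow> word_entry d Z [a] i j = Z a i j"
  by (simp add: sum.delta' if_distrib of_bool_def cong: if_cong)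

lemma word_entry_append:
  assumes "i < d"
  shows "word_entry d Z (u @ v) i j = (\<Sum>k<d. word_entry d Z u i k * word_entry d Z v k j)"
  using assms
proof (induction u arbitrary: i)
  case Nil
  then show ?case by (simp add: of_bool_def if_distrib[of "\<lambda>x. x * _"] sum.delta cong: if_cong)
next
  case (Cons a u)
  have "word_entry d Z ((a # u) @ v) i j
      = (\<Sum>l<d. \<Sum>k<d. Z a i l * (word_entry d Z u l k * word_entry d Z v k j))"
    using Cons.IH by (simp add: sum_distrib_left)
  also have "\<dots> = (\<Sum>k<d. \<Sum>l<d. Z a i l * (word_entry d Z u l k * word_entry d Z v k j))"
    by (rule sum.swap)
  finally show ?case by (simp add: sum_distrib_right mult.assoc)
qed

lemma word_entry_map: "word_entry d Z (map f w) i j = word_entry d (Z \<circ> f) w i j"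
  by (induction w arbitrary: i) auto

lemma word_entry_concat:
  assumes "i < d"
  shows "word_entry d Z (concat (map f w)) i j = word_entry d (\<lambda>z. word_entry d Z (f z)) w i j"
  using assms by (induction w arbitrary: i) (simp_all add: word_entry_append)

text \<open>A weighted sum over families $Z\, \omega$ of matrices: the letters in $A$ are tensor factors
of their own, and the matrices along each word of \<open>ws\<close> are multiplied. Each factor has
one input and one output slot. The slots are named by letters, a word having the input slot of
its first and the output slot of its last letter.\<close>
definition word_tensor ::
  "nat \<Rightarrow> 'w set \<Rightarrow> ('w \<Rightarrow> rat) \<Rightarrow> ('w \<Rightarrow> 'a \<Rightarrow> nat \<Rightarrow> nat \<Rightarrow> rat) \<Rightarrow> 'a list list \<Rightarrow> 'a set
    \<Rightarrow> ('a \<Rightarrow> nat) \<Rightarrow> ('a \<Rightarrow> nat) \<Rightarrow> rat" where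
  "word_tensor d \<Omega> wt Z ws A r c = (\<Sum>\<omega>\<in>\<Omega>. wt \<omega> * (\<Prod>a\<in>A. Z \<omega> a (r a) (c a)) *
     (\<Prod>w\<leftarrow>ws. word_entry d (Z \<omega>) w (r (hd w)) (c (last w))))"

lemma word_tensor_cong:
  assumes "\<And>a. a \<in> A \<union> hd ` set ws \<Longrightarrow> r a = r' a" "\<And>a. a \<in> A \<union> last ` set ws \<Longrightarrow> c a = c' a"
  shows "word_tensor d \<Omega> wt Z ws A r c = word_tensor d \<Omega> wt Z ws A r' c'"
  unfolding word_tensor_def
  using assms by (intro sum.cong arg_cong2[where f = "(*)"] prod.cong refl
      arg_cong[where f = prod_list] map_cong) auto

lemma word_tensor_single:
  assumes "finite A" "a \<notin> A" "c a < d"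
  shows "word_tensor d \<Omega> wt Z ([a] # ws) A r c = word_tensor d \<Omega> wt Z ws (insert a A) r c"
  unfolding word_tensor_def
  using assms by (intro sum.cong refl) (simp add: word_entry_single del: word_entry.simps)

lemma hd_last_in_concat:
  assumes "v \<in> set ws" "[] \<notin> set ws"
  shows "hd v \<in> set (concat ws)" "last v \<in> set (concat ws)"
proof -
  have "v \<noteq> []" using assms by auto
  then have "hd v \<in> set v" "last v \<in> set v" by simp_all
  then show "hd v \<in> set (concat ws)" "last v \<in> set (concat ws)" using assms(1) by auto
qed

text \<open>Splitting off the first letter $a$ of a word undoes a contraction of the output slot of $a$ with
the input slot of the next letter $b$.\<close>
lemma word_tensor_split:
  assumes "finite A" "distinct (concat ((a # b # w) # ws))" "A \<inter> set (concat ((a # b # w) # ws)) = {}"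
    "[] \<notin> set ws"
  shows "word_tensor d \<Omega> wt Z ((a # b # w) # ws) A r c =
    (\<Sum>z<d. word_tensor d \<Omega> wt Z ((b # w) # ws) (insert a A) (r(b := z)) (c(a := z)))"
proof -
  have hd: "hd v \<in> set (concat ws)" "last v \<in> set (concat ws)" if "v \<in> set ws" for v
    using hd_last_in_concat[OF that] assms(4) by auto
  have v: "hd v \<noteq> b" "last v \<noteq> a" if "v \<in> set ws" for v
    using hd[OF that] assms(2) by auto
  have l: "last (b # w) \<noteq> a" using assms(2) last_in_set[of "b # w"] by (auto simp del: last.simps)
  have A: "x \<noteq> a" "x \<noteq> b" if "x \<in> A" for x using assms(3) that by auto
  have "a \<notin> A" "a \<noteq> b" using assms by auto
  have "(\<Prod>v\<leftarrow>ws. word_entry d (Z \<omega>) v ((r(b := z)) (hd v)) ((c(a := z)) (last v)))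
      = (\<Prod>v\<leftarrow>ws. word_entry d (Z \<omega>) v (r (hd v)) (c (last v)))" for z \<omega>
    using v by (intro arg_cong[where f = prod_list] map_cong) auto
  moreover have "(\<Prod>x\<in>A. Z \<omega> x ((r(b := z)) x) ((c(a := z)) x)) = (\<Prod>x\<in>A. Z \<omega> x (r x) (c x))" for z \<omega>
    using A by (intro prod.cong) auto
  ultimately have "(\<Sum>z<d. word_tensor d \<Omega> wt Z ((b # w) # ws) (insert a A) (r(b := z)) (c(a := z)))
     = (\<Sum>z<d. \<Sum>\<omega>\<in>\<Omega>. wt \<omega> * (Z \<omega> a (r a) z * (\<Prod>x\<in>A. Z \<omega> x (r x) (c x))) *
         (word_entry d (Z \<omega>) (b # w) z (c (last (b # w))) *
          (\<Prod>v\<leftarrow>ws. word_entry d (Z \<omega>) v (r (hd v)) (c (last v)))))"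
    unfolding word_tensor_def using \<open>a \<notin> A\<close> \<open>a \<noteq> b\<close> l assms(1)
    by (simp del: word_entry.simps last.simps fun_upd_apply add: fun_upd_same fun_upd_other)
  also have "\<dots> = (\<Sum>\<omega>\<in>\<Omega>. \<Sum>z<d. wt \<omega> * (Z \<omega> a (r a) z * (\<Prod>x\<in>A. Z \<omega> x (r x) (c x))) *
         (word_entry d (Z \<omega>) (b # w) z (c (last (b # w))) *
          (\<Prod>v\<leftarrow>ws. word_entry d (Z \<omega>) v (r (hd v)) (c (last v)))))"
    by (rule sum.swap)
  also have "\<dots> = word_tensor d \<Omega> wt Z ((a # b # w) # ws) A r c"
    unfolding word_tensor_def word_entry.simps(2)[of d _ a] list.map prod_list.Cons list.sel
    by (intro sum.cong refl) (simp del: word_entry.simps add: sum_distrib_left sum_distrib_right mult_ac)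
  finally show ?thesis ..
qed

text \<open>Only the induction scheme matters: the words are taken apart letter by letter, and the letters
are collected in $A$.\<close>
fun unroll :: "'a list list \<Rightarrow> 'a set \<Rightarrow> 'a set" where
  "unroll [] A = A"
| "unroll ([] # ws) A = unroll ws A"
| "unroll ([a] # ws) A = unroll ws (insert a A)"
| "unroll ((a # b # w) # ws) A = unroll ((b # w) # ws) (insert a A)"

lemma perm_span_word_tensor:
  assumes "perm_span d V V (word_tensor d \<Omega> wt Z [] V)"
    "finite A" "distinct (concat ws)" "A \<inter> set (concat ws) = {}" "[] \<notin> set ws" "V = A \<union> set (concat ws)"
  shows "perm_span d (A \<union> hd ` set ws) (A \<union> last ` set ws) (word_tensor d \<Omega> wt Z ws A)"
  using assms
proof (induction ws A rule: unroll.induct)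
  case (3 a ws A)
  have "perm_span d (insert a A \<union> hd ` set ws) (insert a A \<union> last ` set ws)
      (word_tensor d \<Omega> wt Z ws (insert a A))"
    by (intro 3(1)[OF 3(2)]) (use 3(3-) in auto)
  moreover have "insert a A \<union> hd ` set ws = A \<union> hd ` set ([a] # ws)"
    "insert a A \<union> last ` set ws = A \<union> last ` set ([a] # ws)" by auto
  ultimately have span: "perm_span d (A \<union> hd ` set ([a] # ws)) (A \<union> last ` set ([a] # ws))
      (word_tensor d \<Omega> wt Z ws (insert a A))" by simp
  show ?case
  proof (rule perm_span.cong[OF span])
    fix r c :: "'a \<Rightarrow> nat"
    assume "\<forall>q\<in>A \<union> last ` set ([a] # ws). c q < d"
    then show "word_tensor d \<Omega> wt Z ws (insert a A) r c = word_tensor d \<Omega> wt Z ([a] # ws) A r c"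
      using 3 by (intro word_tensor_single[symmetric]) auto
  qed
next
  case (4 a b w ws A)
  have hd: "hd v \<in> set (concat ws)" "last v \<in> set (concat ws)" if "v \<in> set ws" for v
    using hd_last_in_concat[OF that] 4(6) by auto
  have "hd v \<noteq> b" "last v \<noteq> a" if "v \<in> set ws" for v
    using hd[OF that] 4(4,5) by auto
  then have hd': "b \<notin> hd ` set ws" "a \<notin> last ` set ws" by blast+
  have span: "perm_span d (insert a A \<union> hd ` set ((b # w) # ws)) (insert a A \<union> last ` set ((b # w) # ws))
      (word_tensor d \<Omega> wt Z ((b # w) # ws) (insert a A))"
    by (intro 4(1)[OF 4(2)]) (use 4(3-) in auto)
  have P: "insert a A \<union> hd ` set ((b # w) # ws) = insert b (A \<union> hd ` set ((a # b # w) # ws))"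
    by auto
  have Q: "insert a A \<union> last ` set ((b # w) # ws) = insert a (A \<union> last ` set ((a # b # w) # ws))"
    by auto
  have "b \<notin> A \<union> hd ` set ((a # b # w) # ws)"
    using 4(4,5) hd' by auto
  moreover have "a \<notin> A \<union> last ` set ((a # b # w) # ws)"
    using 4(4,5) hd' last_in_set[of "b # w"] by auto
  ultimately have "perm_span d (A \<union> hd ` set ((a # b # w) # ws)) (A \<union> last ` set ((a # b # w) # ws))
     (\<lambda>r c. \<Sum>z<d. word_tensor d \<Omega> wt Z ((b # w) # ws) (insert a A) (r(b := z)) (c(a := z)))"
    using span unfolding P Q by (intro perm_span_contract)
  then show ?case
    using 4 by (subst (asm) word_tensor_split[symmetric]) auto
qed auto

lemma sum_PiE_insert:
  assumes "b \<notin> P"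
  shows "(\<Sum>u\<in>insert b P \<rightarrow>\<^sub>E I. f u) = (\<Sum>u\<in>P \<rightarrow>\<^sub>E I. \<Sum>z\<in>I. f (u(b := z)))"
proof -
  have inj: "inj_on (\<lambda>(y, g). g(b := y)) (I \<times> (P \<rightarrow>\<^sub>E I))"
    using assms by (intro inj_combinator)
  have "(\<Sum>u\<in>insert b P \<rightarrow>\<^sub>E I. f u) = (\<Sum>(y, g)\<in>I \<times> (P \<rightarrow>\<^sub>E I). f (g(b := y)))"
    unfolding PiE_insert_eq by (subst sum.reindex[OF inj]) (auto intro!: sum.cong)
  also have "\<dots> = (\<Sum>z\<in>I. \<Sum>u\<in>P \<rightarrow>\<^sub>E I. f (u(b := z)))"
    by (simp add: sum.cartesian_product)
  also have "\<dots> = (\<Sum>u\<in>P \<rightarrow>\<^sub>E I. \<Sum>z\<in>I. f (u(b := z)))" by (rule sum.swap)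
  finally show ?thesis .
qed

text \<open>Taking a trace along $\sigma$ means connecting the output slot of each factor $q$ with the input
slot of $\sigma\, q$. If $\sigma$ follows the words, the products inside the words are part of the
trace of the single letters.\<close>
lemma trace_word_tensor:
  assumes "finite A" "distinct (concat ws)" "A \<inter> set (concat ws) = {}" "[] \<notin> set ws"
    "V = A \<union> set (concat ws)" "\<sigma> ` (A \<union> last ` set ws) \<subseteq> A \<union> hd ` set ws"
    "\<And>w i. w \<in> set ws \<Longrightarrow> Suc i < length w \<Longrightarrow> \<sigma> (w ! i) = w ! Suc i"
  shows "(\<Sum>u\<in>(A \<union> hd ` set ws) \<rightarrow>\<^sub>E {..<d}. word_tensor d \<Omega> wt Z ws A u (u \<circ> \<sigma>))
       = (\<Sum>u\<in>V \<rightarrow>\<^sub>E {..<d}. word_tensor d \<Omega> wt Z [] V u (u \<circ> \<sigma>))"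
  using assms
proof (induction ws A rule: unroll.induct)
  case (3 a ws A)
  have "(\<Sum>u\<in>(A \<union> hd ` set ([a] # ws)) \<rightarrow>\<^sub>E {..<d}. word_tensor d \<Omega> wt Z ([a] # ws) A u (u \<circ> \<sigma>))
      = (\<Sum>u\<in>(insert a A \<union> hd ` set ws) \<rightarrow>\<^sub>E {..<d}. word_tensor d \<Omega> wt Z ws (insert a A) u (u \<circ> \<sigma>))"
  proof (rule sum.cong)
    fix u assume "u \<in> (insert a A \<union> hd ` set ws) \<rightarrow>\<^sub>E {..<d}"
    moreover have "\<sigma> a \<in> insert a A \<union> hd ` set ws" using 3(7) by auto
    ultimately have "(u \<circ> \<sigma>) a < d" by (auto simp: PiE_iff)
    then show "word_tensor d \<Omega> wt Z ([a] # ws) A u (u \<circ> \<sigma>)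
       = word_tensor d \<Omega> wt Z ws (insert a A) u (u \<circ> \<sigma>)"
      using 3 by (intro word_tensor_single) auto
  qed simp
  also have "\<dots> = (\<Sum>u\<in>V \<rightarrow>\<^sub>E {..<d}. word_tensor d \<Omega> wt Z [] V u (u \<circ> \<sigma>))"
    using 3(2-) by (intro 3(1)) auto
  finally show ?case .
next
  case (4 a b w ws A)
  have hd: "hd v \<in> set (concat ws)" "last v \<in> set (concat ws)" if "v \<in> set ws" for v
    using hd_last_in_concat[OF that] 4(5) by auto
  have "hd v \<noteq> b" "last v \<noteq> a" if "v \<in> set ws" for v
    using hd[OF that] 4(3,4) by auto
  then have hd': "b \<notin> hd ` set ws" "a \<notin> last ` set ws" by blast+
  let ?P = "A \<union> hd ` set ((a # b # w) # ws)"
  have b: "b \<notin> ?P" using 4(3,4) hd' by auto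
  have a: "a \<notin> A \<union> last ` set ((a # b # w) # ws)"
    using 4(3,4) hd' last_in_set[of "b # w"] by auto
  have \<sigma>a: "\<sigma> a = b" using 4(8)[of "a # b # w" 0] by simp
  have P: "insert a A \<union> hd ` set ((b # w) # ws) = insert b ?P" by auto
  have cons: "\<sigma> (v ! i) = v ! Suc i" if "v \<in> set ((b # w) # ws)" "Suc i < length v" for v i
    using that 4(8)[of "a # b # w" "Suc i"] 4(8)[of v i] by auto
  have "(\<Sum>u\<in>?P \<rightarrow>\<^sub>E {..<d}. word_tensor d \<Omega> wt Z ((a # b # w) # ws) A u (u \<circ> \<sigma>))
    = (\<Sum>u\<in>?P \<rightarrow>\<^sub>E {..<d}. \<Sum>z<d. word_tensor d \<Omega> wt Z ((b # w) # ws) (insert a A) (u(b := z)) ((u \<circ> \<sigma>)(a := z)))"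
    using 4 by (subst word_tensor_split) auto
  also have "\<dots> = (\<Sum>u\<in>?P \<rightarrow>\<^sub>E {..<d}. \<Sum>z<d. word_tensor d \<Omega> wt Z ((b # w) # ws) (insert a A) (u(b := z)) (u(b := z) \<circ> \<sigma>))"
  proof (intro sum.cong refl word_tensor_cong)
    fix u z x assume "x \<in> insert a A \<union> last ` set ((b # w) # ws)"
    moreover have "\<sigma> x \<noteq> b" if "x \<in> A \<union> last ` set ((a # b # w) # ws)"
      using that b 4(7) by blast
    ultimately show "((u \<circ> \<sigma>)(a := z)) x = (u(b := z) \<circ> \<sigma>) x"
      using \<sigma>a by auto
  qed
  also have "\<dots> = (\<Sum>u\<in>insert b ?P \<rightarrow>\<^sub>E {..<d}. word_tensor d \<Omega> wt Z ((b # w) # ws) (insert a A) u (u \<circ> \<sigma>))"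
    by (rule sum_PiE_insert[OF b, symmetric])
  also have "\<dots> = (\<Sum>u\<in>V \<rightarrow>\<^sub>E {..<d}. word_tensor d \<Omega> wt Z [] V u (u \<circ> \<sigma>))"
    unfolding P[symmetric]
  proof (intro 4(1))
    show "\<sigma> ` (insert a A \<union> last ` set ((b # w) # ws)) \<subseteq> insert a A \<union> hd ` set ((b # w) # ws)"
      using 4(7) \<sigma>a by auto
  qed (use 4(2-6) cons in auto)
  finally show ?case .
qed auto

section \<open>Cycles, conjugation and odd centralizers\<close>

lemma orbit_eq_if_in_orbit:
  assumes "permutation f" "y \<in> orbit f x"
  shows "orbit f y = orbit f x"
  using assms by (intro orbit_cyclic_eq3 cyclic_on_orbit')

lemma in_orbit_funpow_iff: "permutation f \<Longrightarrow> y \<in> orbit f x \<longleftrightarrow> (\<exists>i. y = (f ^^ i) x)"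
  by (simp add: orbit_altdef_permutation)

lemma funpow_eq_iff_mod_card_orbit:
  assumes "permutation f"
  shows "(f ^^ m) x = (f ^^ n) x \<longleftrightarrow> m mod card (orbit f x) = n mod card (orbit f x)"
    and "card (orbit f x) > 0"
proof -
  let ?k = "funpow_dist1 f x x"
  have x: "x \<in> orbit f x" using assms by (rule permutation_self_in_orbit)
  have card: "card (orbit f x) = ?k"
    using orbit_conv_funpow_dist1[OF x] card_image[OF inj_on_funpow_dist1[OF x]] by simp
  then show "card (orbit f x) > 0" by simp
  have fix_x: "(f ^^ ?k) x = x" using x by (rule funpow_dist1_prop)
  have "(f ^^ m) x = (f ^^ n) x \<longleftrightarrow> (f ^^ (m mod ?k)) x = (f ^^ (n mod ?k)) x"
    using fix_x by (simp only: funpow_mod_eq)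
  also have "\<dots> \<longleftrightarrow> m mod ?k = n mod ?k"
    using inj_on_funpow_dist1[OF x] by (auto dest!: inj_onD)
  finally show "(f ^^ m) x = (f ^^ n) x \<longleftrightarrow> m mod card (orbit f x) = n mod card (orbit f x)"
    unfolding card .
qed

text \<open>Cycles of equal length are isomorphic as sets with a cyclic permutation, with freely chosen base
points: $f^i x$ is sent to $g^i y$.\<close>
lemma orbit_transport:
  assumes f: "permutation f" and g: "permutation g"
    and card: "card (orbit f x) = card (orbit g y)"
  obtains \<beta> where "bij_betw \<beta> (orbit f x) (orbit g y)" "\<beta> x = y"
    "\<And>z. z \<in> orbit f x \<Longrightarrow> \<beta> (f z) = g (\<beta> z)"
proof -
  define \<beta> where "\<beta> z = (g ^^ (SOME i. z = (f ^^ i) x)) y" for z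
  have \<beta>: "\<beta> ((f ^^ i) x) = (g ^^ i) y" for i
  proof -
    have "(f ^^ i) x = (f ^^ (SOME j. (f ^^ i) x = (f ^^ j) x)) x" by (rule someI) simp
    then show ?thesis
      unfolding \<beta>_def using funpow_eq_iff_mod_card_orbit[OF f] funpow_eq_iff_mod_card_orbit[OF g] card
      by metis
  qed
  show ?thesis
  proof
    show "bij_betw \<beta> (orbit f x) (orbit g y)"
      unfolding bij_betw_def
    proof
      show "inj_on \<beta> (orbit f x)"
        unfolding in_orbit_funpow_iff[OF f] inj_on_def
        using \<beta> funpow_eq_iff_mod_card_orbit(1)[OF f] funpow_eq_iff_mod_card_orbit(1)[OF g] card
        by (metis in_orbit_funpow_iff[OF f])
      show "\<beta> ` orbit f x = orbit g y"
      proof -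
        have "orbit f x = range (\<lambda>i. (f ^^ i) x)" "orbit g y = range (\<lambda>i. (g ^^ i) y)"
          by (auto simp: orbit_altdef_permutation f g)
        then show ?thesis by (simp add: image_image \<beta>)
      qed
    qed
    show "\<beta> x = y" using \<beta>[of 0] by simp
    show "\<beta> (f z) = g (\<beta> z)" if z: "z \<in> orbit f x" for z
    proof -
      obtain i where "z = (f ^^ i) x" using z unfolding in_orbit_funpow_iff[OF f] by blast
      then show ?thesis using \<beta>[of i] \<beta>[of "Suc i"] by simp
    qed
  qed
qed

text \<open>Permutations of equal cycle type are conjugate: the isomorphisms of corresponding cycles are glued
together.\<close>
lemma conjugate_if_orbit_cards_eq:
  assumes S: "finite S" and f: "f permutes S" and g: "g permutes S"
    and F: "bij_betw F (orbit f ` S) (orbit g ` S)"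
    and card: "\<And>c. c \<in> orbit f ` S \<Longrightarrow> card (F c) = card c"
  obtains \<tau> where "\<tau> permutes S" "\<tau> \<circ> f = g \<circ> \<tau>"
proof -
  have pf: "permutation f" and pg: "permutation g"
    using S f g permutation_permutes by blast+
  have "\<exists>\<beta>. bij_betw \<beta> c (F c) \<and> (\<forall>z\<in>c. \<beta> (f z) = g (\<beta> z))" if c: "c \<in> orbit f ` S" for c
  proof -
    obtain x where x: "c = orbit f x" using c by blast
    have "F c \<in> orbit g ` S" using F c by (auto simp: bij_betw_def)
    then obtain y where "F c = orbit g y" by blast
    then show ?thesis using orbit_transport[OF pf pg, of x y] card[OF c] x by metis
  qed
  then obtain \<beta> where \<beta>: "\<And>c. c \<in> orbit f ` S \<Longrightarrow> bij_betw (\<beta> c) c (F c)"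
    "\<And>c z. c \<in> orbit f ` S \<Longrightarrow> z \<in> c \<Longrightarrow> \<beta> c (f z) = g (\<beta> c z)"
    by metis
  define \<tau> where "\<tau> x = (if x \<in> S then \<beta> (orbit f x) x else x)" for x
  have self: "x \<in> orbit f x" for x using pf by (rule permutation_self_in_orbit)
  have in_F: "\<tau> x \<in> F (orbit f x)" if "x \<in> S" for x
    using \<beta>(1)[of "orbit f x"] self[of x] that by (auto simp: \<tau>_def bij_betw_def)
  have F_orbit: "F (orbit f x) = orbit g (\<tau> x)" "F (orbit f x) \<subseteq> S" if "x \<in> S" for x
  proof -
    have "F (orbit f x) \<in> orbit g ` S" using F that by (auto simp: bij_betw_def)
    then obtain y where y: "F (orbit f x) = orbit g y" "y \<in> S" by blast
    then show "F (orbit f x) = orbit g (\<tau> x)"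
      using orbit_eq_if_in_orbit[OF pg] in_F[OF that] by metis
    show "F (orbit f x) \<subseteq> S" using y permutes_orbit_subset[OF g] by auto
  qed
  have "inj_on \<tau> S"
  proof (rule inj_onI)
    fix x y assume xy: "x \<in> S" "y \<in> S" "\<tau> x = \<tau> y"
    then have "F (orbit f x) = F (orbit f y)" using F_orbit(1) by metis
    then have eq: "orbit f x = orbit f y"
      using F xy by (auto simp: bij_betw_def dest: inj_onD)
    have "inj_on (\<beta> (orbit f x)) (orbit f x)" using \<beta>(1)[of "orbit f x"] xy by (auto simp: bij_betw_def)
    then show "x = y" using xy eq self[of x] self[of y] by (auto simp: \<tau>_def dest: inj_onD)
  qed
  moreover have "\<tau> ` S \<subseteq> S" using in_F F_orbit(2) by blast
  ultimately have "bij_betw \<tau> S S" using S by (simp add: bij_betw_def endo_inj_surj)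
  then have \<tau>: "\<tau> permutes S" by (rule bij_imp_permutes) (simp add: \<tau>_def)
  have "\<tau> (f x) = g (\<tau> x)" for x
  proof (cases "x \<in> S")
    case True
    then have "f x \<in> S" using f by (simp add: permutes_in_image)
    moreover have "orbit f (f x) = orbit f x"
      using orbit_eq_if_in_orbit[OF pf, of "f x" x] by (simp add: orbit.base)
    ultimately show ?thesis using True \<beta>(2)[of "orbit f x" x] self[of x] by (simp add: \<tau>_def)
  next
    case False
    then show ?thesis using f g by (simp add: permutes_not_in \<tau>_def)
  qed
  then show ?thesis using that[of \<tau>] \<tau> by (simp add: fun_eq_iff)
qed

lemma sign_cycle_of_list: "distinct cs \<Longrightarrow> cs \<noteq> [] \<Longrightarrow> sign (cycle_of_list cs) = (-1) ^ (length cs - 1)"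
proof (induction cs rule: cycle_of_list.induct)
  case (1 i j cs)
  have "sign (cycle_of_list (i # j # cs)) = sign (transpose i j) * sign (cycle_of_list (j # cs))"
    unfolding cycle_of_list.simps(1)[abs_def]
    by (intro sign_compose permutation_swap_id permutation_of_cycle)
  then show ?case using 1 by (simp add: sign_swap_id del: cycle_of_list.simps)
qed auto

text \<open>The cycle of even length, taken by itself, is odd and commutes with $f$.\<close>
lemma odd_commuting_if_even_orbit:
  assumes f: "f permutes S" "finite S" and x: "x \<in> S" and even: "even (card (orbit f x))"
  obtains \<pi> where "\<pi> permutes S" "\<pi> \<circ> f = f \<circ> \<pi>" "sign \<pi> = -1"
proof -
  have pf: "permutation f" using f permutation_permutes by blast
  let ?c = "support f x"
  define \<pi> where "\<pi> = cycle_of_list ?c"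
  have set: "set ?c = orbit f x"
    unfolding support_set[OF pf] orbit_altdef_permutation[OF pf] by auto
  have dist: "distinct ?c" using pf by (rule cycle_of_permutation)
  have len: "length ?c = card (orbit f x)" using distinct_card[OF dist] set by simp
  then have "?c \<noteq> []" using funpow_eq_iff_mod_card_orbit(2)[OF pf, of x] by force
  then have "sign \<pi> = (-1) ^ (card (orbit f x) - 1)"
    using sign_cycle_of_list[OF dist] unfolding \<pi>_def len by blast
  also have "\<dots> = -1"
    using even funpow_eq_iff_mod_card_orbit(2)[OF pf, of x] by simp
  finally have sgn: "sign \<pi> = -1" .
  have \<pi>_in: "\<pi> z = f z" if "z \<in> orbit f x" for z
    unfolding \<pi>_def by (rule cycle_restrict[OF pf, symmetric]) (use that set in simp)
  have \<pi>_out: "\<pi> z = z" if "z \<notin> orbit f x" for z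
    unfolding \<pi>_def by (rule id_outside_supp) (use that set in simp)
  have f_in: "f z \<in> orbit f x \<longleftrightarrow> z \<in> orbit f x" for z
    using orbit_eq_if_in_orbit[OF pf] by (metis orbit.base orbit.step permutation_self_in_orbit pf)
  have "\<pi> (f z) = f (\<pi> z)" for z
    using \<pi>_in \<pi>_out f_in by metis
  moreover have "\<pi> permutes S"
    using cycle_permutes[of ?c] set permutes_orbit_subset[OF f(1) x] permutes_subset
    unfolding \<pi>_def by metis
  ultimately show ?thesis using that sgn by (auto simp: fun_eq_iff)
qed

text \<open>The product of the transpositions of $a$ and $\beta\, a$.\<close>
lemma exchange_permutation:
  assumes "finite A" "inj_on \<beta> A" "A \<inter> \<beta> ` A = {}"
  shows "\<exists>\<pi>. \<pi> permutes (A \<union> \<beta> ` A) \<and> (\<forall>a\<in>A. \<pi> a = \<beta> a \<and> \<pi> (\<beta> a) = a) \<and> sign \<pi> = (-1) ^ card A"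
  using assms
proof (induction A rule: finite_induct)
  case empty
  show ?case by (intro exI[of _ id]) auto
next
  case (insert a A)
  then obtain \<pi> where \<pi>: "\<pi> permutes (A \<union> \<beta> ` A)" "\<forall>a\<in>A. \<pi> a = \<beta> a \<and> \<pi> (\<beta> a) = a"
    "sign \<pi> = (-1) ^ card A" by auto
  let ?\<pi> = "transpose a (\<beta> a) \<circ> \<pi>"
  have notin: "a \<notin> A \<union> \<beta> ` A" "\<beta> a \<notin> A \<union> \<beta> ` A" "a \<noteq> \<beta> a" using insert by auto
  have perm: "permutation \<pi>" by (rule permutes_imp_permutation[OF _ \<pi>(1)]) (use insert(1) in simp)
  have "?\<pi> permutes (insert a A \<union> \<beta> ` insert a A)"
    by (rule permutes_compose[OF permutes_subset[OF \<pi>(1)]])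
      (auto intro!: permutes_swap_id)
  moreover have "?\<pi> x = \<beta> x \<and> ?\<pi> (\<beta> x) = x" if "x \<in> insert a A" for x
  proof (cases "x = a")
    case True
    then show ?thesis using notin permutes_not_in[OF \<pi>(1)] by simp
  next
    case False
    then have "x \<in> A" using that by simp
    then have "\<pi> x = \<beta> x" "\<pi> (\<beta> x) = x" using \<pi>(2) by auto
    moreover have "\<beta> x \<noteq> \<beta> a" using \<open>x \<in> A\<close> notin(2) by (metis UnI2 imageI)
    moreover have "x \<noteq> a" "x \<noteq> \<beta> a" "\<beta> x \<noteq> a" using \<open>x \<in> A\<close> notin by auto
    ultimately show ?thesis by (simp add: transpose_def)
  qed
  moreover have "sign ?\<pi> = (-1) ^ card (insert a A)"
    using insert(1,2) notin by (simp add: sign_compose[OF permutation_swap_id perm] sign_swap_id \<pi>(3))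
  ultimately show ?case by blast
qed

text \<open>Two cycles of equal odd length $k$ can be exchanged by $k$ transpositions.\<close>
lemma odd_commuting_if_equal_odd_orbits:
  assumes f: "f permutes S" "finite S" and xy: "x \<in> S" "y \<in> S" and odd: "odd (card (orbit f x))"
    and card: "card (orbit f y) = card (orbit f x)" and neq: "orbit f x \<noteq> orbit f y"
  obtains \<pi> where "\<pi> permutes S" "\<pi> \<circ> f = f \<circ> \<pi>" "sign \<pi> = -1"
proof -
  have pf: "permutation f" using f permutation_permutes by blast
  let ?X = "orbit f x" and ?Y = "orbit f y"
  obtain \<beta> where \<beta>: "bij_betw \<beta> ?X ?Y" "\<And>z. z \<in> ?X \<Longrightarrow> \<beta> (f z) = f (\<beta> z)"
    using orbit_transport[OF pf pf card[symmetric]] by metis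
  have fin: "finite ?X" using finite_subset permutes_orbit_subset f xy by metis
  have disj: "?X \<inter> ?Y = {}" using orbit_eq_if_in_orbit[OF pf] neq by blast
  obtain \<pi> where \<pi>: "\<pi> permutes (?X \<union> ?Y)" "\<forall>a\<in>?X. \<pi> a = \<beta> a \<and> \<pi> (\<beta> a) = a" "sign \<pi> = -1"
    using exchange_permutation[OF fin, of \<beta>] \<beta>(1) disj odd by (auto simp: bij_betw_def)
  have f_in: "f z \<in> orbit f w \<longleftrightarrow> z \<in> orbit f w" for z w
    using orbit_eq_if_in_orbit[OF pf] by (metis orbit.base orbit.step permutation_self_in_orbit pf)
  have "\<pi> (f z) = f (\<pi> z)" for z
  proof -
    consider "z \<in> ?X" | w where "w \<in> ?X" "z = \<beta> w" | "z \<notin> ?X \<union> ?Y"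
      using \<beta>(1) by (auto simp: bij_betw_def)
    then show ?thesis
    proof cases
      case 1
      then show ?thesis using \<pi>(2) \<beta>(2) f_in[of z x] by simp
    next
      case 2
      then have "f z = \<beta> (f w)" using \<beta>(2) by simp
      then show ?thesis using \<pi>(2) 2 f_in[of w x] by simp
    next
      case 3
      then have "f z \<notin> ?X \<union> ?Y" using f_in by blast
      then show ?thesis using 3 \<pi>(1) by (simp add: permutes_not_in)
    qed
  qed
  moreover have "\<pi> permutes S"
    using \<pi>(1) permutes_orbit_subset[OF f(1)] xy by (meson Un_least permutes_subset)
  ultimately show ?thesis using that \<pi>(3) by (auto simp: fun_eq_iff)
qed

section \<open>Alternating class functions\<close>

text \<open>The traces of an alternating tensor against the permutations of its slots. A conjugation permutes the
slots, which costs a sign. The second axiom is the fundamental trace identity in dimension $d$: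
antisymmetrizing $d + 1$ slots gives zero.\<close>
locale alternating_class_function =
  fixes S :: "'a set" and d :: nat and G :: "('a \<Rightarrow> 'a) \<Rightarrow> rat"
  assumes finite_S: "finite S"
    and conjugate: "\<lbrakk>\<sigma> permutes S; \<sigma>' permutes S; \<tau> permutes S; \<tau> \<circ> \<sigma> = \<sigma>' \<circ> \<tau>\<rbrakk>
      \<Longrightarrow> G \<sigma>' = of_int (sign \<tau>) * G \<sigma>"
    and fundamental: "\<lbrakk>\<sigma> permutes S; A \<subseteq> S; card A = Suc d\<rbrakk>
      \<Longrightarrow> (\<Sum>\<rho> | \<rho> permutes A. of_int (sign \<rho>) * G (\<sigma> \<circ> \<rho>)) = 0"
begin

lemma permutation_if_permutes: "\<sigma> permutes S \<Longrightarrow> permutation \<sigma>"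
  using finite_S permutation_permutes by blast

text \<open>An odd permutation that commutes with $\sigma$ forces $G\,\sigma = - G\,\sigma$, here and in the
next lemma.\<close>
lemma odd_card_orbit:
  assumes "\<sigma> permutes S" "G \<sigma> \<noteq> 0" "x \<in> S"
  shows "odd (card (orbit \<sigma> x))"
proof
  assume "even (card (orbit \<sigma> x))"
  then obtain \<pi> where "\<pi> permutes S" "\<pi> \<circ> \<sigma> = \<sigma> \<circ> \<pi>" "sign \<pi> = -1"
    using odd_commuting_if_even_orbit assms finite_S by metis
  then have "G \<sigma> = - G \<sigma>" using conjugate[of \<sigma> \<sigma> \<pi>] assms(1) by simp
  then show False using assms(2) by simp
qed

lemma orbits_eq_if_cards_eq:
  assumes "\<sigma> permutes S" "G \<sigma> \<noteq> 0" "x \<in> S" "y \<in> S" "card (orbit \<sigma> x) = card (orbit \<sigma> y)"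
  shows "orbit \<sigma> x = orbit \<sigma> y"
proof (rule ccontr)
  assume "orbit \<sigma> x \<noteq> orbit \<sigma> y"
  then obtain \<pi> where "\<pi> permutes S" "\<pi> \<circ> \<sigma> = \<sigma> \<circ> \<pi>" "sign \<pi> = -1"
    using odd_commuting_if_equal_odd_orbits[OF assms(1) finite_S assms(3,4) odd_card_orbit[OF assms(1-3)]]
      assms(5) by metis
  then have "G \<sigma> = - G \<sigma>" using conjugate[of \<sigma> \<sigma> \<pi>] assms(1) by simp
  then show False using assms(2) by simp
qed

text \<open>A form of the Amitsur--Levitzki theorem. In a cycle of length at least $2d$, the fundamental trace
identity is applied to $d + 1$ points that are two steps apart. Each of its terms is either $0$ or
$G\,\sigma$, with the same sign throughout, so that their sum cannot vanish unless
$G\,\sigma = 0$.\<close>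
lemma card_orbit_less:
  assumes \<sigma>: "\<sigma> permutes S" and nz: "G \<sigma> \<noteq> 0" and y: "y \<in> S"
  shows "card (orbit \<sigma> y) < 2 * d"
proof (rule ccontr)
  define D where "D = card (orbit \<sigma> y)"
  define e where "e = D - 2 * d"
  assume "\<not> card (orbit \<sigma> y) < 2 * d"
  moreover have "odd D" unfolding D_def by (rule odd_card_orbit[OF \<sigma> nz y])
  ultimately have "D \<ge> 2 * d" "odd (D - 2 * d)" by (auto simp: D_def)
  then have De: "D = e + 2 * d" "odd e" by (simp_all add: e_def)
  then have "e > 0" by (simp add: odd_pos)
  note De = De this
  have p\<sigma>: "permutation \<sigma>" by (rule permutation_if_permutes[OF \<sigma>])
  define b where "b i = (\<sigma> ^^ i) y" for i
  have b_Suc: "\<sigma> (b i) = b (Suc i)" for i by (simp add: b_def)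
  have b_eq: "b i = b j \<longleftrightarrow> i mod D = j mod D" for i j
    unfolding b_def D_def by (rule funpow_eq_iff_mod_card_orbit(1)[OF p\<sigma>])
  have b_inj: "b i = b j \<longleftrightarrow> i = j" if "i < D" "j < D" for i j
    using that by (simp add: b_eq)
  let ?O = "orbit \<sigma> y"
  have O: "z \<in> ?O \<longleftrightarrow> (\<exists>i<D. z = b i)" for z
  proof -
    have "z \<in> ?O \<longleftrightarrow> (\<exists>i. z = b i)" by (simp add: in_orbit_funpow_iff[OF p\<sigma>] b_def)
    also have "\<dots> \<longleftrightarrow> (\<exists>i<D. z = b i)"
      using b_eq De by (metis add_gr_0 mod_less_divisor mod_mod_trivial)
    finally show ?thesis .
  qed
  have OS: "?O \<subseteq> S" by (rule permutes_orbit_subset[OF \<sigma> y])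
  have finO: "finite ?O" using OS finite_S finite_subset by blast
  \<comment> \<open>The cycle consists of the path b 0, ..., b (e - 1) and of the d pairs b (e + 2 k),
    b (e + 2 k + 1). A contains the end of the path and the second members of the pairs, E the first
    members. A permutation \<rho> of A changes the order in which the path and the pairs are linked.\<close>
  define A where "A = (\<lambda>k. b (e - 1 + 2 * k)) ` {..d}"
  define E where "E = (\<lambda>k. b (e + 2 * k)) ` {..<d}"
  have A_iff: "b i \<in> A \<longleftrightarrow> e - 1 \<le> i \<and> even i" if "i < D" for i
  proof
    assume "b i \<in> A"
    then obtain k where "k \<le> d" "b i = b (e - 1 + 2 * k)" by (auto simp: A_def)
    then have "i = e - 1 + 2 * k" using that De b_inj[of i "e - 1 + 2 * k"] by simp
    then show "e - 1 \<le> i \<and> even i" using De by simp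
  next
    assume i: "e - 1 \<le> i \<and> even i"
    then have "even (i - (e - 1))" using De by simp
    then obtain k where "i - (e - 1) = 2 * k" by blast
    then have "i = e - 1 + 2 * k" "k \<le> d" using i that De by auto
    then show "b i \<in> A" by (auto simp: A_def)
  qed
  have AO: "A \<subseteq> ?O"
  proof
    fix z assume "z \<in> A"
    then obtain k where "k \<le> d" "z = b (e - 1 + 2 * k)" by (auto simp: A_def)
    then show "z \<in> ?O" unfolding O using De by (intro exI[of _ "e - 1 + 2 * k"]) simp
  qed
  have cardA: "card A = Suc d"
  proof -
    have "inj_on (\<lambda>k. b (e - 1 + 2 * k)) {..d}"
    proof (rule inj_onI)
      fix j k assume jk: "j \<in> {..d}" "k \<in> {..d}" "b (e - 1 + 2 * j) = b (e - 1 + 2 * k)"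
      moreover have "e - 1 + 2 * j < D" "e - 1 + 2 * k < D" using jk De by auto
      ultimately show "j = k" using b_inj[of "e - 1 + 2 * j" "e - 1 + 2 * k"] by simp
    qed
    then show ?thesis by (simp add: A_def card_image)
  qed
  have E_A: "z \<notin> A" if z: "z \<in> E" for z
  proof -
    obtain k where "k < d" "z = b (e + 2 * k)" using z by (auto simp: E_def)
    then show ?thesis using A_iff[of "e + 2 * k"] De by simp
  qed
  have \<sigma>E_A: "\<sigma> z \<in> A" if z: "z \<in> E" for z
  proof -
    obtain k where "k < d" "z = b (e + 2 * k)" using z by (auto simp: E_def)
    then show ?thesis using A_iff[of "Suc (e + 2 * k)"] De by (simp add: b_Suc)
  qed
  have b0: "b 0 = y" by (simp add: b_def)
  have \<sigma>A: "\<sigma> z \<in> insert y E" if z: "z \<in> A" for z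
  proof -
    obtain k where k: "k \<le> d" "z = b (e - 1 + 2 * k)" using z by (auto simp: A_def)
    then have *: "\<sigma> z = b (e + 2 * k)" using De by (simp add: b_Suc)
    show ?thesis
    proof (cases "k = d")
      case True
      then have "b (e + 2 * k) = b 0" unfolding b_eq using De by simp
      then show ?thesis using * b0 by simp
    next
      case False
      then show ?thesis using * k by (auto simp: E_def)
    qed
  qed
  \<comment> \<open>An order that breaks up the cycle contributes 0; any other one contributes G \<sigma>.\<close>
  have terms: "of_int (sign \<rho>) * G (\<sigma> \<circ> \<rho>) \<in> {0, G \<sigma>}" if \<rho>: "\<rho> permutes A" for \<rho>
  proof (cases "G (\<sigma> \<circ> \<rho>) = 0")
    case False
    define \<psi> where "\<psi> = \<sigma> \<circ> \<rho>"
    have AS: "A \<subseteq> S" using AO OS by blast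
    have \<rho>S: "\<rho> permutes S" by (rule permutes_subset[OF \<rho> AS])
    have \<psi>: "\<psi> permutes S" unfolding \<psi>_def by (rule permutes_compose[OF \<rho>S \<sigma>])
    have p\<psi>: "permutation \<psi>" by (rule permutation_if_permutes[OF \<psi>])
    have \<psi>_out: "\<psi> z = \<sigma> z" if "z \<notin> A" for z using that \<rho> by (simp add: \<psi>_def permutes_not_in)
    have \<psi>_A: "\<psi> z \<in> insert y E" if "z \<in> A" for z
      using that \<rho> \<sigma>A by (simp add: \<psi>_def permutes_in_image)
    have in_orbit: "\<psi> z \<in> orbit \<psi> w \<longleftrightarrow> z \<in> orbit \<psi> w" for z w
      using orbit_eq_if_in_orbit[OF p\<psi>] by (metis orbit.base orbit.step permutation_self_in_orbit p\<psi>)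
    have start: "(\<psi> ^^ j) y = b j" if "j < e" for j
      using that
    proof (induction j)
      case (Suc j)
      then have "\<not> e - 1 \<le> j" "j < D" using De by auto
      then have "b j \<notin> A" using A_iff[of j] by simp
      then show ?case using Suc by (simp add: \<psi>_out b_Suc)
    qed (simp add: b0)
    have \<psi>O: "\<psi> z \<in> ?O" if "z \<in> ?O" for z
    proof -
      have "\<rho> z \<in> ?O" using that AO \<rho> by (metis permutes_in_image permutes_not_in subsetD)
      then show ?thesis by (simp add: \<psi>_def orbit.step)
    qed
    have sub: "orbit \<psi> z \<subseteq> ?O" if z: "z \<in> ?O" for z
    proof
      fix w assume "w \<in> orbit \<psi> z"
      then show "w \<in> ?O" by induction (use z \<psi>O in auto)
    qed
    have yO: "y \<in> ?O" by (rule permutation_self_in_orbit[OF p\<sigma>])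
    \<comment> \<open>A cycle that misses the path would consist of complete pairs and have even length.\<close>
    have single: "orbit \<psi> y = ?O"
    proof (rule ccontr)
      assume "orbit \<psi> y \<noteq> ?O"
      then obtain z where z: "z \<in> ?O" "z \<notin> orbit \<psi> y" using sub[OF yO] by blast
      let ?B = "orbit \<psi> z"
      have disj: "?B \<inter> orbit \<psi> y = {}"
        using orbit_eq_if_in_orbit[OF p\<psi>] permutation_self_in_orbit[OF p\<psi>] z(2) by blast
      have split: "?B = (?B \<inter> E) \<union> \<psi> ` (?B \<inter> E)"
      proof (intro subset_antisym subsetI)
        fix w assume w: "w \<in> ?B"
        then obtain i where i: "i < D" "w = b i" using sub[OF z(1)] O by blast
        have "\<not> i < e"
        proof
          assume "i < e"
          then have "w \<in> orbit \<psi> y" using start i unfolding in_orbit_funpow_iff[OF p\<psi>] by metis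
          then show False using disj w by blast
        qed
        show "w \<in> (?B \<inter> E) \<union> \<psi> ` (?B \<inter> E)"
        proof (cases "odd i")
          case True
          then have "even (i - e)" using De \<open>\<not> i < e\<close> by simp
          then obtain k where "i - e = 2 * k" by blast
          then have "i = e + 2 * k" "k < d" using i De \<open>\<not> i < e\<close> by auto
          then show ?thesis using w i by (auto simp: E_def)
        next
          case False
          then have "odd (i - e)" using De \<open>\<not> i < e\<close> by simp
          then obtain k where "i - e = 2 * k + 1" using oddE by blast
          then have k: "i = Suc (e + 2 * k)" "k < d" using i De \<open>\<not> i < e\<close> by auto
          then have E: "b (e + 2 * k) \<in> E" by (auto simp: E_def)
          then have "\<psi> (b (e + 2 * k)) = w" using k i E_A by (simp add: \<psi>_out b_Suc)
          moreover from this have "b (e + 2 * k) \<in> ?B" using w in_orbit by metis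
          ultimately show ?thesis using E by blast
        qed
      qed (use in_orbit in auto)
      have "\<psi> ` (?B \<inter> E) \<subseteq> A" using E_A \<sigma>E_A \<psi>_out by auto
      then have "(?B \<inter> E) \<inter> \<psi> ` (?B \<inter> E) = {}" using E_A by blast
      moreover have "card (\<psi> ` (?B \<inter> E)) = card (?B \<inter> E)"
        using permutes_inj[OF \<psi>] by (intro card_image) (auto simp: inj_on_def)
      moreover have "finite (?B \<inter> E)" by (simp add: E_def)
      ultimately have "card ?B = card (?B \<inter> E) + card (?B \<inter> E)"
        using split by (metis card_Un_disjoint finite_imageI)
      moreover have "odd (card ?B)"
        using odd_card_orbit[OF \<psi>] False z(1) OS by (auto simp: \<psi>_def)
      ultimately show False by simp
    qed
    \<comment> \<open>The permutation \<tau> that conjugates \<sigma> into \<psi> and fixes y fixes the whole path and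
      permutes the pairs.\<close>
    obtain \<beta> where \<beta>: "bij_betw \<beta> ?O ?O" "\<beta> y = y" "\<And>z. z \<in> ?O \<Longrightarrow> \<beta> (\<sigma> z) = \<psi> (\<beta> z)"
      using orbit_transport[OF p\<sigma> p\<psi>, of y y] unfolding single by blast
    define \<tau> where "\<tau> z = (if z \<in> ?O then \<beta> z else z)" for z
    have "bij_betw \<tau> ?O ?O" using \<beta>(1) by (subst bij_betw_cong[where g = \<beta>]) (auto simp: \<tau>_def)
    then have \<tau>O: "\<tau> permutes ?O" by (rule bij_imp_permutes) (simp add: \<tau>_def)
    then have \<tau>: "\<tau> permutes S" by (rule permutes_subset[OF _ OS])
    have \<sigma>O: "\<sigma> z \<in> ?O \<longleftrightarrow> z \<in> ?O" for z
      using orbit_eq_if_in_orbit[OF p\<sigma>] by (metis orbit.base orbit.step permutation_self_in_orbit p\<sigma>)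
    have \<tau>\<sigma>: "\<tau> (\<sigma> z) = \<psi> (\<tau> z)" for z
    proof (cases "z \<in> ?O")
      case False
      then have "\<psi> z = \<sigma> z" using AO \<psi>_out by blast
      then show ?thesis using False \<sigma>O by (simp add: \<tau>_def)
    qed (use \<sigma>O \<beta>(3) in \<open>auto simp: \<tau>_def\<close>)
    have \<tau>b: "\<tau> (b i) = (\<psi> ^^ i) y" for i
    proof (induction i)
      case (Suc i)
      then show ?case using \<tau>\<sigma>[of "b i"] by (simp add: b_Suc)
    qed (simp add: b0 \<tau>_def \<beta>(2))
    have \<psi>y: "(\<psi> ^^ i) y = y \<longleftrightarrow> i mod D = 0" for i
      using funpow_eq_iff_mod_card_orbit(1)[OF p\<psi>, of i y 0] unfolding single by (simp add: D_def)
    have stepE: "(\<psi> ^^ (e + 2 * k)) y \<in> E" if "k < d" "(\<psi> ^^ (e - 1 + 2 * k)) y \<in> A" for k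
    proof -
      have "(\<psi> ^^ (e + 2 * k)) y = \<psi> ((\<psi> ^^ (e - 1 + 2 * k)) y)"
        using De by (cases e) auto
      then have "(\<psi> ^^ (e + 2 * k)) y \<in> insert y E" using \<psi>_A that by simp
      moreover have "(\<psi> ^^ (e + 2 * k)) y \<noteq> y" using \<psi>y that De by simp
      ultimately show ?thesis by simp
    qed
    have step: "(\<psi> ^^ (e - 1 + 2 * k)) y \<in> A" if "k \<le> d" for k
      using that
    proof (induction k)
      case 0
      then show ?case using start[of "e - 1"] A_iff[of "e - 1"] De by simp
    next
      case (Suc k)
      then have E: "(\<psi> ^^ (e + 2 * k)) y \<in> E" using stepE by simp
      have "(\<psi> ^^ (Suc (e + 2 * k))) y = \<sigma> ((\<psi> ^^ (e + 2 * k)) y)"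
        using E_A[OF E] \<psi>_out by simp
      moreover have "e - 1 + 2 * Suc k = Suc (e + 2 * k)" using De by simp
      ultimately show ?case using \<sigma>E_A[OF E] by simp
    qed
    have \<tau>E: "\<tau> z \<in> E" if z: "z \<in> E" for z
    proof -
      obtain k where k: "k < d" "z = b (e + 2 * k)" using z by (auto simp: E_def)
      then show ?thesis using stepE[of k] step[of k] by (simp add: \<tau>b)
    qed
    \<comment> \<open>\<tau> moves first and second members in the same way: it is the product of its restriction to E
      and of the conjugate of this restriction under the exchange s of E and \<sigma> ` E. So \<tau> is even.\<close>
    define \<tau>1 where "\<tau>1 z = (if z \<in> E then \<tau> z else z)" for z
    have finE: "finite E" by (simp add: E_def)
    have "inj_on \<tau>1 E" using permutes_inj[OF \<tau>] by (auto simp: \<tau>1_def inj_on_def)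
    moreover have "\<tau>1 ` E \<subseteq> E" using \<tau>E by (auto simp: \<tau>1_def)
    ultimately have "bij_betw \<tau>1 E E" using finE by (simp add: bij_betw_def endo_inj_surj)
    then have \<tau>1: "\<tau>1 permutes E" by (rule bij_imp_permutes) (simp add: \<tau>1_def)
    have "inj_on \<sigma> E" using permutes_inj[OF \<sigma>] by (auto simp: inj_on_def)
    moreover have disjE: "E \<inter> \<sigma> ` E = {}" using E_A \<sigma>E_A by blast
    ultimately obtain s where s: "s permutes (E \<union> \<sigma> ` E)" "\<And>z. z \<in> E \<Longrightarrow> s z = \<sigma> z"
      "\<And>z. z \<in> E \<Longrightarrow> s (\<sigma> z) = z"
      using exchange_permutation[OF finE, of \<sigma>] by blast
    have "\<tau> z = \<tau>1 (s (\<tau>1 (s z)))" for z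
    proof -
      consider "z \<in> E" | w where "w \<in> E" "z = \<sigma> w" | "z \<notin> E \<union> \<sigma> ` E" by blast
      then show ?thesis
      proof cases
        case 1
        have "\<sigma> z \<notin> E" using 1 disjE by blast
        then show ?thesis using 1 s by (simp add: \<tau>1_def)
      next
        case 2
        have "\<tau> z = \<sigma> (\<tau> w)" using 2 \<tau>\<sigma> \<psi>_out E_A \<tau>E by metis
        moreover have "\<sigma> (\<tau> w) \<notin> E" using \<tau>E[OF 2(1)] disjE by blast
        ultimately show ?thesis using 2 s \<tau>E by (simp add: \<tau>1_def)
      next
        case 3
        have "\<tau> z = z"
        proof (cases "z \<in> ?O")
          case True
          then obtain i where i: "i < D" "z = b i" using O by blast
          have "i < e"
          proof (rule ccontr)
            assume "\<not> i < e"
            define k where "k = (i - e) div 2"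
            have "i = e + 2 * k \<or> i = Suc (e + 2 * k)" using \<open>\<not> i < e\<close> by (auto simp: k_def)
            moreover have "k < d" using calculation i De by auto
            moreover from this have "b (e + 2 * k) \<in> E" by (simp add: E_def)
            ultimately have "z \<in> E \<union> \<sigma> ` E" using i b_Suc[of "e + 2 * k"] by (metis UnI1 UnI2 imageI)
            then show False using 3 by blast
          qed
          then show ?thesis using start i \<tau>b by simp
        qed (simp add: \<tau>_def)
        moreover have "s z = z" using 3 s(1) by (simp add: permutes_not_in)
        ultimately show ?thesis using 3 by (simp add: \<tau>1_def)
      qed
    qed
    then have "\<tau> = \<tau>1 \<circ> (s \<circ> (\<tau>1 \<circ> s))" by (simp add: fun_eq_iff)
    moreover have "permutation \<tau>1" "permutation s"
      using permutes_imp_permutation[OF _ \<tau>1] permutes_imp_permutation[OF _ s(1)] finE by auto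
    ultimately have "sign \<tau> = 1"
      by (simp add: sign_compose permutation_compose mult.left_commute)
    then have "G \<psi> = G \<sigma>" using conjugate[OF \<sigma> \<psi> \<tau>] \<tau>\<sigma> by (simp add: fun_eq_iff)
    moreover have "sign \<rho> = 1"
    proof -
      have "\<tau> \<circ> \<sigma> = \<psi> \<circ> \<tau>" using \<tau>\<sigma> by (simp add: fun_eq_iff)
      then have "sign \<tau> * sign \<sigma> = sign \<psi> * sign \<tau>"
        using permutation_if_permutes[OF \<tau>] p\<sigma> p\<psi> by (metis sign_compose)
      moreover have "sign \<psi> = sign \<sigma> * sign \<rho>"
        unfolding \<psi>_def using permutation_if_permutes[OF \<rho>S] p\<sigma> by (simp add: sign_compose)
      ultimately show ?thesis using \<open>sign \<tau> = 1\<close> by (metis mult.commute mult_cancel_left1 sign_nz mult_1)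
    qed
    ultimately show ?thesis by (simp add: \<psi>_def)
  qed simp
  let ?R = "{\<rho>. \<rho> permutes A}"
  have finR: "finite ?R" using finO AO finite_subset finite_permutations by blast
  let ?t = "\<lambda>\<rho>. of_int (sign \<rho>) * G (\<sigma> \<circ> \<rho>)"
  have "0 = (\<Sum>\<rho>\<in>?R. ?t \<rho>)" using fundamental[OF \<sigma> _ cardA] AO OS by auto
  also have "\<dots> = (\<Sum>\<rho>\<in>?R. if ?t \<rho> = 0 then 0 else G \<sigma>)"
    using terms by (intro sum.cong) auto
  also have "\<dots> = of_nat (card (?R - {\<rho>. ?t \<rho> = 0})) * G \<sigma>"
    using finR by (simp add: sum.If_cases Diff_eq Collect_neg_eq Int_commute)
  finally have "?R - {\<rho>. ?t \<rho> = 0} = {}" using nz finR by simp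
  moreover have "id \<in> ?R - {\<rho>. ?t \<rho> = 0}" using nz by simp
  ultimately show False by blast
qed

end

section \<open>Traces of an alternated tensor\<close>

lemma partition_by_orbits:
  assumes "f permutes S" "finite S"
  shows "(\<Sum>c\<in>orbit f ` S. card c) = card S"
proof -
  have pf: "permutation f" using assms permutation_permutes by blast
  have "S = \<Union>(orbit f ` S)"
    using permutes_orbit_subset[OF assms(1)] permutation_self_in_orbit[OF pf] by blast
  moreover have "card (\<Union>(orbit f ` S)) = (\<Sum>c\<in>orbit f ` S. card c)"
  proof (rule card_Union_disjoint)
    show "pairwise disjnt (orbit f ` S)"
      unfolding pairwise_def disjnt_def using orbit_eq_if_in_orbit[OF pf] by blast
    show "finite c" if "c \<in> orbit f ` S" for c
      using that permutes_orbit_subset[OF assms(1)] assms(2) finite_subset by blast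
  qed
  ultimately show ?thesis by metis
qed

lemma sum_odd_upto: "(\<Sum>i=1..d. 2 * i - 1) = (d::nat)\<^sup>2"
  by (induction d) (simp_all add: power2_eq_square)

lemma subset_eq_if_sum_eq:
  fixes T U :: "nat set"
  assumes "finite U" "T \<subseteq> U" "0 \<notin> U" "\<Sum>T = \<Sum>U"
  shows "T = U"
proof -
  have "\<Sum>(U - T) = 0" using sum.subset_diff[OF assms(2,1), of "\<lambda>x. x"] assms(4) by simp
  then have "k = 0" if "k \<in> U - T" for k using that assms(1) by simp
  then have "U \<subseteq> T" using assms(3) by (metis DiffI subsetI)
  then show ?thesis using assms(2) by (rule equalityI[rotated])
qed

context alternating_class_function begin

text \<open>The cycle lengths are distinct odd numbers below $2d$ with sum $d^2 = 1 + 3 + \dots + (2d - 1)$,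
so that none of these numbers is missing.\<close>
lemma orbit_cards:
  assumes \<sigma>: "\<sigma> permutes S" and nz: "G \<sigma> \<noteq> 0" and card: "card S = d\<^sup>2"
  shows "bij_betw card (orbit \<sigma> ` S) ((\<lambda>i. 2 * i - 1) ` {1..d})"
proof -
  let ?T = "card ` orbit \<sigma> ` S" and ?O = "(\<lambda>i::nat. 2 * i - 1) ` {1..d}"
  have inj: "inj_on card (orbit \<sigma> ` S)"
  proof (rule inj_onI)
    fix a b assume ab: "a \<in> orbit \<sigma> ` S" "b \<in> orbit \<sigma> ` S" "card a = card b"
    obtain x where x: "x \<in> S" "a = orbit \<sigma> x" using ab(1) by blast
    obtain y where y: "y \<in> S" "b = orbit \<sigma> y" using ab(2) by blast
    show "a = b"
      unfolding x(2) y(2) by (rule orbits_eq_if_cards_eq[OF \<sigma> nz x(1) y(1)]) (use ab(3) x y in metis)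
  qed
  have sub: "?T \<subseteq> ?O"
  proof
    fix k assume "k \<in> ?T"
    then obtain x where "x \<in> S" "k = card (orbit \<sigma> x)" by blast
    then have "odd k" "k < 2 * d" using odd_card_orbit[OF \<sigma> nz] card_orbit_less[OF \<sigma> nz] by auto
    then have "k = 2 * ((k + 1) div 2) - 1" "(k + 1) div 2 \<in> {1..d}"
      by (auto elim!: oddE)
    then show "k \<in> ?O" by (rule image_eqI)
  qed
  have "\<Sum>?T = \<Sum>?O"
  proof -
    have "\<Sum>?T = card S"
      using partition_by_orbits[OF \<sigma> finite_S] by (simp add: sum.reindex[OF inj])
    moreover have "\<Sum>?O = d\<^sup>2"
      by (subst sum.reindex) (auto simp: inj_on_def sum_odd_upto[symmetric])
    ultimately show ?thesis using card by simp
  qed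
  moreover have "finite ?O" "0 \<notin> ?O" by auto
  ultimately have "?T = ?O" using sub by (intro subset_eq_if_sum_eq)
  then show ?thesis using inj by (simp add: bij_betw_def)
qed

lemma card_orbits:
  assumes "\<sigma> permutes S" "G \<sigma> \<noteq> 0" "card S = d\<^sup>2"
  shows "card (orbit \<sigma> ` S) = d"
proof -
  have "inj_on (\<lambda>i::nat. 2 * i - 1) {1..d}" by (intro inj_onI) auto
  then show ?thesis using bij_betw_same_card[OF orbit_cards[OF assms]] by (simp add: card_image)
qed

end

lemma signed_sum_eq_0_if_transpose_invariant:
  fixes h :: "('a \<Rightarrow> 'a) \<Rightarrow> rat"
  assumes "s \<noteq> t" "\<And>\<rho>. \<rho> \<in> R \<Longrightarrow> permutation \<rho>" "\<And>\<rho>. \<rho> \<in> R \<Longrightarrow> transpose s t \<circ> \<rho> \<in> R"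
    "\<And>\<rho>. \<rho> \<in> R \<Longrightarrow> h (transpose s t \<circ> \<rho>) = h \<rho>"
  shows "(\<Sum>\<rho>\<in>R. of_int (sign \<rho>) * h \<rho>) = 0"
proof -
  have twice: "transpose s t \<circ> (transpose s t \<circ> \<rho>) = \<rho>" for \<rho> by (simp add: fun_eq_iff)
  have "(\<Sum>\<rho>\<in>R. of_int (sign \<rho>) * h \<rho>)
      = (\<Sum>\<rho>\<in>R. of_int (sign (transpose s t \<circ> \<rho>)) * h (transpose s t \<circ> \<rho>))"
    by (rule sum.reindex_bij_witness[of _ "\<lambda>\<rho>. transpose s t \<circ> \<rho>" "\<lambda>\<rho>. transpose s t \<circ> \<rho>"])
      (simp_all only: assms(3) twice)
  also have "\<dots> = (\<Sum>\<rho>\<in>R. - (of_int (sign \<rho>) * h \<rho>))"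
    using assms by (intro sum.cong refl) (simp add: sign_compose permutation_swap_id sign_swap_id)
  also have "\<dots> = - (\<Sum>\<rho>\<in>R. of_int (sign \<rho>) * h \<rho>)" by (rule sum_negf)
  finally show ?thesis by simp
qed

lemma PiE_comp_permutes:
  assumes "\<tau> permutes S" "x \<in> S \<rightarrow>\<^sub>E I"
  shows "x \<circ> \<tau> \<in> S \<rightarrow>\<^sub>E I"
  using assms by (auto simp: PiE_iff extensional_def permutes_in_image permutes_not_in)

lemma sum_PiE_permute:
  assumes "\<tau> permutes S"
  shows "(\<Sum>u\<in>S \<rightarrow>\<^sub>E I. f (u \<circ> \<tau>)) = (\<Sum>u\<in>S \<rightarrow>\<^sub>E I. f u)"
proof (rule sum.reindex_bij_witness[of _ "\<lambda>u. u \<circ> inv \<tau>" "\<lambda>u. u \<circ> \<tau>"])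
  fix u assume "u \<in> S \<rightarrow>\<^sub>E I"
  then show "u \<circ> \<tau> \<in> S \<rightarrow>\<^sub>E I" "u \<circ> inv \<tau> \<in> S \<rightarrow>\<^sub>E I"
    using PiE_comp_permutes assms permutes_inv by blast+
qed (simp_all add: comp_assoc permutes_inv_o[OF assms])

text \<open>The alternation of $x_1 \otimes x_2 \otimes \cdots$ over $S$, with some of its factors multiplied
along words.\<close>
abbreviation alt_tensor where
  "alt_tensor d S X \<equiv> word_tensor d {\<pi>. \<pi> permutes S} (\<lambda>\<pi>. of_int (sign \<pi>)) (\<lambda>\<pi>. X \<circ> \<pi>)"

lemma alt_tensor_letters:
  "alt_tensor d S X [] S r c = (\<Sum>\<pi> | \<pi> permutes S. of_int (sign \<pi>) * (\<Prod>p\<in>S. X (\<pi> p) (r p) (c p)))"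
  by (simp add: word_tensor_def)

text \<open>Slots are permuted for row and column indices simultaneously. The second condition says that only
the indices at slots in $S$ matter; the functions $r$ and $c$ are total.\<close>
definition alternating_on :: "'a set \<Rightarrow> (('a \<Rightarrow> nat) \<Rightarrow> ('a \<Rightarrow> nat) \<Rightarrow> rat) \<Rightarrow> bool" where
  "alternating_on S f \<longleftrightarrow> (\<forall>\<pi> r c. \<pi> permutes S \<longrightarrow> f (r \<circ> \<pi>) (c \<circ> \<pi>) = of_int (sign \<pi>) * f r c) \<and>
     (\<forall>r c r' c'. (\<forall>p\<in>S. r p = r' p \<and> c p = c' p) \<longrightarrow> f r c = f r' c')"

lemma alternating_onI_sum:
  assumes S: "finite S"
    and loc: "\<And>r c r' c'. \<forall>p\<in>S. r p = r' p \<and> c p = c' p \<Longrightarrow> g r c = g r' c'"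
    and f: "\<And>r c. f r c = (\<Sum>\<pi> | \<pi> permutes S. of_int (sign \<pi>) * g (r \<circ> \<pi>) (c \<circ> \<pi>))"
  shows "alternating_on S f"
  unfolding alternating_on_def
proof (intro conjI allI impI)
  fix \<tau> and r c :: "'a \<Rightarrow> nat" assume \<tau>: "\<tau> permutes S"
  have perm: "permutation \<pi>" if "\<pi> permutes S" for \<pi>
    using that S permutation_permutes by blast
  have "f (r \<circ> \<tau>) (c \<circ> \<tau>) = (\<Sum>\<pi> | \<pi> permutes S. of_int (sign \<pi>) * g (r \<circ> (\<tau> \<circ> \<pi>)) (c \<circ> (\<tau> \<circ> \<pi>)))"
    by (simp add: f comp_assoc)
  also have "\<dots> = (\<Sum>\<pi> | \<pi> permutes S. of_int (sign \<tau>) * (of_int (sign \<pi>) * g (r \<circ> \<pi>) (c \<circ> \<pi>)))"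
    by (rule sum.reindex_bij_witness[of _ "\<lambda>\<pi>. inv \<tau> \<circ> \<pi>" "\<lambda>\<pi>. \<tau> \<circ> \<pi>"])
      (use \<tau> perm in \<open>auto simp: comp_assoc[symmetric] permutes_inv_o permutes_compose permutes_inv
        sign_compose simp flip: of_int_mult\<close>)
  finally show "f (r \<circ> \<tau>) (c \<circ> \<tau>) = of_int (sign \<tau>) * f r c"
    by (simp add: f sum_distrib_left)
next
  fix r c r' c' :: "'a \<Rightarrow> nat" assume "\<forall>p\<in>S. r p = r' p \<and> c p = c' p"
  then show "f r c = f r' c'"
    unfolding f by (intro sum.cong refl arg_cong2[where f = "(*)"] loc)
      (auto simp: permutes_in_image)
qed

lemma alternating_alt_tensor:
  assumes "finite S"
  shows "alternating_on S (alt_tensor d S X [] S)"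
proof (rule alternating_onI_sum[OF assms])
  fix r c :: "'a \<Rightarrow> nat"
  have "alt_tensor d S X [] S r c
      = (\<Sum>\<pi> | \<pi> permutes S. of_int (sign (inv \<pi>)) * (\<Prod>p\<in>S. X (inv \<pi> p) (r p) (c p)))"
    unfolding alt_tensor_letters by (rule sum_permutations_inverse)
  also have "\<dots> = (\<Sum>\<pi> | \<pi> permutes S. of_int (sign \<pi>) * (\<Prod>p\<in>S. X p ((r \<circ> \<pi>) p) ((c \<circ> \<pi>) p)))"
  proof (intro sum.cong refl arg_cong2[where f = "(*)"] arg_cong[where f = of_int])
    fix \<pi> assume \<pi>: "\<pi> \<in> {\<pi>. \<pi> permutes S}"
    then have "permutation \<pi>" using assms permutation_permutes by blast
    then show "sign (inv \<pi>) = sign \<pi>" by (rule sign_inverse)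
    show "(\<Prod>p\<in>S. X (inv \<pi> p) (r p) (c p)) = (\<Prod>p\<in>S. X p ((r \<circ> \<pi>) p) ((c \<circ> \<pi>) p))"
      by (rule prod.reindex_bij_witness[of _ \<pi> "inv \<pi>"])
        (use \<pi> in \<open>auto simp: permutes_inverses permutes_in_image permutes_inv\<close>)
  qed
  finally show "alt_tensor d S X [] S r c
    = (\<Sum>\<pi> | \<pi> permutes S. of_int (sign \<pi>) * (\<Prod>p\<in>S. X p ((r \<circ> \<pi>) p) ((c \<circ> \<pi>) p)))" .
next
  fix r c r' c' :: "'a \<Rightarrow> nat" assume "\<forall>p\<in>S. r p = r' p \<and> c p = c' p"
  then show "(\<Prod>p\<in>S. X p (r p) (c p)) = (\<Prod>p\<in>S. X p (r' p) (c' p))"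
    by (intro prod.cong) auto
qed

text \<open>The trace of $Alt_X\,(x_1 \otimes x_2 \otimes \cdots)$ against $\sigma$: an alternated product
of traces of monomials, one for each cycle of $\sigma$.\<close>
definition alt_trace :: "nat \<Rightarrow> 'a set \<Rightarrow> ('a \<Rightarrow> nat \<Rightarrow> nat \<Rightarrow> rat) \<Rightarrow> ('a \<Rightarrow> 'a) \<Rightarrow> rat" where
  "alt_trace d S X \<sigma> = (\<Sum>u\<in>S \<rightarrow>\<^sub>E {..<d}. alt_tensor d S X [] S u (u \<circ> \<sigma>))"

text \<open>For the fundamental trace identity: among $d + 1$ slots two carry the same index $< d$, and
composing with their transposition changes the sign of a term but not its value.\<close>
lemma alternating_class_function_alt_trace:
  assumes "finite S"
  shows "alternating_class_function S d (alt_trace d S X)"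
proof
  let ?D = "alt_tensor d S X [] S"
  have alt: "?D (r \<circ> \<pi>) (c \<circ> \<pi>) = of_int (sign \<pi>) * ?D r c" if "\<pi> permutes S" for r c \<pi>
    using alternating_alt_tensor[OF assms, of d X] that by (simp add: alternating_on_def)
  fix \<sigma> \<sigma>' \<tau> assume *: "\<sigma> permutes S" "\<sigma>' permutes S" "\<tau> permutes S" "\<tau> \<circ> \<sigma> = \<sigma>' \<circ> \<tau>"
  have "of_int (sign \<tau>) * alt_trace d S X \<sigma>'
      = (\<Sum>u\<in>S \<rightarrow>\<^sub>E {..<d}. ?D (u \<circ> \<tau>) (u \<circ> \<tau> \<circ> \<sigma>))"
    unfolding alt_trace_def sum_distrib_left
    using * by (simp add: alt[symmetric] comp_assoc)
  also have "\<dots> = alt_trace d S X \<sigma>"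
    unfolding alt_trace_def by (rule sum_PiE_permute[OF *(3)])
  finally have "of_int (sign \<tau>) * (of_int (sign \<tau>) * alt_trace d S X \<sigma>') = of_int (sign \<tau>) * alt_trace d S X \<sigma>"
    by simp
  then show "alt_trace d S X \<sigma>' = of_int (sign \<tau>) * alt_trace d S X \<sigma>"
    by (simp add: mult.assoc[symmetric] flip: of_int_mult)
next
  let ?D = "alt_tensor d S X [] S"
  fix \<sigma> A assume \<sigma>: "\<sigma> permutes S" and A: "A \<subseteq> S" "card A = Suc d"
  have finA: "finite A" using A(2) card.infinite by fastforce
  have "(\<Sum>\<rho> | \<rho> permutes A. of_int (sign \<rho>) * alt_trace d S X (\<sigma> \<circ> \<rho>))
    = (\<Sum>u\<in>S \<rightarrow>\<^sub>E {..<d}. \<Sum>\<rho> | \<rho> permutes A. of_int (sign \<rho>) * ?D u (u \<circ> (\<sigma> \<circ> \<rho>)))"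
    unfolding alt_trace_def sum_distrib_left by (rule sum.swap)
  also have "\<dots> = (\<Sum>u\<in>S \<rightarrow>\<^sub>E {..<d}. 0)"
  proof (intro sum.cong refl)
    fix u assume u: "u \<in> S \<rightarrow>\<^sub>E {..<d}"
    \<comment> \<open>Two of the d + 1 slots carry the same index.\<close>
    have "(u \<circ> \<sigma>) ` A \<subseteq> {..<d}" using u A(1) \<sigma> by (auto simp: PiE_iff permutes_in_image subsetD)
    then have "card ((u \<circ> \<sigma>) ` A) < card A" using A(2) card_mono[of "{..<d}" "(u \<circ> \<sigma>) ` A"] by simp
    then have "\<not> inj_on (u \<circ> \<sigma>) A" by (rule pigeonhole)
    then obtain s t where st: "s \<in> A" "t \<in> A" "s \<noteq> t" "u (\<sigma> s) = u (\<sigma> t)"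
      by (auto simp: inj_on_def)
    have swap: "u (\<sigma> (transpose s t x)) = u (\<sigma> x)" for x
      using st(4) by (simp add: transpose_def)
    show "(\<Sum>\<rho> | \<rho> permutes A. of_int (sign \<rho>) * ?D u (u \<circ> (\<sigma> \<circ> \<rho>))) = 0"
    proof (rule signed_sum_eq_0_if_transpose_invariant[OF st(3)])
      fix \<rho> assume "\<rho> \<in> {\<rho>. \<rho> permutes A}"
      then have \<rho>: "\<rho> permutes A" by simp
      show "permutation \<rho>" using \<rho> finA permutation_permutes by blast
      show "transpose s t \<circ> \<rho> \<in> {\<rho>. \<rho> permutes A}"
        using permutes_compose[OF \<rho> permutes_swap_id[OF st(1,2)]] by simp
      have "u \<circ> (\<sigma> \<circ> (transpose s t \<circ> \<rho>)) = u \<circ> (\<sigma> \<circ> \<rho>)" by (simp add: fun_eq_iff swap)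
      then show "?D u (u \<circ> (\<sigma> \<circ> (transpose s t \<circ> \<rho>))) = ?D u (u \<circ> (\<sigma> \<circ> \<rho>))" by simp
    qed
  qed
  finally show "(\<Sum>\<rho> | \<rho> permutes A. of_int (sign \<rho>) * alt_trace d S X (\<sigma> \<circ> \<rho>)) = 0" by simp
qed (rule assms)

section \<open>Alternating tensors lie in the span of the permutations\<close>

definition preserving :: "'a set \<Rightarrow> ('a \<Rightarrow> 'b) \<Rightarrow> ('a \<Rightarrow> 'a) set" where
  "preserving S f = {p. p permutes S \<and> (\<forall>x\<in>S. f (p x) = f x)}"

lemma preserving_id: "id \<in> preserving S f"
  by (simp add: preserving_def permutes_id)

lemma preserving_comp: "p \<in> preserving S f \<Longrightarrow> q \<in> preserving S f \<Longrightarrow> p \<circ> q \<in> preserving S f"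
  by (auto simp: preserving_def permutes_compose permutes_in_image)

lemma preserving_inv: "p \<in> preserving S f \<Longrightarrow> inv p \<in> preserving S f"
proof -
  assume p: "p \<in> preserving S f"
  have "f (inv p x) = f x" if "x \<in> S" for x
  proof -
    have "inv p x \<in> S" using that p by (simp add: preserving_def permutes_in_image permutes_inv)
    then have "f (p (inv p x)) = f (inv p x)" using p by (simp add: preserving_def)
    then show ?thesis using permutes_inverses(1)[of p S x] p by (metis (no_types, lifting) mem_Collect_eq preserving_def)
  qed
  then show ?thesis using p by (simp add: preserving_def permutes_inv)
qed

lemma preserving_permutes: "p \<in> preserving S f \<Longrightarrow> p permutes S"
  by (simp add: preserving_def)

lemma preserving_inv_inv: "p \<in> preserving S f \<Longrightarrow> inv (inv p) = p"
  using permutes_inv_inv[OF preserving_permutes] .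

lemma finite_preserving: "finite S \<Longrightarrow> finite (preserving S f)"
  unfolding preserving_def by (rule finite_subset[OF _ finite_permutations[of S]]) auto

lemma inv_comp_permutes:
  "p permutes S \<Longrightarrow> q permutes S \<Longrightarrow> inv (p \<circ> q) = inv q \<circ> inv p"
  by (rule o_inv_distrib[OF permutes_bij permutes_bij])

text \<open>The $d^2$ slots are identified with the cells of a $d \times d$ square. At the indices
\<open>row\<close>, \<open>col\<close> every pair of indices occurs in exactly one slot.\<close>
locale grid =
  fixes S :: "'a set" and d :: nat and row col :: "'a \<Rightarrow> nat"
  assumes fin: "finite S"
    and bij: "bij_betw (\<lambda>x. (row x, col x)) S ({..<d} \<times> {..<d})"
begin

lemma cell_eqI: "x \<in> S \<Longrightarrow> y \<in> S \<Longrightarrow> row x = row y \<Longrightarrow> col x = col y \<Longrightarrow> x = y"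
  using bij by (auto simp: bij_betw_def dest!: inj_onD)

definition cell :: "nat \<Rightarrow> nat \<Rightarrow> 'a" where
  "cell i j = inv_into S (\<lambda>x. (row x, col x)) (i, j)"

lemma cell: "i < d \<Longrightarrow> j < d \<Longrightarrow> cell i j \<in> S \<and> row (cell i j) = i \<and> col (cell i j) = j"
proof -
  assume "i < d" "j < d"
  then have *: "(i, j) \<in> (\<lambda>x. (row x, col x)) ` S" using bij by (simp add: bij_betw_def)
  show ?thesis unfolding cell_def using inv_into_into[OF *] f_inv_into_f[OF *] by simp
qed

lemma row_col_less: "x \<in> S \<Longrightarrow> row x < d \<and> col x < d"
  using bij_betwE[OF bij] by blast

lemma permutation_if_permutes: "\<sigma> permutes S \<Longrightarrow> permutation \<sigma>"
  using fin by (rule permutes_imp_permutation)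

lemma sign_comp: "p permutes S \<Longrightarrow> q permutes S \<Longrightarrow> sign (p \<circ> q) = sign p * sign q"
  by (simp add: sign_compose permutation_if_permutes)

lemma sign_inv: "p permutes S \<Longrightarrow> sign (inv p) = sign p"
  by (simp add: sign_inverse permutation_if_permutes)

text \<open>If two slots carry the same pair of indices, both functions vanish. Otherwise each of the $d^2$
pairs of indices occurs once, and a permutation of the slots leads to the indices
\<open>row\<close>, \<open>col\<close>.\<close>
lemma alternating_on_proportional:
  assumes "alternating_on S f" "alternating_on S g"
    and r: "\<forall>x\<in>S. r x < d" and c: "\<forall>x\<in>S. c x < d"
  shows "f row col * g r c = g row col * f r c"
proof (cases "inj_on (\<lambda>x. (r x, c x)) S")
  case True
  define \<theta> where "\<theta> x = (if x \<in> S then cell (r x) (c x) else x)" for x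
  have \<theta>_in: "\<theta> x \<in> S" "row (\<theta> x) = r x" "col (\<theta> x) = c x" if "x \<in> S" for x
    using that cell r c by (auto simp: \<theta>_def)
  have "inj_on \<theta> S"
    using True \<theta>_in by (auto simp: inj_on_def) metis
  moreover have "\<theta> ` S \<subseteq> S" using \<theta>_in by blast
  ultimately have "bij_betw \<theta> S S" using fin by (simp add: bij_betw_def endo_inj_surj)
  then have \<theta>: "\<theta> permutes S" by (rule bij_imp_permutes) (simp add: \<theta>_def)
  have "h r c = of_int (sign \<theta>) * h row col" if h: "alternating_on S h" for h
  proof -
    have "h r c = h (row \<circ> \<theta>) (col \<circ> \<theta>)"
      using h \<theta>_in unfolding alternating_on_def by (metis comp_apply)
    also have "\<dots> = of_int (sign \<theta>) * h row col" using h \<theta> unfolding alternating_on_def by blast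
    finally show ?thesis .
  qed
  from this[OF assms(1)] this[OF assms(2)] show ?thesis by simp
next
  case False
  then obtain x y where xy: "x \<in> S" "y \<in> S" "x \<noteq> y" "r x = r y" "c x = c y"
    by (auto simp: inj_on_def)
  have "h r c = 0" if h: "alternating_on S h" for h
  proof -
    have "r \<circ> transpose x y = r" "c \<circ> transpose x y = c"
      using xy by (auto simp: fun_eq_iff transpose_def)
    then have "h r c = of_int (sign (transpose x y)) * h r c"
      using h permutes_swap_id[OF xy(1,2)] unfolding alternating_on_def by metis
    then show ?thesis using xy(3) by (simp add: sign_swap_id)
  qed
  from this[OF assms(1)] this[OF assms(2)] show ?thesis by simp
qed

text \<open>The column group $P$ and the row group $Q$ of the square.\<close>
abbreviation P where "P \<equiv> preserving S col"
abbreviation Q where "Q \<equiv> preserving S row"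

definition flip :: "'a \<Rightarrow> 'a" where "flip x = (if x \<in> S then cell (col x) (row x) else x)"

lemma flip_in: "x \<in> S \<Longrightarrow> flip x \<in> S \<and> row (flip x) = col x \<and> col (flip x) = row x"
  using cell row_col_less by (auto simp: flip_def)

lemma flip_flip: "flip (flip x) = x"
proof (cases "x \<in> S")
  case True
  then have *: "flip x \<in> S" "row (flip x) = col x" "col (flip x) = row x" using flip_in by auto
  show ?thesis using flip_in[OF *(1)] * True by (intro cell_eqI) auto
qed (simp add: flip_def)

lemma flip_outside: "x \<notin> S \<Longrightarrow> flip x = x"
  by (simp add: flip_def)

lemma flip_permutes: "flip permutes S"
  by (rule bij_imp_permutes[OF bij_betw_byWitness[where f' = flip]]) (use flip_in flip_flip flip_outside in auto)

lemma flip_conj: "p \<in> P \<Longrightarrow> flip \<circ> p \<circ> flip \<in> Q"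
  using flip_permutes flip_in by (auto simp: preserving_def permutes_compose permutes_in_image)

lemma flip_conj': "q \<in> Q \<Longrightarrow> flip \<circ> q \<circ> flip \<in> P"
  using flip_permutes flip_in by (auto simp: preserving_def permutes_compose permutes_in_image)

lemma PQ_id:
  assumes "p \<in> P" "p \<in> Q"
  shows "p = id"
proof
  fix x
  show "p x = id x"
  proof (cases "x \<in> S")
    case True
    then show ?thesis
      using assms by (intro cell_eqI) (auto simp: preserving_def permutes_in_image)
  next
    case False
    then show ?thesis using permutes_not_in[OF preserving_permutes[OF assms(1)]] by simp
  qed
qed

definition col_sign :: "('a \<Rightarrow> 'a) \<Rightarrow> rat" where
  "col_sign g = of_int (sign g) * of_bool (g \<in> P)"

text \<open>With $e = \sum_{q \in Q} q$ and $\varepsilon = \sum_{p \in P} \epsilon_p\, p$, these are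
the coefficients of the Young symmetrizer $e\, \varepsilon$; those of $\varepsilon\, e$ and
$e\, \varepsilon\, e$ follow.\<close>
definition row_col_coeff :: "('a \<Rightarrow> 'a) \<Rightarrow> rat" where
  "row_col_coeff g = (\<Sum>q\<in>Q. col_sign (q \<circ> g))"

definition col_row_coeff :: "('a \<Rightarrow> 'a) \<Rightarrow> rat" where
  "col_row_coeff g = (\<Sum>q\<in>Q. col_sign (g \<circ> q))"

lemma sum_Q_shift:
  assumes "q \<in> Q"
  shows "(\<Sum>q'\<in>Q. f (q' \<circ> q)) = (\<Sum>q'\<in>Q. f q')" "(\<Sum>q'\<in>Q. f (q \<circ> q')) = (\<Sum>q'\<in>Q. f q')"
proof -
  note q = assms preserving_inv[OF assms] preserving_permutes[OF assms]
  show "(\<Sum>q'\<in>Q. f (q' \<circ> q)) = (\<Sum>q'\<in>Q. f q')"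
    by (rule sum.reindex_bij_witness[of _ "\<lambda>q'. q' \<circ> inv q" "\<lambda>q'. q' \<circ> q"])
      (simp_all add: q preserving_comp comp_assoc permutes_inv_o[OF q(3)])
  show "(\<Sum>q'\<in>Q. f (q \<circ> q')) = (\<Sum>q'\<in>Q. f q')"
    by (rule sum.reindex_bij_witness[of _ "\<lambda>q'. inv q \<circ> q'" "\<lambda>q'. q \<circ> q'"])
      (simp_all add: q preserving_comp comp_assoc[symmetric] permutes_inv_o[OF q(3)])
qed

lemma row_col_coeff_invariant: "q \<in> Q \<Longrightarrow> row_col_coeff (q \<circ> g) = row_col_coeff g"
  unfolding row_col_coeff_def using sum_Q_shift(1)[of q "\<lambda>q'. col_sign (q' \<circ> g)"] by (simp add: comp_assoc)

lemma col_row_coeff_invariant: "q \<in> Q \<Longrightarrow> col_row_coeff (g \<circ> q) = col_row_coeff g"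
  unfolding col_row_coeff_def using sum_Q_shift(2)[of q "\<lambda>q'. col_sign (g \<circ> q')"] by (simp add: comp_assoc)

definition row_col_row_coeff :: "('a \<Rightarrow> 'a) \<Rightarrow> rat" where
  "row_col_row_coeff g = (\<Sum>q\<in>Q. row_col_coeff (g \<circ> q))"

lemma row_col_row_coeff_alt: "row_col_row_coeff g = (\<Sum>q\<in>Q. col_row_coeff (q \<circ> g))"
  unfolding row_col_row_coeff_def row_col_coeff_def col_row_coeff_def by (subst sum.swap) (simp add: comp_assoc)

lemma col_sign_Q: "q \<in> Q \<Longrightarrow> col_sign q = of_bool (q = id)"
  using PQ_id[of q] preserving_id[of S col] by (auto simp: col_sign_def)

lemma card_Q: "card Q > 0"
  using preserving_id[of S row] finite_preserving[OF fin, of row] by (auto simp: card_gt_0_iff)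

lemma row_col_row_coeff_id: "row_col_row_coeff id = of_nat (card Q)"
proof -
  have "row_col_row_coeff id = (\<Sum>q\<in>Q. \<Sum>q'\<in>Q. col_sign (q' \<circ> q))" by (simp add: row_col_row_coeff_def row_col_coeff_def)
  also have "\<dots> = (\<Sum>q\<in>Q. \<Sum>q'\<in>Q. col_sign q')"
    by (intro sum.cong refl sum_Q_shift(1))
  also have "(\<Sum>q'\<in>Q. col_sign q') = (\<Sum>q'\<in>Q. if q' = id then 1 else 0)"
    by (intro sum.cong refl) (simp add: col_sign_Q)
  also have "\<dots> = 1" using preserving_id[of S row] finite_preserving[OF fin, of row] by simp
  finally show ?thesis by (simp only: sum_constant mult_1_right)
qed

text \<open>Up to the factor $|Q|^2$ the sum is the sum of the squares of the coefficients of
$e\, \varepsilon\, e$, since multiplying by $e$ on either side is averaging over $Q$ up to a factor. The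
coefficient at the identity is $|Q| \neq 0$ because rows and columns meet in one cell only.\<close>
lemma sum_row_col_coeff_col_row_coeff_pos: "(\<Sum>g | g permutes S. row_col_coeff g * col_row_coeff g) > 0" (is "?K > 0")
proof -
  let ?G = "{g. g permutes S}"
  have "(\<Sum>g\<in>?G. row_col_row_coeff g * row_col_row_coeff g) = (\<Sum>g\<in>?G. \<Sum>q1\<in>Q. \<Sum>q2\<in>Q. row_col_coeff (g \<circ> q1) * col_row_coeff (q2 \<circ> g))"
    by (subst (2) row_col_row_coeff_alt) (simp add: row_col_row_coeff_def sum_product)
  also have "\<dots> = (\<Sum>g\<in>?G. \<Sum>q1\<in>Q. \<Sum>q2\<in>Q. row_col_coeff (q2 \<circ> g \<circ> q1) * col_row_coeff (q2 \<circ> g \<circ> q1))"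
  proof (intro sum.cong refl arg_cong2[where f = "(*)"])
    fix g q1 q2 assume q: "q1 \<in> Q" "q2 \<in> Q"
    show "row_col_coeff (g \<circ> q1) = row_col_coeff (q2 \<circ> g \<circ> q1)"
      using row_col_coeff_invariant[OF q(2), of "g \<circ> q1"] by (simp only: comp_assoc)
    show "col_row_coeff (q2 \<circ> g) = col_row_coeff (q2 \<circ> g \<circ> q1)"
      using col_row_coeff_invariant[OF q(1), of "q2 \<circ> g"] by (simp only: comp_assoc)
  qed
  also have "\<dots> = (\<Sum>q1\<in>Q. \<Sum>g\<in>?G. \<Sum>q2\<in>Q. row_col_coeff (q2 \<circ> g \<circ> q1) * col_row_coeff (q2 \<circ> g \<circ> q1))"
    by (rule sum.swap)
  also have "\<dots> = (\<Sum>q1\<in>Q. \<Sum>q2\<in>Q. \<Sum>g\<in>?G. row_col_coeff (q2 \<circ> g \<circ> q1) * col_row_coeff (q2 \<circ> g \<circ> q1))"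
    by (intro sum.cong refl sum.swap)
  also have "\<dots> = (\<Sum>q1\<in>Q. \<Sum>q2\<in>Q. ?K)"
  proof (rule sum.cong[OF refl], rule sum.cong[OF refl])
    fix q1 q2 assume "q1 \<in> Q" "q2 \<in> Q"
    then have q: "q1 permutes S" "q2 permutes S" by (auto dest: preserving_permutes)
    have "inv q2 \<circ> (q2 \<circ> g \<circ> q1) \<circ> inv q1 = g" "q2 \<circ> (inv q2 \<circ> g \<circ> inv q1) \<circ> q1 = g" for g
      by (simp_all add: fun_eq_iff permutes_inverses[OF q(1)] permutes_inverses[OF q(2)])
    then show "(\<Sum>g\<in>?G. row_col_coeff (q2 \<circ> g \<circ> q1) * col_row_coeff (q2 \<circ> g \<circ> q1)) = ?K"
      by (intro sum.reindex_bij_witness[of _ "\<lambda>g. inv q2 \<circ> g \<circ> inv q1" "\<lambda>g. q2 \<circ> g \<circ> q1"])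
        (simp_all add: q permutes_compose permutes_inv)
  qed
  finally have K: "(\<Sum>g\<in>?G. row_col_row_coeff g * row_col_row_coeff g) = of_nat (card Q) * (of_nat (card Q) * ?K)" by simp
  have "(\<Sum>g\<in>{id}. row_col_row_coeff g * row_col_row_coeff g) \<le> (\<Sum>g\<in>?G. row_col_row_coeff g * row_col_row_coeff g)"
    by (intro sum_mono2 finite_permutations fin) (simp_all add: permutes_id)
  moreover have "0 < (\<Sum>g\<in>{id}. row_col_row_coeff g * row_col_row_coeff g)" 
  proof -
    have "(\<Sum>g\<in>{id}. row_col_row_coeff g * row_col_row_coeff g) = of_nat (card Q) * of_nat (card Q)"
      unfolding row_col_row_coeff_id[symmetric] by simp
    then show ?thesis using card_Q by simp
  qed
  ultimately have "0 < (\<Sum>g\<in>?G. row_col_row_coeff g * row_col_row_coeff g)" by (rule less_le_trans[rotated])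
  then show ?thesis unfolding K using card_Q by (simp add: zero_less_mult_iff)
qed

text \<open>The column antisymmetrizer $\varepsilon$ composed with the reflection of the square. The
reflection turns rows into columns, so that the tensor does not vanish at \<open>row\<close>, \<open>col\<close>.\<close>
definition flip_tensor :: "('a \<Rightarrow> nat) \<Rightarrow> ('a \<Rightarrow> nat) \<Rightarrow> rat" where
  "flip_tensor r c = (\<Sum>p\<in>P. of_int (sign p) * of_bool (\<forall>x\<in>S. c x = r (p (flip x))))"

text \<open>If $\pi$ is not a product of a row and a column permutation, two cells of one column have images in
one row; their transposition cancels the terms on the left, and the right-hand side has no term. Otherwise the
two factors of $\pi = q^{-1} p$ are unique, and the left-hand side splits accordingly.\<close>
lemma flip_tensor_cell:
  assumes \<pi>: "\<pi> permutes S"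
  shows "of_int (sign \<pi>) * flip_tensor (row \<circ> \<pi>) (col \<circ> \<pi>) = row_col_coeff \<pi> * col_row_coeff \<pi>"
proof (cases "\<exists>q\<in>Q. q \<circ> \<pi> \<in> P")
  case True
  then obtain q0 where q0: "q0 \<in> Q" "q0 \<circ> \<pi> \<in> P" by blast
  define p0 where "p0 = q0 \<circ> \<pi>"
  have p0: "p0 \<in> P" "p0 permutes S" using q0 preserving_permutes by (auto simp: p0_def)
  \<comment> \<open>Two decompositions differ by an element of both groups, which is the identity.\<close>
  have uniq: "q = q0" if "q \<in> Q" "q \<circ> \<pi> \<in> P" for q
  proof -
    have "(q \<circ> \<pi>) \<circ> inv (q0 \<circ> \<pi>) \<in> P" by (rule preserving_comp[OF that(2) preserving_inv[OF q0(2)]])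
    moreover have "(q \<circ> \<pi>) \<circ> inv (q0 \<circ> \<pi>) = q \<circ> inv q0"
      by (simp add: inv_comp_permutes[OF preserving_permutes[OF q0(1)] \<pi>] fun_eq_iff permutes_inverses[OF \<pi>])
    ultimately have "q \<circ> inv q0 \<in> P" by simp
    moreover have "q \<circ> inv q0 \<in> Q" by (rule preserving_comp[OF that(1) preserving_inv[OF q0(1)]])
    ultimately have "q \<circ> inv q0 = id" by (rule PQ_id)
    then have "q \<circ> inv q0 \<circ> q0 = q0" by simp
    then show ?thesis by (simp add: comp_assoc permutes_inv_o[OF preserving_permutes[OF q0(1)]])
  qed
  have "row_col_coeff \<pi> = (\<Sum>q\<in>Q. if q = q0 then of_int (sign p0) else 0)"
    unfolding row_col_coeff_def
  proof (intro sum.cong refl)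
    fix q assume "q \<in> Q"
    then have "q \<circ> \<pi> \<in> P \<longleftrightarrow> q = q0" using uniq q0 by blast
    then show "col_sign (q \<circ> \<pi>) = (if q = q0 then of_int (sign p0) else 0)"
      by (simp add: col_sign_def p0_def)
  qed
  then have A: "row_col_coeff \<pi> = of_int (sign p0)"
    using q0 finite_preserving[OF fin, of row] by simp
  have row\<pi>: "row (\<pi> y) = row (p0 y)" if "y \<in> S" for y
    using q0(1) that \<pi> by (simp add: p0_def preserving_def permutes_in_image)
  have "flip_tensor (row \<circ> \<pi>) (col \<circ> \<pi>)
      = (\<Sum>p\<in>P. of_int (sign p) * of_bool (\<forall>x\<in>S. col (\<pi> x) = col (flip (p0 (p (flip x))))))"
    unfolding flip_tensor_def
  proof (intro sum.cong refl)
    fix p assume "p \<in> P"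
    then have "p (flip x) \<in> S" "p0 (p (flip x)) \<in> S" if "x \<in> S" for x
      using that flip_in p0 preserving_permutes by (metis permutes_in_image)+
    then have "row (\<pi> (p (flip x))) = col (flip (p0 (p (flip x))))" if "x \<in> S" for x
      using that row\<pi> flip_in by simp
    then show "of_int (sign p) * of_bool (\<forall>x\<in>S. (col \<circ> \<pi>) x = (row \<circ> \<pi>) (p (flip x)))
        = of_int (sign p) * (of_bool (\<forall>x\<in>S. col (\<pi> x) = col (flip (p0 (p (flip x))))) :: rat)"
      by simp
  qed
  also have "\<dots> = (\<Sum>q\<in>Q. of_int (sign p0 * sign q) * of_bool (\<forall>x\<in>S. col (\<pi> x) = col (q x)))"
  proof (rule sum.reindex_bij_witness[of _ "\<lambda>q. inv p0 \<circ> (flip \<circ> q \<circ> flip)" "\<lambda>p. flip \<circ> (p0 \<circ> p) \<circ> flip"])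
    fix p assume p: "p \<in> P"
    show "inv p0 \<circ> (flip \<circ> (flip \<circ> (p0 \<circ> p) \<circ> flip) \<circ> flip) = p"
      by (simp add: fun_eq_iff flip_flip permutes_inverses[OF p0(2)])
    show "flip \<circ> (p0 \<circ> p) \<circ> flip \<in> Q" using p p0 by (intro flip_conj preserving_comp)
    have "sign p0 * sign (flip \<circ> (p0 \<circ> p) \<circ> flip) = sign p"
      using p0 preserving_permutes[OF p] flip_permutes
      by (cases flip rule: sign_cases; cases p0 rule: sign_cases) (simp_all add: sign_comp permutes_compose)
    then show "of_int (sign p0 * sign (flip \<circ> (p0 \<circ> p) \<circ> flip)) *
          of_bool (\<forall>x\<in>S. col (\<pi> x) = col ((flip \<circ> (p0 \<circ> p) \<circ> flip) x)) =
        of_int (sign p) * (of_bool (\<forall>x\<in>S. col (\<pi> x) = col (flip (p0 (p (flip x))))) :: rat)"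
      by simp
  next
    fix q assume q: "q \<in> Q"
    show "inv p0 \<circ> (flip \<circ> q \<circ> flip) \<in> P" using q p0 by (intro preserving_comp preserving_inv flip_conj')
    show "flip \<circ> (p0 \<circ> (inv p0 \<circ> (flip \<circ> q \<circ> flip))) \<circ> flip = q"
      by (simp add: fun_eq_iff flip_flip permutes_inverses[OF p0(2)])
  qed
  also have "\<dots> = of_int (sign p0) * (\<Sum>q\<in>Q. of_int (sign q) * of_bool (\<forall>x\<in>S. col (\<pi> x) = col (q x)))"
    by (simp add: sum_distrib_left mult.assoc)
  finally have T: "flip_tensor (row \<circ> \<pi>) (col \<circ> \<pi>)
    = of_int (sign p0) * (\<Sum>q\<in>Q. of_int (sign q) * of_bool (\<forall>x\<in>S. col (\<pi> x) = col (q x)))" .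
  have "of_int (sign \<pi>) * (\<Sum>q\<in>Q. of_int (sign q) * of_bool (\<forall>x\<in>S. col (\<pi> x) = col (q x)))
      = (\<Sum>q\<in>Q. col_sign (\<pi> \<circ> inv q))"
    unfolding sum_distrib_left
  proof (intro sum.cong refl)
    fix q assume q: "q \<in> Q"
    have perm: "q permutes S" "inv q permutes S" using preserving_permutes[OF q] permutes_inv by auto
    have "\<pi> \<circ> inv q \<in> P \<longleftrightarrow> (\<forall>x\<in>S. col (\<pi> (inv q x)) = col x)"
      using \<pi> perm by (simp add: preserving_def permutes_compose)
    also have "\<dots> \<longleftrightarrow> (\<forall>x\<in>S. col (\<pi> x) = col (q x))"
      using perm by (metis permutes_in_image permutes_inverses)
    finally show "of_int (sign \<pi>) * (of_int (sign q) * of_bool (\<forall>x\<in>S. col (\<pi> x) = col (q x)))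
        = col_sign (\<pi> \<circ> inv q)"
      using \<pi> perm by (simp add: col_sign_def sign_comp sign_inv)
  qed
  also have "\<dots> = col_row_coeff \<pi>"
    unfolding col_row_coeff_def by (rule sum.reindex_bij_witness[of _ inv inv])
      (simp_all add: preserving_inv preserving_inv_inv)
  finally show ?thesis by (simp add: T A mult.left_commute)
next
  case False
  then have "row_col_coeff \<pi> = 0" by (simp add: row_col_coeff_def col_sign_def)
  moreover have "\<exists>x\<in>S. \<exists>y\<in>S. x \<noteq> y \<and> col x = col y \<and> row (\<pi> x) = row (\<pi> y)"
  proof (rule ccontr)
    assume no: "\<not> ?thesis"
    \<comment> \<open>Each column would be mapped injectively to the rows. Sorting its cells accordingly is a column
      permutation p, and p differs from \<pi> by a row permutation.\<close>
    define p where "p x = (if x \<in> S then cell (row (\<pi> x)) (col x) else x)" for x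
    have less: "row (\<pi> x) < d" "col x < d" if "x \<in> S" for x
      using that row_col_less \<pi> by (simp_all add: permutes_in_image)
    have p_in: "p x \<in> S" "row (p x) = row (\<pi> x)" "col (p x) = col x" if "x \<in> S" for x
      using that less cell by (auto simp: p_def)
    have "inj_on p S" using no p_in by (metis inj_onI)
    moreover have "p ` S \<subseteq> S" using p_in by blast
    ultimately have "bij_betw p S S" using fin by (simp add: bij_betw_def endo_inj_surj)
    then have p: "p permutes S" by (rule bij_imp_permutes) (simp add: p_def)
    then have "p \<in> P" using p_in by (simp add: preserving_def)
    have "row (p (inv \<pi> x)) = row x" if "x \<in> S" for x
      using p_in(2)[of "inv \<pi> x"] that \<pi>
      by (simp add: permutes_in_image[OF permutes_inv[OF \<pi>]] permutes_inverses[OF \<pi>])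
    then have "p \<circ> inv \<pi> \<in> Q" using p \<pi> by (simp add: preserving_def permutes_compose permutes_inv)
    moreover have "p \<circ> inv \<pi> \<circ> \<pi> \<in> P"
      using \<open>p \<in> P\<close> by (simp add: comp_assoc permutes_inv_o[OF \<pi>])
    ultimately show False using False by blast
  qed
  then obtain x y where xy: "x \<in> S" "y \<in> S" "x \<noteq> y" "col x = col y" "row (\<pi> x) = row (\<pi> y)" by blast
  have swap: "transpose x y \<in> P"
    using xy permutes_swap_id[OF xy(1,2)] by (auto simp: preserving_def transpose_def)
  have "flip_tensor (row \<circ> \<pi>) (col \<circ> \<pi>) = 0"
    unfolding flip_tensor_def
  proof (rule signed_sum_eq_0_if_transpose_invariant[OF xy(3)])
    fix p assume p: "p \<in> P"
    show "permutation p" using p preserving_permutes permutation_if_permutes by blast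
    show "transpose x y \<circ> p \<in> P" using swap p by (rule preserving_comp)
    have "row (\<pi> (transpose x y z)) = row (\<pi> z)" for z
      using xy(5) by (simp add: transpose_def)
    then show "of_bool (\<forall>xa\<in>S. (col \<circ> \<pi>) xa = (row \<circ> \<pi>) ((transpose x y \<circ> p) (flip xa))) =
        of_bool (\<forall>x\<in>S. (col \<circ> \<pi>) x = (row \<circ> \<pi>) (p (flip x)))"
      by simp
  qed
  ultimately show ?thesis by simp
qed

definition alt_flip_tensor :: "('a \<Rightarrow> nat) \<Rightarrow> ('a \<Rightarrow> nat) \<Rightarrow> rat" where
  "alt_flip_tensor r c = (\<Sum>\<pi> | \<pi> permutes S. of_int (sign \<pi>) * flip_tensor (r \<circ> \<pi>) (c \<circ> \<pi>))"

lemma alternating_alt_flip_tensor: "alternating_on S alt_flip_tensor"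
proof (rule alternating_onI_sum[where g = flip_tensor, OF fin _ alt_flip_tensor_def])
  fix r c r' c' :: "'a \<Rightarrow> nat" assume *: "\<forall>p\<in>S. r p = r' p \<and> c p = c' p"
  show "flip_tensor r c = flip_tensor r' c'"
    unfolding flip_tensor_def
  proof (intro sum.cong refl)
    fix p assume "p \<in> P"
    then have "p (flip x) \<in> S" if "x \<in> S" for x
      using that flip_in preserving_permutes by (metis permutes_in_image)
    then show "of_int (sign p) * of_bool (\<forall>x\<in>S. c x = r (p (flip x)))
        = of_int (sign p) * (of_bool (\<forall>x\<in>S. c' x = r' (p (flip x))) :: rat)"
      using * by simp
  qed
qed

lemma alt_flip_tensor_row_col_pos: "alt_flip_tensor row col > 0"
  unfolding alt_flip_tensor_def using sum_row_col_coeff_col_row_coeff_pos by (simp add: flip_tensor_cell)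

lemma perm_span_alt_flip_tensor: "perm_span d S S alt_flip_tensor"
proof -
  have terms: "perm_span d S S (\<lambda>r c. of_int (sign \<pi>) * (of_int (sign p) *
      of_bool (\<forall>x\<in>S. (c \<circ> \<pi>) x = (r \<circ> \<pi>) (p (flip x)))))"
    if "\<pi> permutes S" "p \<in> P" for \<pi> p
  proof -
    define \<sigma> where "\<sigma> = \<pi> \<circ> (p \<circ> (flip \<circ> inv \<pi>))"
    have perm: "p permutes S" "inv \<pi> permutes S" using that preserving_permutes permutes_inv by auto
    have "\<sigma> permutes S"
      unfolding \<sigma>_def using that perm flip_permutes by (intro permutes_compose)
    then have bij: "bij_betw \<sigma> S S" by (rule permutes_imp_bij)
    have eq: "(\<forall>x\<in>S. c (\<pi> x) = r (\<pi> (p (flip x)))) = (\<forall>y\<in>S. c y = r (\<sigma> y))" for r c :: "'a \<Rightarrow> nat"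
    proof -
      have "(\<forall>y\<in>S. c y = r (\<sigma> y)) = (\<forall>y\<in>\<pi> ` S. c y = r (\<sigma> y))"
        using permutes_image[OF that(1)] by simp
      also have "\<dots> = (\<forall>x\<in>S. c (\<pi> x) = r (\<pi> (p (flip x))))"
        by (simp add: \<sigma>_def permutes_inverses[OF that(1)])
      finally show ?thesis ..
    qed
    show ?thesis
      unfolding comp_apply eq mult.assoc[symmetric] by (rule perm_span.delta[OF bij])
  qed
  have id: "bij_betw id S S" by simp
  have "perm_span d S S (\<lambda>r c. \<Sum>\<pi> | \<pi> permutes S. \<Sum>p\<in>P. of_int (sign \<pi>) * (of_int (sign p) *
      of_bool (\<forall>x\<in>S. (c \<circ> \<pi>) x = (r \<circ> \<pi>) (p (flip x)))))"
    using terms by (intro perm_span_sum[OF _ _ id] finite_permutations finite_preserving fin) auto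
  then show ?thesis
    unfolding alt_flip_tensor_def[abs_def] flip_tensor_def sum_distrib_left .
qed

text \<open>The alternation of \<open>flip_tensor\<close> is a sum of permutations and does not vanish, so every
alternating tensor is a multiple of it.\<close>
lemma perm_span_if_alternating:
  assumes "alternating_on S f"
  shows "perm_span d S S f"
proof (rule perm_span.cong[OF perm_span_scale[OF perm_span_alt_flip_tensor]])
  fix r c :: "'a \<Rightarrow> nat"
  assume "\<forall>p\<in>S. r p < d" "\<forall>q\<in>S. c q < d"
  then have "alt_flip_tensor row col * f r c = f row col * alt_flip_tensor r c"
    by (rule alternating_on_proportional[OF alternating_alt_flip_tensor assms])
  then show "f row col / alt_flip_tensor row col * alt_flip_tensor r c = f r c"
    using alt_flip_tensor_row_col_pos by (simp add: field_simps)
qed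

end

section \<open>Inverting the Jucys--Murphy factors\<close>

text \<open>An injective endomorphism of a finite-dimensional space is onto. The unknowns are indexed by a
finite set; the solution comes from the adjugate matrix.\<close>
lemma linear_system_solvable:
  fixes A :: "'a \<Rightarrow> 'a \<Rightarrow> rat"
  assumes S: "finite S"
    and inj: "\<And>f. (\<forall>s\<in>S. (\<Sum>t\<in>S. A s t * f t) = 0) \<Longrightarrow> \<forall>s\<in>S. f s = 0"
  shows "\<exists>f. \<forall>s\<in>S. (\<Sum>t\<in>S. A s t * f t) = v s"
proof -
  define n where "n = card S"
  obtain e where e: "bij_betw e {0..<n} S" using ex_bij_betw_nat_finite[OF S] n_def by blast
  define M where "M = mat n n (\<lambda>(i, j). A (e i) (e j))"
  define e' where "e' = inv_into {0..<n} e"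
  have e'_e: "e' (e i) = i" if "i < n" for i using e that by (simp add: e'_def bij_betw_def)
  have e_e': "e (e' s) = s" "e' s < n" if s: "s \<in> S" for s
  proof -
    show "e (e' s) = s" unfolding e'_def by (rule bij_betw_inv_into_right[OF e s])
    have "e' s \<in> {0..<n}" unfolding e'_def using bij_betwE[OF bij_betw_inv_into[OF e]] s by blast
    then show "e' s < n" by simp
  qed
  have M: "M \<in> carrier_mat n n" by (simp add: M_def)
  have sum_e: "(\<Sum>t\<in>S. g t) = (\<Sum>j = 0..<n. g (e j))" for g :: "'a \<Rightarrow> rat"
    by (rule sum.reindex_bij_betw[OF e, symmetric])
  have mult: "(M *\<^sub>v x) $ i = (\<Sum>t\<in>S. A (e i) t * x $ e' t)" if "x \<in> carrier_vec n" "i < n" for x i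
    using that by (simp add: M_def scalar_prod_def sum_e e'_e)
  have "det M \<noteq> 0"
  proof
    assume "det M = 0"
    then obtain x where x: "x \<in> carrier_vec n" "x \<noteq> 0\<^sub>v n" "M *\<^sub>v x = 0\<^sub>v n"
      using det_0_iff_vec_prod_zero[OF M] by blast
    have "(\<Sum>t\<in>S. A s t * x $ e' t) = 0" if "s \<in> S" for s
      using mult[OF x(1) e_e'(2)[OF that]] x(3) e_e'[OF that] by simp
    then have zero: "\<forall>s\<in>S. x $ e' s = 0" using inj[of "\<lambda>s. x $ e' s"] by blast
    have "x $ i = 0" if "i < n" for i
    proof -
      have "e i \<in> S" using bij_betwE[OF e] that by auto
      then show ?thesis using zero e'_e[OF that] by metis
    qed
    then have "x = 0\<^sub>v n" using x(1) by (intro eq_vecI) auto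
    then show False using x(2) by blast
  qed
  define b where "b = vec n (\<lambda>i. v (e i))"
  define x where "x = (1 / det M) \<cdot>\<^sub>v (adj_mat M *\<^sub>v b)"
  have b: "b \<in> carrier_vec n" by (simp add: b_def)
  have x: "x \<in> carrier_vec n" using adj_mat(1)[OF M] b by (simp add: x_def)
  have "M *\<^sub>v x = (1 / det M) \<cdot>\<^sub>v (M *\<^sub>v (adj_mat M *\<^sub>v b))"
    unfolding x_def using adj_mat(1)[OF M] b by (intro mult_mat_vec[OF M]) auto
  also have "M *\<^sub>v (adj_mat M *\<^sub>v b) = (det M \<cdot>\<^sub>m 1\<^sub>m n) *\<^sub>v b"
    using adj_mat[OF M] b M by (metis assoc_mult_mat_vec)
  also have "\<dots> = det M \<cdot>\<^sub>v b" using b by (intro eq_vecI) (simp_all add: scalar_prod_def sum.delta' if_distrib[of "\<lambda>x. det M * x"] if_distrib[of "\<lambda>x. x * _"] cong: if_cong)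
  also have "(1 / det M) \<cdot>\<^sub>v \<dots> = b" using \<open>det M \<noteq> 0\<close> by (simp add: smult_smult_assoc)
  finally have Mx: "M *\<^sub>v x = b" .
  have "(\<Sum>t\<in>S. A s t * x $ e' t) = v s" if "s \<in> S" for s
    using mult[OF x e_e'(2)[OF that]] e_e'[OF that] by (simp add: Mx b_def)
  then show ?thesis by (intro exI[of _ "\<lambda>t. x $ e' t"] ballI)
qed

text \<open>A minimum principle: at a minimum of $w$ the at most $d - 1$ neighbours are at least as large, so
$d\, w \ge \sum w$ over the neighbours cannot hold there if $w$ is negative.\<close>
lemma nonneg_if_dominates_neighbours:
  fixes w v :: "'a \<Rightarrow> rat" and nb :: "'b \<Rightarrow> 'a \<Rightarrow> 'a"
  assumes G: "finite G" and J: "card J < d" and nb: "\<And>s j. s \<in> G \<Longrightarrow> j \<in> J \<Longrightarrow> nb j s \<in> G"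
    and eq: "\<And>s. s \<in> G \<Longrightarrow> of_nat d * w s - (\<Sum>j\<in>J. w (nb j s)) = v s"
    and v: "\<And>s. s \<in> G \<Longrightarrow> v s \<ge> 0" and "s \<in> G"
  shows "w s \<ge> 0"
proof -
  have "Min (w ` G) \<in> w ` G" using G \<open>s \<in> G\<close> by (intro Min_in) auto
  then obtain m where m: "m \<in> G" "w m = Min (w ` G)" by auto
  have least: "w m \<le> w s" if "s \<in> G" for s using m(2) G that by simp
  have "of_nat (card J) * w m \<le> (\<Sum>j\<in>J. w (nb j m))"
    using sum_bounded_below[of J "w m" "\<lambda>j. w (nb j m)"] least nb[OF m(1)] by simp
  also have "\<dots> \<le> of_nat d * w m" using eq[OF m(1)] v[OF m(1)] by linarith
  finally have "(of_nat d - of_nat (card J)) * w m \<ge> 0" by (simp add: algebra_simps)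
  moreover have "(of_nat d - of_nat (card J) :: rat) > 0" using J by simp
  ultimately have "w m \<ge> 0" by (simp add: zero_le_mult_iff)
  then show ?thesis using least[OF \<open>s \<in> G\<close>] by simp
qed

lemma neighbour_system_solvable:
  fixes v :: "'a \<Rightarrow> rat" and nb :: "'b \<Rightarrow> 'a \<Rightarrow> 'a"
  assumes G: "finite G" and J: "card J < d" "finite J" and nb: "\<And>s j. s \<in> G \<Longrightarrow> j \<in> J \<Longrightarrow> nb j s \<in> G"
  shows "\<exists>w. \<forall>s\<in>G. of_nat d * w s - (\<Sum>j\<in>J. w (nb j s)) = v s"
proof -
  define A :: "'a \<Rightarrow> 'a \<Rightarrow> rat"
    where "A s t = of_nat d * of_bool (s = t) - (\<Sum>j\<in>J. of_bool (nb j s = t))" for s t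
  have A: "(\<Sum>t\<in>G. A s t * w t) = of_nat d * w s - (\<Sum>j\<in>J. w (nb j s))" if s: "s \<in> G" for s w
  proof -
    have "(\<Sum>t\<in>G. of_bool (u = t) * w t) = w u" if "u \<in> G" for u
      using G that by (simp add: of_bool_def if_distrib[of "\<lambda>x. x * _"] sum.delta cong: if_cong)
    note one = this
    have "(\<Sum>t\<in>G. A s t * w t) = of_nat d * (\<Sum>t\<in>G. of_bool (s = t) * w t)
        - (\<Sum>t\<in>G. \<Sum>j\<in>J. of_bool (nb j s = t) * w t)"
      unfolding A_def left_diff_distrib sum_subtractf sum_distrib_left sum_distrib_right mult.assoc ..
    also have "(\<Sum>t\<in>G. \<Sum>j\<in>J. of_bool (nb j s = t) * w t) = (\<Sum>j\<in>J. \<Sum>t\<in>G. of_bool (nb j s = t) * w t)"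
      by (rule sum.swap)
    also have "\<dots> = (\<Sum>j\<in>J. w (nb j s))"
      using one nb[OF s] by (intro sum.cong refl) auto
    finally show ?thesis using one[OF s] by simp
  qed
  have "\<exists>w. \<forall>s\<in>G. (\<Sum>t\<in>G. A s t * w t) = v s"
  proof (rule linear_system_solvable[OF G])
    fix w assume w: "\<forall>s\<in>G. (\<Sum>t\<in>G. A s t * w t) = 0"
    show "\<forall>s\<in>G. w s = 0"
    proof
      fix s assume s: "s \<in> G"
      have "w s \<ge> 0"
        by (rule nonneg_if_dominates_neighbours[OF G J(1) nb _ _ s, where v = "\<lambda>_. 0"]) (use w A in auto)
      moreover have "- w s \<ge> 0"
        by (rule nonneg_if_dominates_neighbours[OF G J(1) nb _ _ s, where v = "\<lambda>_. 0" and w = "\<lambda>s. - w s"])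
          (use w A in \<open>auto simp: sum_negf\<close>)
      ultimately show "w s = 0" by simp
    qed
  qed
  then show ?thesis using A by simp
qed

text \<open>The trace of the operator $g$ on $k$ tensor factors of dimension $d$.\<close>
definition fix_count :: "nat \<Rightarrow> nat \<Rightarrow> (nat \<Rightarrow> nat) \<Rightarrow> rat" where
  "fix_count d k g = (\<Sum>u\<in>{1..k} \<rightarrow>\<^sub>E {..<d}. of_bool (\<forall>i\<in>{1..k}. u (g i) = u i))"

lemma fix_count_Suc_fixed:
  assumes "g (Suc k) = Suc k" "g permutes {1..k}"
  shows "fix_count d (Suc k) g = of_nat d * fix_count d k g"
proof -
  have ins: "{1..Suc k} = insert (Suc k) {1..k}" by auto
  have "(\<forall>i\<in>{1..Suc k}. (u(Suc k := z)) (g i) = (u(Suc k := z)) i) = (\<forall>i\<in>{1..k}. u (g i) = u i)"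
    for u :: "nat \<Rightarrow> nat" and z
  proof -
    have "g i \<noteq> Suc k" if "i \<in> {1..k}" for i using permutes_in_image[OF assms(2), of i] that by auto
    then show ?thesis unfolding ins using assms(1) by auto
  qed
  then have "fix_count d (Suc k) g = (\<Sum>u\<in>{1..k} \<rightarrow>\<^sub>E {..<d}. \<Sum>z<d. of_bool (\<forall>i\<in>{1..k}. u (g i) = u i))"
    unfolding fix_count_def ins by (subst sum_PiE_insert) auto
  then show ?thesis by (simp add: fix_count_def sum_distrib_left)
qed

lemma sum_of_bool_eq_conj: "a < d \<Longrightarrow> (\<Sum>z<d. of_bool (z = a \<and> B)) = (of_bool B :: rat)" for a d :: nat
  by (cases B) (simp_all add: of_bool_def)

lemma fix_count_Suc_moved:
  assumes "g permutes {1..Suc k}" "g (Suc k) = j" "j \<in> {1..k}"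
  shows "fix_count d (Suc k) g = fix_count d k (transpose j (Suc k) \<circ> g)"
proof -
  have ins: "{1..Suc k} = insert (Suc k) {1..k}" by auto
  have g_in: "g i \<in> {1..Suc k}" "g i \<noteq> j" if "i \<in> {1..k}" for i
  proof -
    show "g i \<in> {1..Suc k}" using permutes_in_image[OF assms(1), of i] that by simp
    show "g i \<noteq> j" 
    proof
      assume "g i = j"
      then have "i = Suc k" using injD[OF permutes_inj[OF assms(1)], of i "Suc k"] assms(2) by simp
      then show False using that by simp
    qed
  qed
  have iff: "(\<forall>i\<in>{1..Suc k}. (u(Suc k := z)) (g i) = (u(Suc k := z)) i)
    = (z = u j \<and> (\<forall>i\<in>{1..k}. u ((transpose j (Suc k) \<circ> g) i) = u i))" (is "?L = ?R")
    for u :: "nat \<Rightarrow> nat" and z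
  proof -
    have "?L \<longleftrightarrow> z = u j \<and> (\<forall>i\<in>{1..k}. (u(Suc k := z)) (g i) = u i)"
      unfolding ins using assms(2,3) by auto
    also have "\<dots> \<longleftrightarrow> ?R"
      using g_in by (intro conj_cong refl ball_cong) (auto simp: transpose_def)
    finally show ?thesis .
  qed
  have "fix_count d (Suc k) g = (\<Sum>u\<in>{1..k} \<rightarrow>\<^sub>E {..<d}. \<Sum>z<d.
      of_bool (z = u j \<and> (\<forall>i\<in>{1..k}. u ((transpose j (Suc k) \<circ> g) i) = u i)))"
    unfolding fix_count_def iff[symmetric] unfolding ins by (rule sum_PiE_insert) simp
  also have "\<dots> = fix_count d k (transpose j (Suc k) \<circ> g)"
    unfolding fix_count_def
  proof (intro sum.cong refl)
    fix u assume "u \<in> {1..k} \<rightarrow>\<^sub>E {..<d}"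
    then have "u j < d" using assms(3) by (auto simp: PiE_iff)
    then show "(\<Sum>z<d. of_bool (z = u j \<and> (\<forall>i\<in>{1..k}. u ((transpose j (Suc k) \<circ> g) i) = u i)))
      = (of_bool (\<forall>i\<in>{1..k}. u ((transpose j (Suc k) \<circ> g) i) = u i) :: rat)"
      by (rule sum_of_bool_eq_conj)
  qed
  finally show ?thesis .
qed

lemma fix_count_eq_power:
  assumes "g permutes {1..k}"
  shows "fix_count d k g = of_nat d ^ card (orbit g ` {1..k})"
proof -
  let ?S = "{1..k}" and ?C = "orbit g ` {1..k}"
  have pg: "permutation g" using assms permutation_permutes by blast
  have self: "x \<in> orbit g x" for x by (rule permutation_self_in_orbit[OF pg])
  let ?U = "{u \<in> ?S \<rightarrow>\<^sub>E {..<d}. \<forall>i\<in>?S. u (g i) = u i}"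
  let ?f = "\<lambda>v. \<lambda>x\<in>?S. v (orbit g x)"
  have "bij_betw ?f (?C \<rightarrow>\<^sub>E {..<d}) ?U"
    unfolding bij_betw_def
  proof
    show "inj_on ?f (?C \<rightarrow>\<^sub>E {..<d})"
    proof (rule inj_onI)
      fix v w assume vw: "v \<in> ?C \<rightarrow>\<^sub>E {..<d}" "w \<in> ?C \<rightarrow>\<^sub>E {..<d}" "?f v = ?f w"
      have "v (orbit g x) = w (orbit g x)" if "x \<in> ?S" for x
        using fun_cong[OF vw(3), of x] that by simp
      then show "v = w" using vw(1,2) by (intro PiE_ext) auto
    qed
    show "?f ` (?C \<rightarrow>\<^sub>E {..<d}) = ?U"
    proof (intro subset_antisym subsetI)
      fix u assume "u \<in> ?f ` (?C \<rightarrow>\<^sub>E {..<d})"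
      then obtain v where v: "v \<in> ?C \<rightarrow>\<^sub>E {..<d}" "u = ?f v" by blast
      have "g x \<in> ?S" "orbit g (g x) = orbit g x" if "x \<in> ?S" for x
        using that permutes_in_image[OF assms, of x] orbit_eq_if_in_orbit[OF pg orbit.base] by auto
      then show "u \<in> ?U" using v by (auto simp: PiE_iff)
    next
      fix u assume u: "u \<in> ?U"
      define v where "v = (\<lambda>c\<in>?C. u (SOME y. y \<in> c))"
      have const: "u y = u x" if "x \<in> ?S" "y \<in> orbit g x" for x y
        using that(2)
      proof induction
        case base
        then show ?case using u that(1) by auto
      next
        case (step y)
        then have "y \<in> ?S" using permutes_orbit_subset[OF assms that(1)] by blast
        then show ?case using step u by auto
      qed
      have "u (SOME y. y \<in> orbit g x) = u x" if "x \<in> ?S" for x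
        using const[OF that] someI[of "\<lambda>y. y \<in> orbit g x", OF self] by blast
      note some = this
      have "u = ?f v"
        using u some by (auto simp: v_def PiE_iff extensional_def)
      moreover have "v \<in> ?C \<rightarrow>\<^sub>E {..<d}"
        using u some by (auto simp: v_def PiE_iff)
      ultimately show "u \<in> ?f ` (?C \<rightarrow>\<^sub>E {..<d})" by blast
    qed
  qed
  then have "card ?U = card (?C \<rightarrow>\<^sub>E {..<d})" by (rule bij_betw_same_card[symmetric])
  also have "\<dots> = d ^ card ?C" by (simp add: card_PiE)
  finally have "card ?U = d ^ card ?C" .
  moreover have "fix_count d k g = of_nat (card ?U)"
    unfolding fix_count_def by (simp add: finite_PiE Int_def sum.If_cases of_bool_def)
  ultimately show ?thesis by simp
qed

lemma permutes_lower:
  assumes "g permutes {1..Suc k}" "g (Suc k) = Suc k"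
  shows "g permutes {1..k}"
proof (rule permutes_superset[OF assms(1)])
  fix x assume "x \<in> {1..Suc k} - {1..k}"
  then have "x = Suc k" by auto
  then show "g x = x" using assms(2) by simp
qed

text \<open>With the Jucys--Murphy element $J = \sum_{j \le k} (j\; k{+}1)$ this says
$\sum_{g \in S_{k+1}} d^{\#\mathrm{cycles}(g)} g = (d + J) \sum_{g \in S_k} d^{\#\mathrm{cycles}(g)} g$:
the point $k + 1$ either is a cycle of its own or is inserted into a cycle in front of a point
$j \le k$.\<close>
lemma fix_count_Suc:
  assumes g: "g permutes {1..Suc k}"
  shows "fix_count d (Suc k) g = of_nat d * (if g permutes {1..k} then fix_count d k g else 0) +
    (\<Sum>j\<in>{1..k}. if (transpose j (Suc k) \<circ> g) permutes {1..k}
       then fix_count d k (transpose j (Suc k) \<circ> g) else 0)"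
proof -
  have fixed: "(transpose j (Suc k) \<circ> g) permutes {1..k} \<longleftrightarrow> g (Suc k) = j" if j: "j \<in> {1..k}" for j
  proof
    assume "(transpose j (Suc k) \<circ> g) permutes {1..k}"
    then have "transpose j (Suc k) (g (Suc k)) = Suc k" by (auto dest!: permutes_not_in[of _ _ "Suc k"])
    then show "g (Suc k) = j" by (metis transpose_apply_first transpose_involutory)
  next
    assume gj: "g (Suc k) = j"
    have "(transpose j (Suc k) \<circ> g) permutes {1..Suc k}"
      by (rule permutes_compose[OF g permutes_swap_id]) (use j in simp_all)
    then show "(transpose j (Suc k) \<circ> g) permutes {1..k}" by (rule permutes_lower) (simp add: gj)
  qed
  show ?thesis
  proof (cases "g (Suc k) = Suc k")
    case True
    have "g permutes {1..k}" by (rule permutes_lower[OF g True])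
    moreover have "(\<Sum>j\<in>{1..k}. if (transpose j (Suc k) \<circ> g) permutes {1..k}
       then fix_count d k (transpose j (Suc k) \<circ> g) else 0) = 0"
      using fixed True by (intro sum.neutral) auto
    ultimately show ?thesis using fix_count_Suc_fixed[of g, OF True] by simp
  next
    case False
    have not: "\<not> g permutes {1..k}"
    proof
      assume "g permutes {1..k}"
      from permutes_not_in[OF this, of "Suc k"] False show False by simp
    qed
    have j: "g (Suc k) \<in> {1..k}"
      using permutes_in_image[OF g, of "Suc k"] False by simp
    have "(\<Sum>j\<in>{1..k}. if (transpose j (Suc k) \<circ> g) permutes {1..k}
       then fix_count d k (transpose j (Suc k) \<circ> g) else 0)
      = (\<Sum>j\<in>{1..k}. if j = g (Suc k) then fix_count d k (transpose (g (Suc k)) (Suc k) \<circ> g) else 0)"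
    proof (intro sum.cong refl)
      fix j assume j: "j \<in> {1..k}"
      show "(if (transpose j (Suc k) \<circ> g) permutes {1..k}
          then fix_count d k (transpose j (Suc k) \<circ> g) else 0)
        = (if j = g (Suc k) then fix_count d k (transpose (g (Suc k)) (Suc k) \<circ> g) else 0)"
        unfolding fixed[OF j] by (cases "g (Suc k) = j") simp_all
    qed
    also have "\<dots> = fix_count d (Suc k) g"
      using j fix_count_Suc_moved[OF g refl j, of d] by simp
    finally show ?thesis using not by simp
  qed
qed

text \<open>By induction on $k$ the factors $d + J$ are inverted. Replacing $w(\pi)$ by
$\epsilon_\pi\, w(\pi)$ turns $d + J$ into $d - J$, and $J$ has less than $d$ summands. So the
equation has a solution by the minimum principle, and this solution is positive.\<close>
lemma signed_inverse_exists:
  assumes "k \<le> d"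
  shows "\<exists>w. (\<forall>\<pi>. \<not> \<pi> permutes {1..k} \<longrightarrow> w \<pi> = 0) \<and>
    (\<forall>\<pi>. \<pi> permutes {1..k} \<longrightarrow> of_int (sign \<pi>) * w \<pi> > (0::rat)) \<and>
    (\<forall>\<pi>. \<pi> permutes {1..k} \<longrightarrow>
      (\<Sum>\<tau> | \<tau> permutes {1..k}. w \<tau> * fix_count d k (inv \<tau> \<circ> \<pi>)) = of_bool (\<pi> = id))"
  using assms
proof (induction k)
  case 0
  have *: "\<pi> permutes {1..0::nat} \<longleftrightarrow> \<pi> = id" for \<pi> :: "nat \<Rightarrow> nat" by simp
  have one: "fix_count d 0 g = 1" for g by (simp add: fix_count_def)
  have set: "{\<tau>. \<tau> = id} = {id :: nat \<Rightarrow> nat}" by blast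
  show ?case
    unfolding * one set by (intro exI[of _ "\<lambda>\<pi>. of_bool (\<pi> = id)"] conjI allI impI) (simp_all add: id_def)
next
  case (Suc k)
  from Suc.prems have "k \<le> d" by simp
  from Suc.IH[OF this] obtain v :: "(nat \<Rightarrow> nat) \<Rightarrow> rat" where v': "(\<forall>\<pi>. \<not> \<pi> permutes {1..k} \<longrightarrow> v \<pi> = 0) \<and>
    (\<forall>\<pi>. \<pi> permutes {1..k} \<longrightarrow> of_int (sign \<pi>) * v \<pi> > (0::rat)) \<and>
    (\<forall>\<pi>. \<pi> permutes {1..k} \<longrightarrow>
      (\<Sum>\<tau> | \<tau> permutes {1..k}. v \<tau> * fix_count d k (inv \<tau> \<circ> \<pi>)) = of_bool (\<pi> = id))" ..
  note v = v'[THEN conjunct1, rule_format] v'[THEN conjunct2, THEN conjunct1, rule_format]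
    v'[THEN conjunct2, THEN conjunct2, rule_format]
  let ?G = "{\<pi>. \<pi> permutes {1..Suc k}}" and ?G' = "{\<pi>. \<pi> permutes {1..k}}"
  let ?t = "\<lambda>j. transpose j (Suc k)"
  have perm: "permutation \<pi>" if "\<pi> \<in> ?G" for \<pi>
    using that permutes_imp_permutation[of "{1..Suc k}"] by simp
  have sub: "?G' \<subseteq> ?G" by (auto intro: permutes_subset)
  have t: "?t j permutes {1..Suc k}" if "j \<in> {1..k}" for j
    by (rule permutes_swap_id) (use that in auto)
  have nb: "\<pi> \<circ> ?t j \<in> ?G" if "\<pi> \<in> ?G" "j \<in> {1..k}" for \<pi> j
    using that t by (auto intro: permutes_compose)
  have fin: "finite ?G" by (simp add: finite_permutations)
  \<comment> \<open>The names sv and sw stand for v and w multiplied by the sign.\<close>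
  define sv :: "(nat \<Rightarrow> nat) \<Rightarrow> rat" where "sv \<pi> = of_int (sign \<pi>) * v \<pi>" for \<pi>
  have sv: "sv \<pi> \<ge> 0" for \<pi> using v(1)[of \<pi>] v(2)[of \<pi>] by (cases "\<pi> permutes {1..k}") (auto simp: sv_def)
  have card: "card {1..k} < d" using Suc.prems by simp
  obtain sw where sw: "\<And>\<pi>. \<pi> \<in> ?G \<Longrightarrow> of_nat d * sw \<pi> - (\<Sum>j\<in>{1..k}. sw (\<pi> \<circ> ?t j)) = sv \<pi>"
    using neighbour_system_solvable[OF fin card, of "\<lambda>j \<pi>. \<pi> \<circ> ?t j" sv] nb by auto
  have nonneg: "sw \<pi> \<ge> 0" if "\<pi> \<in> ?G" for \<pi>
    by (rule nonneg_if_dominates_neighbours[where nb = "\<lambda>j \<pi>. \<pi> \<circ> ?t j" and J = "{1..k}" and v = sv,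
      OF fin card nb sw sv that])
  have d: "(of_nat d :: rat) > 0" using Suc.prems by simp
  have lower: "of_nat d * sw \<pi> \<ge> sv \<pi>" if "\<pi> \<in> ?G" for \<pi>
  proof -
    have "(\<Sum>j\<in>{1..k}. sw (\<pi> \<circ> ?t j)) \<ge> 0" using nonneg nb[OF that] by (intro sum_nonneg) auto
    then show ?thesis using sw[OF that] by linarith
  qed
  have pos: "sw \<pi> > 0" if \<pi>: "\<pi> \<in> ?G'" for \<pi>
  proof -
    have "0 < sv \<pi>" unfolding sv_def by (rule v(2)) (use \<pi> in simp)
    also have "\<dots> \<le> of_nat d * sw \<pi>" by (rule lower) (use sub \<pi> in blast)
    finally show ?thesis using d by (simp add: zero_less_mult_iff)
  qed
  \<comment> \<open>If \<pi> moves k + 1, exactly one of its neighbours fixes k + 1, where positivity is known.\<close>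
  have pos: "sw \<pi> > 0" if \<pi>: "\<pi> \<in> ?G" for \<pi>
  proof (cases "\<pi> permutes {1..k}")
    case False
    define j where "j = inv \<pi> (Suc k)"
    have perm_\<pi>: "\<pi> permutes {1..Suc k}" using \<pi> by simp
    have \<pi>j: "\<pi> j = Suc k" unfolding j_def by (rule permutes_inverses(1)[OF perm_\<pi>])
    have "j \<noteq> Suc k"
    proof
      assume "j = Suc k"
      then have "\<pi> (Suc k) = Suc k" using \<pi>j by simp
      then show False using permutes_lower[OF perm_\<pi>] False by blast
    qed
    moreover have "j \<in> {1..Suc k}" using permutes_in_image[OF perm_\<pi>, of j] \<pi>j by simp
    ultimately have j: "j \<in> {1..k}" by auto
    have "(\<pi> \<circ> ?t j) permutes {1..k}"
      by (rule permutes_lower) (use nb[OF \<pi> j] \<pi>j in simp_all)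
    then have "0 < sw (\<pi> \<circ> ?t j)" using pos by simp
    also have "\<dots> \<le> (\<Sum>j\<in>{1..k}. sw (\<pi> \<circ> ?t j))"
      using nonneg nb[OF \<pi>] j by (intro member_le_sum) auto
    also have "\<dots> \<le> of_nat d * sw \<pi>" using sw[OF \<pi>] sv[of \<pi>] by linarith
    finally show ?thesis using d by (simp add: zero_less_mult_iff)
  qed (use pos in simp)
  define w :: "(nat \<Rightarrow> nat) \<Rightarrow> rat"
    where "w \<pi> = (if \<pi> \<in> ?G then of_int (sign \<pi>) * sw \<pi> else 0)" for \<pi>
  have w: "of_nat d * w \<pi> + (\<Sum>j\<in>{1..k}. w (\<pi> \<circ> ?t j)) = v \<pi>" if \<pi>: "\<pi> \<in> ?G" for \<pi>
  proof -
    have "w (\<pi> \<circ> ?t j) = - (of_int (sign \<pi>) * sw (\<pi> \<circ> ?t j))" if j: "j \<in> {1..k}" for j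
      using nb[OF \<pi> j] perm[OF \<pi>] j
      by (simp add: w_def sign_compose permutation_swap_id sign_swap_id)
    then have "of_nat d * w \<pi> + (\<Sum>j\<in>{1..k}. w (\<pi> \<circ> ?t j))
        = of_int (sign \<pi>) * (of_nat d * sw \<pi> - (\<Sum>j\<in>{1..k}. sw (\<pi> \<circ> ?t j)))"
      using \<pi> by (simp add: w_def sum_negf right_diff_distrib sum_distrib_left mult.left_commute)
    also have "\<dots> = of_int (sign \<pi> * sign \<pi>) * v \<pi>" unfolding sw[OF \<pi>] sv_def of_int_mult mult.assoc ..
    finally show ?thesis by simp
  qed
  have "(\<Sum>\<tau>\<in>?G. w \<tau> * fix_count d (Suc k) (inv \<tau> \<circ> \<pi>)) = of_bool (\<pi> = id)" if \<pi>: "\<pi> \<in> ?G" for \<pi>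
  proof -
    define F where "F g = (if g permutes {1..k} then fix_count d k g else 0)" for g
    have "(\<Sum>\<tau>\<in>?G. w \<tau> * fix_count d (Suc k) (inv \<tau> \<circ> \<pi>))
      = (\<Sum>\<tau>\<in>?G. w \<tau> * (of_nat d * F (inv \<tau> \<circ> \<pi>)) + (\<Sum>j\<in>{1..k}. w \<tau> * F (?t j \<circ> (inv \<tau> \<circ> \<pi>))))"
    proof (intro sum.cong refl)
      fix \<tau> assume "\<tau> \<in> ?G"
      then have "(inv \<tau> \<circ> \<pi>) permutes {1..Suc k}" using \<pi> by (auto intro: permutes_compose permutes_inv)
      from fix_count_Suc[OF this, of d]
      show "w \<tau> * fix_count d (Suc k) (inv \<tau> \<circ> \<pi>)
        = w \<tau> * (of_nat d * F (inv \<tau> \<circ> \<pi>)) + (\<Sum>j\<in>{1..k}. w \<tau> * F (?t j \<circ> (inv \<tau> \<circ> \<pi>)))"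
        by (simp add: F_def distrib_left sum_distrib_left)
    qed
    also have "\<dots> = (\<Sum>\<tau>\<in>?G. w \<tau> * (of_nat d * F (inv \<tau> \<circ> \<pi>)))
        + (\<Sum>j\<in>{1..k}. \<Sum>\<tau>\<in>?G. w \<tau> * F (?t j \<circ> (inv \<tau> \<circ> \<pi>)))"
      by (subst sum.swap) (simp add: sum.distrib)
    also have "(\<Sum>j\<in>{1..k}. \<Sum>\<tau>\<in>?G. w \<tau> * F (?t j \<circ> (inv \<tau> \<circ> \<pi>)))
      = (\<Sum>j\<in>{1..k}. \<Sum>\<tau>\<in>?G. w (\<tau> \<circ> ?t j) * F (inv \<tau> \<circ> \<pi>))"
    proof (rule sum.cong[OF refl])
      fix j assume j: "j \<in> {1..k}"
      have twice: "\<tau> \<circ> ?t j \<circ> ?t j = \<tau>" for \<tau> by (simp add: fun_eq_iff)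
      have inv: "inv (\<tau> \<circ> ?t j) \<circ> \<pi> = ?t j \<circ> (inv \<tau> \<circ> \<pi>)" if "\<tau> \<in> ?G" for \<tau>
        using inv_comp_permutes[of \<tau> "{1..Suc k}" "?t j"] that t[OF j] by (simp add: comp_assoc)
      show "(\<Sum>\<tau>\<in>?G. w \<tau> * F (?t j \<circ> (inv \<tau> \<circ> \<pi>))) = (\<Sum>\<tau>\<in>?G. w (\<tau> \<circ> ?t j) * F (inv \<tau> \<circ> \<pi>))"
      proof (rule sum.reindex_bij_witness[of _ "\<lambda>\<tau>. \<tau> \<circ> ?t j" "\<lambda>\<tau>. \<tau> \<circ> ?t j"])
        fix \<tau> assume \<tau>: "\<tau> \<in> ?G"
        show "\<tau> \<circ> ?t j \<circ> ?t j = \<tau>" "\<tau> \<circ> ?t j \<circ> ?t j = \<tau>" by (rule twice)+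
        show "\<tau> \<circ> ?t j \<in> ?G" "\<tau> \<circ> ?t j \<in> ?G" by (rule nb[OF \<tau> j])+
        show "w (\<tau> \<circ> ?t j \<circ> ?t j) * F (inv (\<tau> \<circ> ?t j) \<circ> \<pi>) = w \<tau> * F (?t j \<circ> (inv \<tau> \<circ> \<pi>))"
          unfolding twice inv[OF \<tau>] ..
      qed
    qed
    also have "(\<Sum>\<tau>\<in>?G. w \<tau> * (of_nat d * F (inv \<tau> \<circ> \<pi>)))
        + (\<Sum>j\<in>{1..k}. \<Sum>\<tau>\<in>?G. w (\<tau> \<circ> ?t j) * F (inv \<tau> \<circ> \<pi>))
      = (\<Sum>\<tau>\<in>?G. (of_nat d * w \<tau> + (\<Sum>j\<in>{1..k}. w (\<tau> \<circ> ?t j))) * F (inv \<tau> \<circ> \<pi>))"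
      by (subst sum.swap) (simp only: distrib_left distrib_right sum.distrib sum_distrib_left sum_distrib_right mult_ac)
    also have "\<dots> = (\<Sum>\<tau>\<in>?G. v \<tau> * F (inv \<tau> \<circ> \<pi>))" using w by (intro sum.cong refl) simp
    also have "\<dots> = (\<Sum>\<tau>\<in>?G'. v \<tau> * F (inv \<tau> \<circ> \<pi>))"
      using v(1) sub fin by (intro sum.mono_neutral_right) auto
    also have "\<dots> = of_bool (\<pi> = id)"
    proof (cases "\<pi> permutes {1..k}")
      case True
      then show ?thesis unfolding v(3)[OF True, symmetric]
        by (intro sum.cong refl) (auto simp: F_def permutes_compose permutes_inv)
    next
      case False
      have "\<not> (inv \<tau> \<circ> \<pi>) permutes {1..k}" if "\<tau> \<in> ?G'" for \<tau>
      proof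
        assume "(inv \<tau> \<circ> \<pi>) permutes {1..k}"
        then have "(\<tau> \<circ> (inv \<tau> \<circ> \<pi>)) permutes {1..k}" using that by (auto intro: permutes_compose)
        moreover have "\<tau> \<circ> (inv \<tau> \<circ> \<pi>) = \<pi>"
          using that by (simp add: comp_assoc[symmetric] permutes_inv_o[of \<tau> "{1..k}"])
        ultimately show False using False by simp
      qed
      moreover have "\<pi> \<noteq> id" using False permutes_id by blast
      ultimately show ?thesis by (simp add: F_def)
    qed
    finally show ?thesis .
  qed
  moreover have "of_int (sign \<pi>) * w \<pi> > 0" if "\<pi> \<in> ?G" for \<pi>
    using pos[OF that] that by (cases \<pi> rule: sign_cases) (simp_all add: w_def)
  moreover have "w \<pi> = 0" if "\<not> \<pi> permutes {1..Suc k}" for \<pi> using that by (simp add: w_def)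
  ultimately show ?case by (intro exI[of _ w] conjI allI impI) (simp_all only: mem_Collect_eq)
qed

section \<open>The Weingarten function\<close>

lemma fix_count_inv: "g permutes {1..k} \<Longrightarrow> fix_count d k (inv g) = fix_count d k g"
  using permutes_imp_permutation[of "{1..k}" g]
  by (simp add: fix_count_eq_power permutes_inv orbit_inv_eq)

lemma fix_count_conj:
  assumes "\<tau> permutes {1..k}"
  shows "fix_count d k (inv \<tau> \<circ> g \<circ> \<tau>) = fix_count d k g"
proof -
  have "fix_count d k (inv \<tau> \<circ> g \<circ> \<tau>)
      = (\<Sum>u\<in>{1..k} \<rightarrow>\<^sub>E {..<d}. of_bool (\<forall>i\<in>{1..k}. (u \<circ> \<tau>) ((inv \<tau> \<circ> g \<circ> \<tau>) i) = (u \<circ> \<tau>) i))"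
    unfolding fix_count_def by (rule sum_PiE_permute[OF assms, symmetric])
  also have "\<dots> = fix_count d k g"
    unfolding fix_count_def
  proof (intro sum.cong refl arg_cong[where f = of_bool])
    fix u :: "nat \<Rightarrow> nat"
    have "(\<forall>i\<in>{1..k}. (u \<circ> \<tau>) ((inv \<tau> \<circ> g \<circ> \<tau>) i) = (u \<circ> \<tau>) i) \<longleftrightarrow> (\<forall>i\<in>{1..k}. u (g (\<tau> i)) = u (\<tau> i))"
      by (simp add: permutes_inverses[OF assms])
    also have "\<dots> \<longleftrightarrow> (\<forall>i\<in>\<tau> ` {1..k}. u (g i) = u i)" by simp
    also have "\<tau> ` {1..k} = {1..k}" by (rule permutes_image[OF assms])
    finally show "(\<forall>i\<in>{1..k}. (u \<circ> \<tau>) ((inv \<tau> \<circ> g \<circ> \<tau>) i) = (u \<circ> \<tau>) i) = (\<forall>i\<in>{1..k}. u (g i) = u i)" .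
  qed
  finally show ?thesis .
qed

lemma cycle_sum_eq:
  "cycle_sum d \<pi> = (if \<pi> permutes {1..d} then fix_count d d \<pi> else 0)"
proof (cases "\<pi> permutes {1..d}")
  case True
  have "cycle_sum d \<pi> = (\<Sum>\<sigma> | \<sigma> permutes {1..d}. if \<sigma> = inv \<pi> then of_nat d ^ card (cycles d \<sigma>) else 0)"
    unfolding cycle_sum_def
  proof (intro sum.cong refl)
    fix \<sigma> assume "\<sigma> \<in> {\<sigma>. \<sigma> permutes {1..d}}"
    then have "\<pi> = inv \<sigma> \<longleftrightarrow> \<sigma> = inv \<pi>" using True permutes_inv_inv by force
    then show "of_nat d ^ card (cycles d \<sigma>) * gdelta (inv \<sigma>) \<pi>
        = (if \<sigma> = inv \<pi> then of_nat d ^ card (cycles d \<sigma>) else 0)"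
      by (simp add: gdelta_def)
  qed
  also have "\<dots> = of_nat d ^ card (cycles d (inv \<pi>))"
    using permutes_inv[OF True] by (simp add: finite_permutations)
  also have "\<dots> = fix_count d d \<pi>"
    using fix_count_eq_power[OF permutes_inv[OF True], of d] fix_count_inv[OF True, of d]
    by (simp add: cycles_def)
  finally show ?thesis using True by simp
next
  case False
  have "\<pi> \<noteq> inv \<sigma>" if "\<sigma> permutes {1..d}" for \<sigma> using permutes_inv[OF that] False by blast
  then show ?thesis using False by (simp add: cycle_sum_def gdelta_def)
qed

lemma conv_eq:
  assumes "\<pi> permutes {1..d}"
  shows "conv d f g \<pi> = (\<Sum>\<sigma> | \<sigma> permutes {1..d}. f \<sigma> * g (inv \<sigma> \<circ> \<pi>))"
proof -
  have "conv d f g \<pi> = (\<Sum>x | x \<in> {(\<sigma>, \<tau>). \<sigma> permutes {1..d} \<and> \<tau> permutes {1..d} \<and> \<sigma> \<circ> \<tau> = \<pi>}.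
      case x of (\<sigma>, \<tau>) \<Rightarrow> f \<sigma> * g \<tau>)"
    by (simp add: conv_def)
  also have "\<dots> = (\<Sum>\<sigma> | \<sigma> permutes {1..d}. f \<sigma> * g (inv \<sigma> \<circ> \<pi>))"
  proof (rule sum.reindex_bij_witness[of _ "\<lambda>\<sigma>. (\<sigma>, inv \<sigma> \<circ> \<pi>)" fst])
    fix x assume x: "x \<in> {x. x \<in> {(\<sigma>, \<tau>). \<sigma> permutes {1..d} \<and> \<tau> permutes {1..d} \<and> \<sigma> \<circ> \<tau> = \<pi>}}"
    then obtain \<sigma> \<tau> where st: "x = (\<sigma>, \<tau>)" "\<sigma> permutes {1..d}" "\<tau> permutes {1..d}" "\<sigma> \<circ> \<tau> = \<pi>" by auto
    have "inv \<sigma> \<circ> \<pi> = \<tau>" unfolding st(4)[symmetric] by (simp add: comp_assoc[symmetric] permutes_inv_o[OF st(2)])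
    then show "(fst x, inv (fst x) \<circ> \<pi>) = x" "fst x \<in> {\<sigma>. \<sigma> permutes {1..d}}"
      "f (fst x) * g (inv (fst x) \<circ> \<pi>) = (case x of (\<sigma>, \<tau>) \<Rightarrow> f \<sigma> * g \<tau>)"
      using st by simp_all
  next
    fix \<sigma> assume "\<sigma> \<in> {\<sigma>. \<sigma> permutes {1..d}}"
    then have \<sigma>: "\<sigma> permutes {1..d}" by simp
    show "fst (\<sigma>, inv \<sigma> \<circ> \<pi>) = \<sigma>" by simp
    show "(\<sigma>, inv \<sigma> \<circ> \<pi>) \<in> {x. x \<in> {(\<sigma>, \<tau>). \<sigma> permutes {1..d} \<and> \<tau> permutes {1..d} \<and> \<sigma> \<circ> \<tau> = \<pi>}}"
      using \<sigma> assms by (simp add: permutes_compose permutes_inv comp_assoc[symmetric] permutes_inv_o[OF \<sigma>])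
  qed
  finally show ?thesis .
qed

lemma conv_outside: "\<not> \<pi> permutes {1..d} \<Longrightarrow> conv d f g \<pi> = 0"
  unfolding conv_def by (intro sum.neutral) (auto simp: permutes_compose)

lemma conv_assoc: "conv d (conv d f g) h = conv d f (conv d g h)"
proof
  fix \<pi>
  let ?G = "{\<sigma>. \<sigma> permutes {1..d}}"
  show "conv d (conv d f g) h \<pi> = conv d f (conv d g h) \<pi>"
  proof (cases "\<pi> permutes {1..d}")
    case True
    have "conv d (conv d f g) h \<pi> = (\<Sum>\<sigma>\<in>?G. \<Sum>\<tau>\<in>?G. f \<tau> * g (inv \<tau> \<circ> \<sigma>) * h (inv \<sigma> \<circ> \<pi>))"
      by (simp add: conv_eq[OF True] conv_eq sum_distrib_right)
    also have "\<dots> = (\<Sum>\<tau>\<in>?G. \<Sum>\<sigma>\<in>?G. f \<tau> * g (inv \<tau> \<circ> \<sigma>) * h (inv \<sigma> \<circ> \<pi>))" by (rule sum.swap)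
    also have "\<dots> = (\<Sum>\<tau>\<in>?G. \<Sum>\<rho>\<in>?G. f \<tau> * (g \<rho> * h (inv \<rho> \<circ> (inv \<tau> \<circ> \<pi>))))"
    proof (rule sum.cong[OF refl])
      fix \<tau> assume "\<tau> \<in> ?G"
      then have \<tau>: "\<tau> permutes {1..d}" by simp
      show "(\<Sum>\<sigma>\<in>?G. f \<tau> * g (inv \<tau> \<circ> \<sigma>) * h (inv \<sigma> \<circ> \<pi>)) = (\<Sum>\<rho>\<in>?G. f \<tau> * (g \<rho> * h (inv \<rho> \<circ> (inv \<tau> \<circ> \<pi>))))"
      proof (rule sum.reindex_bij_witness[of _ "\<lambda>\<rho>. \<tau> \<circ> \<rho>" "\<lambda>\<sigma>. inv \<tau> \<circ> \<sigma>"])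
        fix \<sigma> assume \<sigma>: "\<sigma> \<in> ?G"
        show "\<tau> \<circ> (inv \<tau> \<circ> \<sigma>) = \<sigma>" by (simp add: comp_assoc[symmetric] permutes_inv_o[OF \<tau>])
        show "inv \<tau> \<circ> \<sigma> \<in> ?G" using \<sigma> \<tau> by (simp add: permutes_compose permutes_inv)
        have "inv (inv \<tau> \<circ> \<sigma>) \<circ> (inv \<tau> \<circ> \<pi>) = inv \<sigma> \<circ> \<pi>"
          using inv_comp_permutes[OF permutes_inv[OF \<tau>], of \<sigma>] \<sigma>
          by (simp add: permutes_inv_inv[OF \<tau>] fun_eq_iff permutes_inverses[OF \<tau>])
        then show "f \<tau> * (g (inv \<tau> \<circ> \<sigma>) * h (inv (inv \<tau> \<circ> \<sigma>) \<circ> (inv \<tau> \<circ> \<pi>)))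
            = f \<tau> * g (inv \<tau> \<circ> \<sigma>) * h (inv \<sigma> \<circ> \<pi>)" by simp
      next
        fix \<rho> assume \<rho>: "\<rho> \<in> ?G"
        show "inv \<tau> \<circ> (\<tau> \<circ> \<rho>) = \<rho>" by (simp add: comp_assoc[symmetric] permutes_inv_o[OF \<tau>])
        show "\<tau> \<circ> \<rho> \<in> ?G" using \<rho> \<tau> by (simp add: permutes_compose)
      qed
    qed
    also have "\<dots> = conv d f (conv d g h) \<pi>"
      unfolding conv_eq[OF True] sum_distrib_left[symmetric]
      using True by (intro sum.cong refl) (simp add: conv_eq permutes_compose permutes_inv)
    finally show ?thesis .
  qed (simp add: conv_outside)
qed

lemma conv_gdelta_left:
  assumes "f \<in> group_alg d"
  shows "conv d (gdelta id) f = f"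
proof
  fix \<pi>
  show "conv d (gdelta id) f \<pi> = f \<pi>"
  proof (cases "\<pi> permutes {1..d}")
    case True
    have "conv d (gdelta id) f \<pi> = (\<Sum>\<sigma> | \<sigma> permutes {1..d}. if \<sigma> = id then f \<pi> else 0)"
      unfolding conv_eq[OF True] by (intro sum.cong refl) (auto simp: gdelta_def)
    then show ?thesis using permutes_id[of "{1..d}"] by (simp add: finite_permutations)
  next
    case False
    then show ?thesis using assms by (simp add: conv_outside group_alg_def)
  qed
qed

lemma conv_gdelta_right:
  assumes "f \<in> group_alg d"
  shows "conv d f (gdelta id) = f"
proof
  fix \<pi>
  show "conv d f (gdelta id) \<pi> = f \<pi>"
  proof (cases "\<pi> permutes {1..d}")
    case True
    have "conv d f (gdelta id) \<pi> = (\<Sum>\<sigma> | \<sigma> permutes {1..d}. if \<sigma> = \<pi> then f \<pi> else 0)"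
      unfolding conv_eq[OF True]
    proof (intro sum.cong refl)
      fix \<sigma> assume "\<sigma> \<in> {\<sigma>. \<sigma> permutes {1..d}}"
      then have \<sigma>: "\<sigma> permutes {1..d}" by simp
      have "\<sigma> \<circ> (inv \<sigma> \<circ> \<pi>) = \<pi>" by (simp add: comp_assoc[symmetric] permutes_inv_o[OF \<sigma>])
      then have "inv \<sigma> \<circ> \<pi> = id \<longleftrightarrow> \<sigma> = \<pi>" using permutes_inv_o(2)[OF \<sigma>] by (metis comp_id)
      then show "f \<sigma> * gdelta id (inv \<sigma> \<circ> \<pi>) = (if \<sigma> = \<pi> then f \<pi> else 0)"
        by (simp add: gdelta_def)
    qed
    then show ?thesis using True by (simp add: finite_permutations)
  next
    case False
    then show ?thesis using assms by (simp add: conv_outside group_alg_def)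
  qed
qed

text \<open>The inverse constructed above is a left inverse. Reading it at inverse permutations gives a right
inverse, because the cycle type of a permutation is that of its inverse; hence both agree and
satisfy the definition.\<close>
lemma Wg_inverse:
  "Wg d \<in> group_alg d" "conv d (cycle_sum d) (Wg d) = gdelta id" "conv d (Wg d) (cycle_sum d) = gdelta id"
  and Wg_sign: "\<pi> permutes {1..d} \<Longrightarrow> of_int (sign \<pi>) * Wg d \<pi> > 0"
proof -
  obtain w :: "(nat \<Rightarrow> nat) \<Rightarrow> rat" where w': "(\<forall>\<pi>. \<not> \<pi> permutes {1..d} \<longrightarrow> w \<pi> = 0) \<and>
    (\<forall>\<pi>. \<pi> permutes {1..d} \<longrightarrow> of_int (sign \<pi>) * w \<pi> > (0::rat)) \<and>
    (\<forall>\<pi>. \<pi> permutes {1..d} \<longrightarrow>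
      (\<Sum>\<tau> | \<tau> permutes {1..d}. w \<tau> * fix_count d d (inv \<tau> \<circ> \<pi>)) = of_bool (\<pi> = id))"
    using signed_inverse_exists[of d d] by blast
  note w = w'[THEN conjunct1, rule_format] w'[THEN conjunct2, THEN conjunct1, rule_format]
    w'[THEN conjunct2, THEN conjunct2, rule_format]
  let ?G = "{\<sigma>. \<sigma> permutes {1..d}}"
  have wG: "w \<in> group_alg d" using w(1) by (simp add: group_alg_def)
  have left: "conv d w (cycle_sum d) = gdelta id"
  proof
    fix \<pi>
    show "conv d w (cycle_sum d) \<pi> = gdelta id \<pi>"
    proof (cases "\<pi> permutes {1..d}")
      case True
      have "conv d w (cycle_sum d) \<pi> = (\<Sum>\<tau>\<in>?G. w \<tau> * fix_count d d (inv \<tau> \<circ> \<pi>))"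
        unfolding conv_eq[OF True]
        using True by (intro sum.cong refl) (simp add: cycle_sum_eq permutes_compose permutes_inv)
      then show ?thesis using w(3)[OF True] by (simp add: gdelta_def)
    next
      case False
      then have "\<pi> \<noteq> id" using permutes_id by blast
      then show ?thesis using False by (simp add: conv_outside gdelta_def)
    qed
  qed
  define w2 where "w2 \<pi> = (if \<pi> permutes {1..d} then w (inv \<pi>) else 0)" for \<pi>
  have w2G: "w2 \<in> group_alg d" by (simp add: group_alg_def w2_def)
  have right: "conv d (cycle_sum d) w2 = gdelta id"
  proof
    fix \<pi>
    show "conv d (cycle_sum d) w2 \<pi> = gdelta id \<pi>"
    proof (cases "\<pi> permutes {1..d}")
      case True
      note i\<pi> = permutes_inv[OF True]
      have "conv d (cycle_sum d) w2 \<pi> = (\<Sum>\<sigma>\<in>?G. cycle_sum d \<sigma> * w2 (inv \<sigma> \<circ> \<pi>))"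
        by (rule conv_eq[OF True])
      also have "\<dots> = (\<Sum>\<rho>\<in>?G. w \<rho> * fix_count d d (inv \<rho> \<circ> inv \<pi>))"
      proof (rule sum.reindex_bij_witness[of _ "\<lambda>\<rho>. \<pi> \<circ> \<rho>" "\<lambda>\<sigma>. inv \<pi> \<circ> \<sigma>"])
        fix \<sigma> assume "\<sigma> \<in> ?G"
        then have \<sigma>: "\<sigma> permutes {1..d}" by simp
        show "\<pi> \<circ> (inv \<pi> \<circ> \<sigma>) = \<sigma>" by (simp add: comp_assoc[symmetric] permutes_inv_o[OF True])
        show "inv \<pi> \<circ> \<sigma> \<in> ?G" using \<sigma> i\<pi> by (simp add: permutes_compose)
        have "inv (inv \<sigma> \<circ> \<pi>) = inv \<pi> \<circ> \<sigma>"
          using inv_comp_permutes[OF permutes_inv[OF \<sigma>] True] permutes_inv_inv[OF \<sigma>] by simp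
        moreover have "(inv \<sigma> \<circ> \<pi>) permutes {1..d}" using \<sigma> True by (simp add: permutes_compose permutes_inv)
        ultimately have "w2 (inv \<sigma> \<circ> \<pi>) = w (inv \<pi> \<circ> \<sigma>)" by (simp add: w2_def)
        moreover have "inv (inv \<pi> \<circ> \<sigma>) \<circ> inv \<pi> = inv \<sigma>"
          using inv_comp_permutes[OF i\<pi> \<sigma>] permutes_inv_inv[OF True]
          by (simp add: comp_assoc permutes_inv_o[OF True])
        ultimately show "w (inv \<pi> \<circ> \<sigma>) * fix_count d d (inv (inv \<pi> \<circ> \<sigma>) \<circ> inv \<pi>)
            = cycle_sum d \<sigma> * w2 (inv \<sigma> \<circ> \<pi>)"
          using \<sigma> fix_count_inv[OF \<sigma>] by (simp add: cycle_sum_eq)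
      next
        fix \<rho> assume "\<rho> \<in> ?G"
        then show "inv \<pi> \<circ> (\<pi> \<circ> \<rho>) = \<rho>" "\<pi> \<circ> \<rho> \<in> ?G"
          using True by (simp_all add: comp_assoc[symmetric] permutes_inv_o[OF True] permutes_compose)
      qed
      also have "\<dots> = of_bool (inv \<pi> = id)" by (rule w(3)[OF i\<pi>])
      also have "inv \<pi> = id \<longleftrightarrow> \<pi> = id" using permutes_inv_inv[OF True] by (metis inv_id)
      finally show ?thesis by (simp add: gdelta_def)
    next
      case False
      then have "\<pi> \<noteq> id" using permutes_id by blast
      then show ?thesis using False by (simp add: conv_outside gdelta_def)
    qed
  qed
  have "w = conv d w (conv d (cycle_sum d) w2)" by (simp add: right conv_gdelta_right[OF wG])
  also have "\<dots> = w2" by (simp add: conv_assoc[symmetric] left conv_gdelta_left[OF w2G])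
  finally have right': "conv d (cycle_sum d) w = gdelta id" using right by simp
  have Wg: "Wg d = w"
    unfolding Wg_def
  proof (rule the_equality)
    fix v assume v: "v \<in> group_alg d \<and> conv d (cycle_sum d) v = gdelta id \<and> conv d v (cycle_sum d) = gdelta id"
    have "v = conv d (conv d w (cycle_sum d)) v" using v by (simp add: left conv_gdelta_left)
    also have "\<dots> = w" using v by (simp add: conv_assoc conv_gdelta_right[OF wG])
    finally show "v = w" .
  qed (use wG left right' in simp)
  show "Wg d \<in> group_alg d" "conv d (cycle_sum d) (Wg d) = gdelta id" "conv d (Wg d) (cycle_sum d) = gdelta id"
    using Wg wG left right' by simp_all
  show "\<pi> permutes {1..d} \<Longrightarrow> of_int (sign \<pi>) * Wg d \<pi> > 0" using w(2) Wg by simp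
qed

lemma Wg_orthogonality:
  assumes "\<pi> permutes {1..d}"
  shows "(\<Sum>\<tau> | \<tau> permutes {1..d}. Wg d \<tau> * fix_count d d (inv \<tau> \<circ> \<pi>)) = of_bool (\<pi> = id)"
proof -
  have "(\<Sum>\<tau> | \<tau> permutes {1..d}. Wg d \<tau> * fix_count d d (inv \<tau> \<circ> \<pi>)) = conv d (Wg d) (cycle_sum d) \<pi>"
    unfolding conv_eq[OF assms]
    using assms by (intro sum.cong refl) (simp add: cycle_sum_eq permutes_compose permutes_inv)
  then show ?thesis by (simp add: Wg_inverse gdelta_def)
qed

lemma Wg_nonzero: "\<pi> permutes {1..d} \<Longrightarrow> Wg d \<pi> \<noteq> 0"
  using Wg_sign[of \<pi> d] by auto

text \<open>Conjugating the inverse of a central element gives an inverse again.\<close>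
lemma Wg_conj:
  assumes \<tau>: "\<tau> permutes {1..d}" and \<pi>: "\<pi> permutes {1..d}" "\<pi>' permutes {1..d}"
    and eq: "\<tau> \<circ> \<pi> = \<pi>' \<circ> \<tau>"
  shows "Wg d \<pi> = Wg d \<pi>'"
proof -
  let ?G = "{\<sigma>. \<sigma> permutes {1..d}}"
  define v where "v \<sigma> = (if \<sigma> permutes {1..d} then Wg d (\<tau> \<circ> \<sigma> \<circ> inv \<tau>) else 0)" for \<sigma>
  have v: "v \<in> group_alg d" by (simp add: group_alg_def v_def)
  have conj_perm: "(\<tau> \<circ> \<sigma> \<circ> inv \<tau>) permutes {1..d}" "(inv \<tau> \<circ> \<sigma> \<circ> \<tau>) permutes {1..d}"
    if "\<sigma> permutes {1..d}" for \<sigma>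
    using that \<tau> by (simp_all add: permutes_compose permutes_inv)
  have "conv d v (cycle_sum d) = gdelta id"
  proof
    fix g
    show "conv d v (cycle_sum d) g = gdelta id g"
    proof (cases "g permutes {1..d}")
      case True
      have "conv d v (cycle_sum d) g = (\<Sum>\<sigma>\<in>?G. Wg d (\<tau> \<circ> \<sigma> \<circ> inv \<tau>) * fix_count d d (inv \<sigma> \<circ> g))"
        unfolding conv_eq[OF True]
        using True by (intro sum.cong refl) (simp add: v_def cycle_sum_eq permutes_compose permutes_inv)
      also have "\<dots> = (\<Sum>\<sigma>\<in>?G. Wg d \<sigma> * fix_count d d (inv \<sigma> \<circ> (\<tau> \<circ> g \<circ> inv \<tau>)))"
      proof (rule sum.reindex_bij_witness[of _ "\<lambda>\<sigma>. inv \<tau> \<circ> \<sigma> \<circ> \<tau>" "\<lambda>\<sigma>. \<tau> \<circ> \<sigma> \<circ> inv \<tau>"])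
        fix \<sigma> assume "\<sigma> \<in> ?G"
        then have \<sigma>: "\<sigma> permutes {1..d}" by simp
        show "inv \<tau> \<circ> (\<tau> \<circ> \<sigma> \<circ> inv \<tau>) \<circ> \<tau> = \<sigma>" "\<tau> \<circ> (inv \<tau> \<circ> \<sigma> \<circ> \<tau>) \<circ> inv \<tau> = \<sigma>"
          by (simp_all add: fun_eq_iff permutes_inverses[OF \<tau>])
        show "\<tau> \<circ> \<sigma> \<circ> inv \<tau> \<in> ?G" "inv \<tau> \<circ> \<sigma> \<circ> \<tau> \<in> ?G" using conj_perm[OF \<sigma>] by simp_all
        have "inv (\<tau> \<circ> \<sigma> \<circ> inv \<tau>) = \<tau> \<circ> inv \<sigma> \<circ> inv \<tau>"
          using inv_comp_permutes[OF permutes_compose[OF \<sigma> \<tau>] permutes_inv[OF \<tau>]]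
            inv_comp_permutes[OF \<tau> \<sigma>] permutes_inv_inv[OF \<tau>] by (simp add: comp_assoc)
        then have "inv \<tau> \<circ> (inv (\<tau> \<circ> \<sigma> \<circ> inv \<tau>) \<circ> (\<tau> \<circ> g \<circ> inv \<tau>)) \<circ> \<tau> = inv \<sigma> \<circ> g"
          by (simp add: fun_eq_iff permutes_inverses[OF \<tau>])
        then show "Wg d (\<tau> \<circ> \<sigma> \<circ> inv \<tau>) * fix_count d d (inv (\<tau> \<circ> \<sigma> \<circ> inv \<tau>) \<circ> (\<tau> \<circ> g \<circ> inv \<tau>))
            = Wg d (\<tau> \<circ> \<sigma> \<circ> inv \<tau>) * fix_count d d (inv \<sigma> \<circ> g)"
          using fix_count_conj[OF \<tau>] by metis
      qed
      also have "\<dots> = of_bool (\<tau> \<circ> g \<circ> inv \<tau> = id)" by (rule Wg_orthogonality[OF conj_perm(1)[OF True]])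
      also have "\<tau> \<circ> g \<circ> inv \<tau> = id \<longleftrightarrow> g = id"
      proof
        assume "\<tau> \<circ> g \<circ> inv \<tau> = id"
        then have "inv \<tau> \<circ> (\<tau> \<circ> g \<circ> inv \<tau>) \<circ> \<tau> = inv \<tau> \<circ> \<tau>" by simp
        then show "g = id" by (simp add: fun_eq_iff permutes_inverses[OF \<tau>])
      qed (simp add: permutes_inv_o[OF \<tau>])
      finally show ?thesis by (simp add: gdelta_def)
    next
      case False
      then have "g \<noteq> id" using permutes_id by blast
      then show ?thesis using False by (simp add: conv_outside gdelta_def)
    qed
  qed
  then have "Wg d = conv d (conv d v (cycle_sum d)) (Wg d)"
    by (simp add: conv_gdelta_left Wg_inverse(1))
  also have "\<dots> = v" by (simp add: conv_assoc Wg_inverse(2) conv_gdelta_right[OF v])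
  finally have "Wg d \<pi> = v \<pi>" by simp
  also have "\<dots> = Wg d (\<tau> \<circ> \<pi> \<circ> inv \<tau>)" using \<pi> by (simp add: v_def)
  also have "\<tau> \<circ> \<pi> \<circ> inv \<tau> = \<pi>'" by (simp add: eq comp_assoc permutes_inv_o[OF \<tau>])
  finally show ?thesis .
qed

section \<open>The blocks of variables\<close>

definition block_start :: "nat \<Rightarrow> nat" where "block_start i = (i - 1)\<^sup>2 + 1"

lemma set_m_idx: "set (m_idx i) = {block_start i..i\<^sup>2}"
  by (auto simp: m_idx_def block_start_def)

lemma block_start_le: "i \<ge> 1 \<Longrightarrow> block_start i \<le> i\<^sup>2"
  by (cases i) (simp_all add: block_start_def power2_eq_square)

lemma block_start_in: "i \<in> {1..d} \<Longrightarrow> block_start i \<in> {1..d\<^sup>2}"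
proof -
  assume i: "i \<in> {1..d}"
  have "block_start i \<le> i\<^sup>2" using i by (intro block_start_le) simp
  also have "i\<^sup>2 \<le> d\<^sup>2" using i by (simp add: power_mono)
  finally show ?thesis by (simp add: block_start_def)
qed

lemma m_idx_Suc: "m_idx (Suc i) = [i\<^sup>2 + 1..<(Suc i)\<^sup>2 + 1]"
  by (simp add: m_idx_def)

lemma length_m_idx: "i \<ge> 1 \<Longrightarrow> length (m_idx i) = 2 * i - 1"
  by (cases i) (simp_all add: m_idx_Suc power2_eq_square)

lemma m_idx_nth: "k < length (m_idx i) \<Longrightarrow> m_idx i ! k = block_start i + k"
  by (simp add: m_idx_def block_start_def del: upt_Suc)

lemma m_idx_nonempty: "i \<ge> 1 \<Longrightarrow> m_idx i \<noteq> []"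
  using length_m_idx[of i] by auto

lemma hd_m_idx: "i \<ge> 1 \<Longrightarrow> hd (m_idx i) = block_start i"
  using m_idx_nonempty[of i] m_idx_nth[of 0 i] by (simp add: hd_conv_nth)

lemma last_m_idx: "i \<ge> 1 \<Longrightarrow> last (m_idx i) = i\<^sup>2"
  using m_idx_nonempty[of i] by (cases i) (auto simp: m_idx_Suc)

lemma concat_m_idx: "concat (map m_idx [1..<Suc d]) = [1..<d\<^sup>2 + 1]"
proof (induction d)
  case (Suc d)
  have "d\<^sup>2 + 1 \<le> (Suc d)\<^sup>2 + 1" by (simp add: power2_eq_square)
  then have "[1..<d\<^sup>2 + 1] @ [d\<^sup>2 + 1..<(Suc d)\<^sup>2 + 1] = [1..<(Suc d)\<^sup>2 + 1]"
    by (metis le_add2 le_Suc_ex upt_add_eq_append)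
  then show ?case using Suc by (simp add: m_idx_Suc del: upt_Suc) (simp add: m_idx_Suc)
qed simp

lemma block_cases:
  assumes "p \<in> {1..d\<^sup>2}"
  obtains i where "i \<in> {1..d}" "block_start i \<le> p" "p \<le> i\<^sup>2"
proof -
  have "p \<in> set (concat (map m_idx [1..<Suc d]))" unfolding concat_m_idx using assms by auto
  then obtain i where "i \<in> set [1..<Suc d]" "p \<in> set (m_idx i)"
    unfolding set_concat set_map by blast
  then have "i \<in> {1..d}" "p \<in> set (m_idx i)" by auto
  then show ?thesis using that by (auto simp: set_m_idx)
qed

lemma between_squares: "(i - 1)\<^sup>2 < p \<Longrightarrow> p < i\<^sup>2 \<Longrightarrow> p \<noteq> j\<^sup>2" for i j p :: nat
proof
  assume *: "(i - 1)\<^sup>2 < p" "p < i\<^sup>2" "p = j\<^sup>2"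
  then have "i - 1 < j" "j < i" by (simp_all add: power2_less_imp_less)
  then show False by simp
qed

lemma block_start_inj: "block_start i = block_start j \<Longrightarrow> i \<ge> 1 \<Longrightarrow> j \<ge> 1 \<Longrightarrow> i = j"
  by (auto simp: block_start_def)

text \<open>A permutation $\tau$ of the $d$ blocks becomes a permutation of the $d^2$ variables: it runs
through block $i$ and continues with the first variable of block $\tau\, i$. Thus the cycles of
$\tau$ turn into concatenations of the corresponding monomials.\<close>
definition blow_up :: "nat \<Rightarrow> (nat \<Rightarrow> nat) \<Rightarrow> nat \<Rightarrow> nat" where
  "blow_up d \<tau> p = (if p \<notin> {1..d\<^sup>2} then p
     else if \<exists>i. p = i\<^sup>2 then block_start (\<tau> (THE i. p = i\<^sup>2)) else Suc p)"

lemma blow_up_square: "i \<in> {1..d} \<Longrightarrow> blow_up d \<tau> (i\<^sup>2) = block_start (\<tau> i)"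
proof -
  assume i: "i \<in> {1..d}"
  have "(THE j. i\<^sup>2 = j\<^sup>2) = i" by (rule the_equality) auto
  moreover have "1 \<le> i\<^sup>2" "i\<^sup>2 \<le> d\<^sup>2" using i by (simp_all add: power_mono)
  ultimately show ?thesis by (auto simp: blow_up_def)
qed

lemma blow_up_inner:
  assumes "i \<in> {1..d}" "block_start i \<le> p" "p < i\<^sup>2"
  shows "blow_up d \<tau> p = Suc p"
proof -
  have "(i - 1)\<^sup>2 < p" using assms(2) by (simp add: block_start_def)
  then have "\<nexists>j. p = j\<^sup>2" using between_squares assms(3) by blast
  moreover have "p \<le> d\<^sup>2"
  proof (rule order_trans[OF less_imp_le[OF assms(3)]])
    show "i\<^sup>2 \<le> d\<^sup>2" using assms(1) by (simp add: power_mono)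
  qed
  ultimately show ?thesis using \<open>(i - 1)\<^sup>2 < p\<close> by (simp add: blow_up_def)
qed

lemma blow_up_permutes:
  assumes \<tau>: "\<tau> permutes {1..d}"
  shows "blow_up d \<tau> permutes {1..d\<^sup>2}"
proof (rule inj_imp_permutes)
  let ?b = "blow_up d \<tau>"
  have \<tau>_in: "\<tau> i \<in> {1..d}" if "i \<in> {1..d}" for i using permutes_in_image[OF \<tau>] that by simp
  have not_start: "?b p \<noteq> block_start j" if p: "p \<in> {1..d\<^sup>2}" "?b p = Suc p" and j: "j \<ge> 1"
    and inner: "\<nexists>i. p = i\<^sup>2" for p j
  proof
    assume "?b p = block_start j"
    then have "p = (j - 1)\<^sup>2" using p by (simp add: block_start_def)
    then show False using inner by blast
  qed
  have split: "(\<exists>i\<in>{1..d}. p = i\<^sup>2 \<and> ?b p = block_start (\<tau> i)) \<or> (?b p = Suc p \<and> (\<nexists>i. p = i\<^sup>2))"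
    if p: "p \<in> {1..d\<^sup>2}" for p
  proof -
    obtain i where i: "i \<in> {1..d}" "block_start i \<le> p" "p \<le> i\<^sup>2" using block_cases[OF p] .
    show ?thesis
    proof (cases "p = i\<^sup>2")
      case True
      then have "?b p = block_start (\<tau> i)" using blow_up_square[OF i(1), of \<tau>] by simp
      then show ?thesis using i(1) True by blast
    next
      case False
      then have "p < i\<^sup>2" "(i - 1)\<^sup>2 < p" using i by (simp_all add: block_start_def)
      then show ?thesis using blow_up_inner[OF i(1,2)] between_squares by blast
    qed
  qed
  show "inj_on ?b {1..d\<^sup>2}"
  proof (rule inj_onI)
    fix p q assume pq: "p \<in> {1..d\<^sup>2}" "q \<in> {1..d\<^sup>2}" "?b p = ?b q"
    show "p = q"
      using split[OF pq(1)]
    proof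
      assume "\<exists>i\<in>{1..d}. p = i\<^sup>2 \<and> ?b p = block_start (\<tau> i)"
      then obtain i where i: "i \<in> {1..d}" "p = i\<^sup>2" "?b p = block_start (\<tau> i)" by blast
      have "\<not> (?b q = Suc q \<and> (\<nexists>i. q = i\<^sup>2))"
        using not_start[OF pq(2), of "\<tau> i"] i(3) pq(3) \<tau>_in[OF i(1)] by auto
      then obtain j where j: "j \<in> {1..d}" "q = j\<^sup>2" "?b q = block_start (\<tau> j)"
        using split[OF pq(2)] by blast
      have "block_start (\<tau> i) = block_start (\<tau> j)" using i(3) j(3) pq(3) by simp
      moreover have "\<tau> i \<ge> 1" "\<tau> j \<ge> 1" using \<tau>_in[OF i(1)] \<tau>_in[OF j(1)] by simp_all
      ultimately have "\<tau> i = \<tau> j" by (rule block_start_inj)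
      then have "i = j" by (rule injD[OF permutes_inj[OF \<tau>]])
      then show "p = q" using i(2) j(2) by simp
    next
      assume p: "?b p = Suc p \<and> (\<nexists>i. p = i\<^sup>2)"
      have "\<not> (\<exists>i\<in>{1..d}. q = i\<^sup>2 \<and> ?b q = block_start (\<tau> i))"
      proof
        assume "\<exists>i\<in>{1..d}. q = i\<^sup>2 \<and> ?b q = block_start (\<tau> i)"
        then obtain i where i: "i \<in> {1..d}" "?b q = block_start (\<tau> i)" by blast
        have "\<tau> i \<ge> 1" using \<tau>_in[OF i(1)] by simp
        then have "?b p \<noteq> block_start (\<tau> i)" using not_start[OF pq(1)] p by blast
        then show False using i(2) pq(3) by simp
      qed
      then have "?b q = Suc q" using split[OF pq(2)] by blast
      then show "p = q" using p pq(3) by simp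
    qed
  qed
  fix p
  show "?b p \<in> {1..d\<^sup>2}" if p: "p \<in> {1..d\<^sup>2}"
    using split[OF p]
  proof
    assume "\<exists>i\<in>{1..d}. p = i\<^sup>2 \<and> ?b p = block_start (\<tau> i)"
    then obtain i where i: "i \<in> {1..d}" "?b p = block_start (\<tau> i)" by blast
    have "block_start (\<tau> i) \<in> {1..d\<^sup>2}" by (rule block_start_in[OF \<tau>_in[OF i(1)]])
    then show ?thesis using i(2) by simp
  next
    assume *: "?b p = Suc p \<and> (\<nexists>i. p = i\<^sup>2)"
    then have "p \<noteq> d\<^sup>2" by blast
    then have "p < d\<^sup>2" using p by simp
    then show ?thesis using * by simp
  qed
  show "?b p = p" if "p \<notin> {1..d\<^sup>2}" using that by (simp only: blow_up_def if_True not_False_eq_True)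
qed simp

lemma blow_up_funpow:
  assumes "i \<in> {1..d}" "block_start i + k \<le> i\<^sup>2"
  shows "(blow_up d \<tau> ^^ k) (block_start i) = block_start i + k"
  using assms(2)
proof (induction k)
  case (Suc k)
  then show ?case using blow_up_inner[OF assms(1), of "block_start i + k" \<tau>] by simp
qed simp

lemma orbit_blow_up_image:
  assumes \<tau>: "\<tau> permutes {1..d}"
  shows "orbit (blow_up d \<tau>) ` {1..d\<^sup>2} = (\<lambda>i. orbit (blow_up d \<tau>) (block_start i)) ` {1..d}"
proof -
  let ?b = "blow_up d \<tau>"
  have pb: "permutation ?b" by (rule permutes_imp_permutation[OF _ blow_up_permutes[OF \<tau>]]) simp
  show ?thesis
  proof (intro subset_antisym subsetI)
    fix c assume "c \<in> orbit ?b ` {1..d\<^sup>2}"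
    then obtain p where p: "p \<in> {1..d\<^sup>2}" "c = orbit ?b p" by blast
    obtain i where i: "i \<in> {1..d}" "block_start i \<le> p" "p \<le> i\<^sup>2" using block_cases[OF p(1)] .
    then have "(?b ^^ (p - block_start i)) (block_start i) = p"
      using blow_up_funpow[OF i(1), of "p - block_start i" \<tau>] by simp
    then have "p \<in> orbit ?b (block_start i)" using in_orbit_funpow_iff[OF pb] by metis
    then have "c = orbit ?b (block_start i)" using orbit_eq_if_in_orbit[OF pb] p(2) by simp
    then show "c \<in> (\<lambda>i. orbit ?b (block_start i)) ` {1..d}" using i(1) by blast
  next
    fix c assume "c \<in> (\<lambda>i. orbit ?b (block_start i)) ` {1..d}"
    then obtain i where i: "i \<in> {1..d}" "c = orbit ?b (block_start i)" by blast
    have "block_start i \<in> {1..d\<^sup>2}" by (rule block_start_in[OF i(1)])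
    then show "c \<in> orbit ?b ` {1..d\<^sup>2}" using i(2) by blast
  qed
qed

text \<open>If $\tau$ moves $i$, the blocks $i$ and $\tau\, i$ belong to the same cycle.\<close>
lemma card_orbits_blow_up_less:
  assumes \<tau>: "\<tau> permutes {1..d}" and "\<tau> \<noteq> id"
  shows "card (orbit (blow_up d \<tau>) ` {1..d\<^sup>2}) < d"
proof -
  let ?b = "blow_up d \<tau>" and ?c = "\<lambda>i. orbit (blow_up d \<tau>) (block_start i)"
  have pb: "permutation ?b" by (rule permutes_imp_permutation[OF _ blow_up_permutes[OF \<tau>]]) simp
  obtain i where "\<tau> i \<noteq> i" using \<open>\<tau> \<noteq> id\<close> by (auto simp: fun_eq_iff)
  then have i: "i \<in> {1..d}" "\<tau> i \<noteq> i" using permutes_not_in[OF \<tau>] by metis+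
  have \<tau>i: "\<tau> i \<in> {1..d}" using permutes_in_image[OF \<tau>] i(1) by simp
  have "i \<ge> 1" using i(1) by simp
  then have "(?b ^^ (i\<^sup>2 - block_start i)) (block_start i) = i\<^sup>2"
    using blow_up_funpow[OF i(1), of "i\<^sup>2 - block_start i" \<tau>] block_start_le[of i] by simp
  then have "(?b ^^ Suc (i\<^sup>2 - block_start i)) (block_start i) = block_start (\<tau> i)"
    using blow_up_square[OF i(1), of \<tau>] by simp
  then have "block_start (\<tau> i) \<in> orbit ?b (block_start i)" using in_orbit_funpow_iff[OF pb] by metis
  then have eq: "?c (\<tau> i) = ?c i" by (rule orbit_eq_if_in_orbit[OF pb])
  have "?c ` {1..d} \<subseteq> ?c ` ({1..d} - {i})"
  proof
    fix c assume "c \<in> ?c ` {1..d}"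
    then obtain j where j: "j \<in> {1..d}" "c = ?c j" by blast
    show "c \<in> ?c ` ({1..d} - {i})"
    proof (cases "j = i")
      case True
      then have "c = ?c (\<tau> i)" using j(2) eq by simp
      moreover have "\<tau> i \<in> {1..d} - {i}" using \<tau>i i(2) by simp
      ultimately show ?thesis by blast
    qed (use j in blast)
  qed
  then have "card (?c ` {1..d}) \<le> card (?c ` ({1..d} - {i}))" by (rule card_mono[rotated]) simp
  also have "\<dots> \<le> card ({1..d} - {i})" by (rule card_image_le) simp
  also have "\<dots> < d" using i(1) by simp
  finally show ?thesis using orbit_blow_up_image[OF \<tau>] by simp
qed

lemma orbit_blow_up_id:
  assumes i: "i \<in> {1..d}"
  shows "orbit (blow_up d id) (block_start i) = {block_start i..i\<^sup>2}"
proof -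
  let ?b = "blow_up d id"
  have "permutation ?b" by (rule permutes_imp_permutation[OF _ blow_up_permutes[OF permutes_id]]) simp
  have le: "block_start i \<le> i\<^sup>2" using i by (intro block_start_le) simp
  have stable: "?b p \<in> {block_start i..i\<^sup>2}" if p: "p \<in> {block_start i..i\<^sup>2}" for p
  proof (cases "p = i\<^sup>2")
    case True
    then have "?b p = block_start i" using blow_up_square[OF i, of id] by simp
    then show ?thesis using le by simp
  next
    case False
    then have "?b p = Suc p" using blow_up_inner[OF i, of p id] p by simp
    then show ?thesis using p False by simp
  qed
  show ?thesis
  proof (intro subset_antisym subsetI)
    fix p assume "p \<in> orbit ?b (block_start i)"
    then show "p \<in> {block_start i..i\<^sup>2}"
    proof induction
      case base
      then show ?case using stable[of "block_start i"] le by simp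
    next
      case (step p)
      then show ?case using stable by simp
    qed
  next
    fix p assume "p \<in> {block_start i..i\<^sup>2}"
    then have "(?b ^^ (p - block_start i)) (block_start i) = p"
      using blow_up_funpow[OF i, of "p - block_start i" id] by simp
    then show "p \<in> orbit ?b (block_start i)"
      using in_orbit_funpow_iff[OF \<open>permutation ?b\<close>] by metis
  qed
qed

lemma card_block: "i \<ge> 1 \<Longrightarrow> card {block_start i..i\<^sup>2} = 2 * i - 1"
  using set_m_idx[of i] length_m_idx[of i] distinct_card[of "m_idx i"] by (simp add: m_idx_def)

section \<open>The alternated product of monomials\<close>

text \<open>The function $\mathcal{T}_d$, for matrices given by their entries.\<close>
definition trace_form :: "nat \<Rightarrow> (nat \<Rightarrow> nat \<Rightarrow> nat \<Rightarrow> rat) \<Rightarrow> rat" where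
  "trace_form d X = (\<Sum>\<pi> | \<pi> permutes {1..d\<^sup>2}. of_int (sign \<pi>) *
     (\<Prod>i=1..d. \<Sum>z<d. word_entry d (X \<circ> \<pi>) (m_idx i) z z))"

text \<open>The entries of $Alt_X\, m_1(X) \otimes \dots \otimes m_d(X)$.\<close>
definition mono_tensor ::
  "nat \<Rightarrow> (nat \<Rightarrow> nat \<Rightarrow> nat \<Rightarrow> rat) \<Rightarrow> (nat \<Rightarrow> nat) \<Rightarrow> (nat \<Rightarrow> nat) \<Rightarrow> rat" where
  "mono_tensor d X r c = (\<Sum>\<pi> | \<pi> permutes {1..d\<^sup>2}. of_int (sign \<pi>) *
     (\<Prod>i=1..d. word_entry d (X \<circ> \<pi>) (m_idx i) (r i) (c i)))"

lemma mono_tensor_cong: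
  "(\<And>i. i \<in> {1..d} \<Longrightarrow> r i = r' i) \<Longrightarrow> (\<And>i. i \<in> {1..d} \<Longrightarrow> c i = c' i)
    \<Longrightarrow> mono_tensor d X r c = mono_tensor d X r' c'"
  unfolding mono_tensor_def by (intro sum.cong refl arg_cong2[where f = "(*)"] prod.cong) auto

lemma prod_list_upt: "(\<Prod>i\<leftarrow>[1..<Suc d]. f i) = (\<Prod>i=1..d. f i)" for f :: "nat \<Rightarrow> rat"
  by (induction d) (auto simp: mult.commute)

lemma alt_tensor_blocks:
  "alt_tensor d {1..d\<^sup>2} X (map m_idx [1..<Suc d]) {} r c
    = mono_tensor d X (r \<circ> block_start) (c \<circ> (\<lambda>i. i\<^sup>2))"
  unfolding word_tensor_def mono_tensor_def
proof (intro sum.cong refl)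
  fix \<pi>
  have "(\<Prod>w\<leftarrow>map m_idx [1..<Suc d]. word_entry d (X \<circ> \<pi>) w (r (hd w)) (c (last w)))
      = (\<Prod>i=1..d. word_entry d (X \<circ> \<pi>) (m_idx i) (r (hd (m_idx i))) (c (last (m_idx i))))"
    using prod_list_upt[of "\<lambda>i. word_entry d (X \<circ> \<pi>) (m_idx i) (r (hd (m_idx i))) (c (last (m_idx i)))" d]
    by (simp only: list.map_comp comp_def)
  also have "\<dots> = (\<Prod>i=1..d. word_entry d (X \<circ> \<pi>) (m_idx i) ((r \<circ> block_start) i) ((c \<circ> (\<lambda>i. i\<^sup>2)) i))"
    by (intro prod.cong refl) (simp add: hd_m_idx last_m_idx)
  finally show "of_int (sign \<pi>) * (\<Prod>a\<in>{}. (X \<circ> \<pi>) a (r a) (c a)) *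
      (\<Prod>w\<leftarrow>map m_idx [1..<Suc d]. word_entry d (X \<circ> \<pi>) w (r (hd w)) (c (last w)))
    = of_int (sign \<pi>) * (\<Prod>i=1..d. word_entry d (X \<circ> \<pi>) (m_idx i) ((r \<circ> block_start) i) ((c \<circ> (\<lambda>i. i\<^sup>2)) i))"
    by simp
qed

lemma blocks_props:
  "distinct (concat (map m_idx [1..<Suc d]))" "set (concat (map m_idx [1..<Suc d])) = {1..d\<^sup>2}"
  "[] \<notin> set (map m_idx [1..<Suc d])"
  "hd ` set (map m_idx [1..<Suc d]) = block_start ` {1..d}"
  "last ` set (map m_idx [1..<Suc d]) = (\<lambda>i. i\<^sup>2) ` {1..d}"
proof -
  show "distinct (concat (map m_idx [1..<Suc d]))" "set (concat (map m_idx [1..<Suc d])) = {1..d\<^sup>2}"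
    unfolding concat_m_idx by auto
  have set: "set (map m_idx [1..<Suc d]) = m_idx ` {1..d}" by auto
  show "[] \<notin> set (map m_idx [1..<Suc d])" unfolding set
  proof
    assume "[] \<in> m_idx ` {1..d}"
    then obtain i where "i \<in> {1..d}" "m_idx i = []" by auto
    then show False using m_idx_nonempty[of i] by simp
  qed
  show "hd ` set (map m_idx [1..<Suc d]) = block_start ` {1..d}"
    unfolding set image_image by (intro image_cong refl) (simp add: hd_m_idx)
  show "last ` set (map m_idx [1..<Suc d]) = (\<lambda>i. i\<^sup>2) ` {1..d}"
    unfolding set image_image by (intro image_cong refl) (simp add: last_m_idx)
qed

lemma grid_square: "grid {1..d\<^sup>2} d (\<lambda>p. (p - 1) div d) (\<lambda>p. (p - 1) mod d)"
proof
  show "bij_betw (\<lambda>p. ((p - 1) div d, (p - 1) mod d)) {1..d\<^sup>2} ({..<d} \<times> {..<d})"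
  proof (rule bij_betw_byWitness[where f' = "\<lambda>(i, j). i * d + j + 1"])
    show "(\<lambda>p. ((p - 1) div d, (p - 1) mod d)) ` {1..d\<^sup>2} \<subseteq> {..<d} \<times> {..<d}"
    proof (rule image_subsetI)
      fix p assume p: "p \<in> {1..d\<^sup>2}"
      then have "p - 1 < d * d" by (auto simp: power2_eq_square)
      moreover from this have "d > 0" by (cases d) auto
      ultimately show "((p - 1) div d, (p - 1) mod d) \<in> {..<d} \<times> {..<d}"
        by (simp add: less_mult_imp_div_less)
    qed
    show "(\<lambda>(i, j). i * d + j + 1) ` ({..<d} \<times> {..<d}) \<subseteq> {1..d\<^sup>2}"
    proof (rule image_subsetI)
      fix x assume "x \<in> {..<d} \<times> {..<d}"
      then obtain i j where x: "x = (i, j)" "i < d" "j < d" by auto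
      then have "i * d + j < Suc i * d" by simp
      also have "\<dots> \<le> d * d" using x by (intro mult_right_mono) auto
      finally show "(case x of (i, j) \<Rightarrow> i * d + j + 1) \<in> {1..d\<^sup>2}"
        using x by (simp add: power2_eq_square)
    qed
  qed (auto simp: mult.commute[of _ d])
qed simp

lemma perm_span_alt_tensor: "perm_span d {1..d\<^sup>2} {1..d\<^sup>2} (alt_tensor d {1..d\<^sup>2} X [] {1..d\<^sup>2})"
  by (rule grid.perm_span_if_alternating[OF grid_square alternating_alt_tensor]) simp

lemma perm_span_mono_tensor: "perm_span d {1..d} {1..d} (mono_tensor d X)"
proof -
  let ?ws = "map m_idx [1..<Suc d]"
  have "perm_span d ({} \<union> hd ` set ?ws) ({} \<union> last ` set ?ws) (alt_tensor d {1..d\<^sup>2} X ?ws {})"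
    by (rule perm_span_word_tensor[OF perm_span_alt_tensor]) (use blocks_props in auto)
  then have span: "perm_span d (block_start ` {1..d}) ((\<lambda>i. i\<^sup>2) ` {1..d}) (alt_tensor d {1..d\<^sup>2} X ?ws {})"
    unfolding blocks_props Un_empty_left .
  have inj: "inj_on block_start {1..d}" "inj_on (\<lambda>i::nat. i\<^sup>2) {1..d}"
    using block_start_inj by (auto simp: inj_on_def)
  let ?\<phi> = "inv_into {1..d} block_start" and ?\<psi> = "inv_into {1..d} (\<lambda>i. i\<^sup>2)"
  have "perm_span d {1..d} {1..d} (\<lambda>r c. alt_tensor d {1..d\<^sup>2} X ?ws {} (r \<circ> ?\<phi>) (c \<circ> ?\<psi>))"
    by (rule perm_span_rename[OF span]) (intro bij_betw_inv_into inj_on_imp_bij_betw inj)+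
  moreover have "alt_tensor d {1..d\<^sup>2} X ?ws {} (r \<circ> ?\<phi>) (c \<circ> ?\<psi>) = mono_tensor d X r c" for r c
    unfolding alt_tensor_blocks
    by (rule mono_tensor_cong) (simp_all only: comp_apply inv_into_f_f[OF inj(1)] inv_into_f_f[OF inj(2)])
  ultimately show ?thesis by simp
qed

lemma sum_PiE_reindex:
  assumes \<phi>: "bij_betw \<phi> P P'" and F: "\<And>u v. (\<And>p. p \<in> P \<Longrightarrow> u p = v p) \<Longrightarrow> F u = F v"
  shows "(\<Sum>u\<in>P' \<rightarrow>\<^sub>E I. F (u \<circ> \<phi>)) = (\<Sum>v\<in>P \<rightarrow>\<^sub>E I. F v)"
proof (rule sum.reindex_bij_witness[of _ "\<lambda>v. restrict (v \<circ> inv_into P \<phi>) P'" "\<lambda>u. restrict (u \<circ> \<phi>) P"])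
  fix u assume u: "u \<in> P' \<rightarrow>\<^sub>E I"
  show "restrict (u \<circ> \<phi>) P \<in> P \<rightarrow>\<^sub>E I" using u bij_betwE[OF \<phi>] by (auto simp: PiE_iff)
  show "restrict (restrict (u \<circ> \<phi>) P \<circ> inv_into P \<phi>) P' = u"
  proof
    fix x
    show "restrict (restrict (u \<circ> \<phi>) P \<circ> inv_into P \<phi>) P' x = u x"
      using u bij_betw_inv_into_right[OF \<phi>, of x] bij_betwE[OF bij_betw_inv_into[OF \<phi>]]
      by (cases "x \<in> P'") (auto simp: PiE_iff extensional_def)
  qed
  show "F (restrict (u \<circ> \<phi>) P) = F (u \<circ> \<phi>)" by (rule F) simp
next
  fix v assume v: "v \<in> P \<rightarrow>\<^sub>E I"
  show "restrict (v \<circ> inv_into P \<phi>) P' \<in> P' \<rightarrow>\<^sub>E I"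
    using v bij_betwE[OF bij_betw_inv_into[OF \<phi>]] by (auto simp: PiE_iff)
  show "restrict (restrict (v \<circ> inv_into P \<phi>) P' \<circ> \<phi>) P = v"
  proof
    fix x
    show "restrict (restrict (v \<circ> inv_into P \<phi>) P' \<circ> \<phi>) P x = v x"
      using v bij_betw_inv_into_left[OF \<phi>, of x] bij_betwE[OF \<phi>]
      by (cases "x \<in> P") (auto simp: PiE_iff extensional_def)
  qed
qed

text \<open>Slot $i$ is named by the first variable of block $i$ on the input side and by the last one on the
output side.\<close>
lemma trace_mono_tensor_eq_alt_trace:
  assumes \<tau>: "\<tau> permutes {1..d}"
  shows "(\<Sum>u\<in>{1..d} \<rightarrow>\<^sub>E {..<d}. mono_tensor d X u (u \<circ> \<tau>)) = alt_trace d {1..d\<^sup>2} X (blow_up d \<tau>)"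
proof -
  let ?ws = "map m_idx [1..<Suc d]" and ?b = "blow_up d \<tau>"
  have "(\<Sum>u\<in>({} \<union> hd ` set ?ws) \<rightarrow>\<^sub>E {..<d}. alt_tensor d {1..d\<^sup>2} X ?ws {} u (u \<circ> ?b))
      = (\<Sum>u\<in>{1..d\<^sup>2} \<rightarrow>\<^sub>E {..<d}. alt_tensor d {1..d\<^sup>2} X [] {1..d\<^sup>2} u (u \<circ> ?b))"
  proof (rule trace_word_tensor)
    show "?b ` ({} \<union> last ` set ?ws) \<subseteq> {} \<union> hd ` set ?ws"
      unfolding blocks_props Un_empty_left
      using permutes_in_image[OF \<tau>] by (auto simp: blow_up_square)
    fix w k assume "w \<in> set ?ws" "Suc k < length w"
    then obtain i where "i \<in> set [1..<Suc d]" "w = m_idx i" "Suc k < length (m_idx i)"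
      by (auto simp del: upt_Suc)
    then have i: "i \<in> {1..d}" "w = m_idx i" "Suc k < length (m_idx i)" by auto
    then have len: "Suc k < 2 * i - 1" using length_m_idx[of i] by simp
    have "block_start i + k < i\<^sup>2"
    proof -
      have "block_start i + (2 * i - 1) = i\<^sup>2 + 1"
        using i(1) by (cases i) (simp_all add: block_start_def power2_eq_square)
      then show ?thesis using len by simp
    qed
    then show "?b (w ! k) = w ! Suc k"
      using i by (simp add: m_idx_nth blow_up_inner)
  qed (use blocks_props in auto)
  then have "alt_trace d {1..d\<^sup>2} X ?b
      = (\<Sum>u\<in>block_start ` {1..d} \<rightarrow>\<^sub>E {..<d}. mono_tensor d X (u \<circ> block_start) (u \<circ> ?b \<circ> (\<lambda>i. i\<^sup>2)))"
    unfolding alt_trace_def alt_tensor_blocks blocks_props Un_empty_left by simp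
  also have "\<dots> = (\<Sum>u\<in>block_start ` {1..d} \<rightarrow>\<^sub>E {..<d}. mono_tensor d X (u \<circ> block_start) ((u \<circ> block_start) \<circ> \<tau>))"
    by (intro sum.cong refl mono_tensor_cong) (simp add: blow_up_square)
  also have "\<dots> = (\<Sum>v\<in>{1..d} \<rightarrow>\<^sub>E {..<d}. mono_tensor d X v (v \<circ> \<tau>))"
  proof (rule sum_PiE_reindex)
    show "bij_betw block_start {1..d} (block_start ` {1..d})"
      using block_start_inj by (intro inj_on_imp_bij_betw) (auto simp: inj_on_def)
    fix u v :: "nat \<Rightarrow> nat" assume "\<And>p. p \<in> {1..d} \<Longrightarrow> u p = v p"
    then show "mono_tensor d X u (u \<circ> \<tau>) = mono_tensor d X v (v \<circ> \<tau>)"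
      using permutes_in_image[OF \<tau>] by (intro mono_tensor_cong) auto
  qed
  finally show ?thesis ..
qed

text \<open>A nonzero trace needs $d$ cycles, but \<open>blow_up d \<tau>\<close> has fewer of them unless
$\tau$ is the identity.\<close>
lemma trace_mono_tensor:
  assumes \<tau>: "\<tau> permutes {1..d}"
  shows "(\<Sum>u\<in>{1..d} \<rightarrow>\<^sub>E {..<d}. mono_tensor d X u (u \<circ> \<tau>)) = of_bool (\<tau> = id) * trace_form d X"
proof (cases "\<tau> = id")
  case True
  have "(\<Sum>u\<in>{1..d} \<rightarrow>\<^sub>E {..<d}. mono_tensor d X u u)
      = (\<Sum>\<pi> | \<pi> permutes {1..d\<^sup>2}. \<Sum>u\<in>{1..d} \<rightarrow>\<^sub>E {..<d}. of_int (sign \<pi>) *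
          (\<Prod>i=1..d. word_entry d (X \<circ> \<pi>) (m_idx i) (u i) (u i)))"
    unfolding mono_tensor_def by (rule sum.swap)
  also have "\<dots> = trace_form d X"
    unfolding trace_form_def sum_distrib_left[symmetric]
    by (intro sum.cong refl arg_cong2[where f = "(*)"] prod_sum_PiE[symmetric]) simp_all
  finally show ?thesis using True by simp
next
  case False
  have "alt_trace d {1..d\<^sup>2} X (blow_up d \<tau>) = 0"
  proof (rule ccontr)
    assume "alt_trace d {1..d\<^sup>2} X (blow_up d \<tau>) \<noteq> 0"
    then have "card (orbit (blow_up d \<tau>) ` {1..d\<^sup>2}) = d"
      by (intro alternating_class_function.card_orbits[OF alternating_class_function_alt_trace]
          blow_up_permutes \<tau>) simp_all
    then show False using card_orbits_blow_up_less[OF \<tau> False] by simp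
  qed
  then show ?thesis using False trace_mono_tensor_eq_alt_trace[OF \<tau>] by simp
qed

lemma permutes_of_bij_betw:
  assumes "bij_betw \<sigma> S S"
  obtains \<tau> where "\<tau> permutes S" "\<And>x. x \<in> S \<Longrightarrow> \<tau> x = \<sigma> x"
proof
  show "(\<lambda>x. if x \<in> S then \<sigma> x else x) permutes S"
    by (rule bij_imp_permutes) (use assms in \<open>auto cong: bij_betw_cong\<close>)
qed simp

text \<open>Both sides lie in the span of the permutations. For the right-hand side, the trace of $\tau$
against $\sigma$ is the number of fixed index assignments of $\tau^{-1} \sigma$, so that the
orthogonality of the Weingarten function gives the same traces as for the left-hand side.\<close>
lemma mono_tensor_Wg:
  assumes "\<forall>i\<in>{1..d}. r i < d" "\<forall>i\<in>{1..d}. c i < d"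
  shows "mono_tensor d X r c
    = trace_form d X * (\<Sum>\<tau> | \<tau> permutes {1..d}. Wg d \<tau> * of_bool (\<forall>i\<in>{1..d}. c i = r (\<tau> i)))"
proof -
  let ?G = "{\<tau>. \<tau> permutes {1..d}}"
  define W :: "(nat \<Rightarrow> nat) \<Rightarrow> (nat \<Rightarrow> nat) \<Rightarrow> rat"
    where "W r c = (\<Sum>\<tau>\<in>?G. Wg d \<tau> * of_bool (\<forall>i\<in>{1..d}. c i = r (\<tau> i)))" for r c
  have W: "perm_span d {1..d} {1..d} W"
    unfolding W_def[abs_def]
    by (rule perm_span_sum[OF _ _ bij_betw_id])
      (auto intro!: perm_span.delta permutes_imp_bij simp: finite_permutations)
  have trace_W: "(\<Sum>u\<in>{1..d} \<rightarrow>\<^sub>E {..<d}. W u (u \<circ> \<sigma>)) = of_bool (\<sigma> = id)" if \<sigma>: "\<sigma> permutes {1..d}" for \<sigma>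
  proof -
    have "(\<Sum>u\<in>{1..d} \<rightarrow>\<^sub>E {..<d}. W u (u \<circ> \<sigma>))
        = (\<Sum>\<tau>\<in>?G. Wg d \<tau> * (\<Sum>u\<in>{1..d} \<rightarrow>\<^sub>E {..<d}. of_bool (\<forall>i\<in>{1..d}. u (\<sigma> i) = u (\<tau> i))))"
      unfolding W_def comp_apply sum_distrib_left by (rule sum.swap)
    also have "\<dots> = (\<Sum>\<tau>\<in>?G. Wg d \<tau> * fix_count d d (inv \<tau> \<circ> \<sigma>))"
    proof (intro sum.cong refl arg_cong2[where f = "(*)"])
      fix \<tau> assume "\<tau> \<in> ?G"
      then have \<tau>: "\<tau> permutes {1..d}" by simp
      have "fix_count d d (inv \<tau> \<circ> \<sigma>) = fix_count d d (inv \<tau> \<circ> (\<sigma> \<circ> inv \<tau>) \<circ> \<tau>)"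
        by (rule arg_cong[where f = "fix_count d d"]) (simp add: fun_eq_iff permutes_inverses[OF \<tau>])
      also have "\<dots> = fix_count d d (\<sigma> \<circ> inv \<tau>)" by (rule fix_count_conj[OF \<tau>])
      also have "\<dots> = (\<Sum>u\<in>{1..d} \<rightarrow>\<^sub>E {..<d}. of_bool (\<forall>i\<in>{1..d}. u (\<sigma> i) = u (\<tau> i)))"
        unfolding fix_count_def
      proof (intro sum.cong refl arg_cong[where f = of_bool])
        fix u :: "nat \<Rightarrow> nat"
        have "(\<forall>i\<in>{1..d}. u ((\<sigma> \<circ> inv \<tau>) i) = u i) \<longleftrightarrow> (\<forall>i\<in>\<tau> ` {1..d}. u (\<sigma> (inv \<tau> i)) = u i)"
          unfolding permutes_image[OF \<tau>] comp_apply ..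
        also have "\<dots> \<longleftrightarrow> (\<forall>i\<in>{1..d}. u (\<sigma> i) = u (\<tau> i))"
          by (simp add: permutes_inverses[OF \<tau>])
        finally show "(\<forall>i\<in>{1..d}. u ((\<sigma> \<circ> inv \<tau>) i) = u i) = (\<forall>i\<in>{1..d}. u (\<sigma> i) = u (\<tau> i))" .
      qed
      finally show "(\<Sum>u\<in>{1..d} \<rightarrow>\<^sub>E {..<d}. of_bool (\<forall>i\<in>{1..d}. u (\<sigma> i) = u (\<tau> i)))
          = fix_count d d (inv \<tau> \<circ> \<sigma>)" ..
    qed
    also have "\<dots> = of_bool (\<sigma> = id)" by (rule Wg_orthogonality[OF \<sigma>])
    finally show ?thesis .
  qed
  define g where "g r c = mono_tensor d X r c + (- trace_form d X) * W r c" for r c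
  have g: "perm_span d {1..d} {1..d} g"
    unfolding g_def[abs_def] by (intro perm_span.add perm_span_mono_tensor perm_span_scale W)
  have "g r c = 0"
  proof (rule perm_span_eq_zero_if_traces_zero[OF g _ _ _ assms])
    fix \<sigma> :: "nat \<Rightarrow> nat" assume "bij_betw \<sigma> {1..d} {1..d}"
    then obtain \<tau> where \<tau>: "\<tau> permutes {1..d}" "\<And>i. i \<in> {1..d} \<Longrightarrow> \<tau> i = \<sigma> i"
      using permutes_of_bij_betw by blast
    have "(\<Sum>u\<in>{1..d} \<rightarrow>\<^sub>E {..<d}. g u (u \<circ> \<sigma>)) = (\<Sum>u\<in>{1..d} \<rightarrow>\<^sub>E {..<d}. g u (u \<circ> \<tau>))"
    proof (intro sum.cong refl)
      fix u
      have "mono_tensor d X u (u \<circ> \<sigma>) = mono_tensor d X u (u \<circ> \<tau>)"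
        using \<tau>(2) by (intro mono_tensor_cong) auto
      moreover have "W u (u \<circ> \<sigma>) = W u (u \<circ> \<tau>)"
        unfolding W_def using \<tau>(2) by (intro sum.cong refl arg_cong2[where f = "(*)"] arg_cong[where f = of_bool]) auto
      ultimately show "g u (u \<circ> \<sigma>) = g u (u \<circ> \<tau>)" by (simp add: g_def)
    qed
    also have "\<dots> = 0"
      unfolding g_def sum.distrib sum_distrib_left[symmetric] trace_mono_tensor[OF \<tau>(1)] trace_W[OF \<tau>(1)]
      by simp
    finally show "(\<Sum>u\<in>{1..d} \<rightarrow>\<^sub>E {..<d}. g u (u \<circ> \<sigma>)) = 0" .
  qed simp_all
  then show ?thesis by (simp add: g_def W_def)
qed

text \<open>The matrix units in the order of the cells of the square.\<close>
definition matrix_units :: "nat \<Rightarrow> nat \<Rightarrow> nat \<Rightarrow> nat \<Rightarrow> rat" where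
  "matrix_units d p i j = of_bool (i = (p - 1) div d \<and> j = (p - 1) mod d)"

text \<open>At the matrix units the alternated tensor is not zero, hence one of its traces is not zero. The
permutation of this trace has cycle lengths $1, 3, \dots, 2d - 1$, so it is conjugate to the
permutation that runs through the blocks, whose trace is $\mathcal{T}_d$.\<close>
lemma trace_form_nonzero: "trace_form d (matrix_units d) \<noteq> 0"
proof -
  define E where "E = matrix_units d"
  let ?N = "{1..d\<^sup>2}"
  interpret grid ?N d "\<lambda>p. (p - 1) div d" "\<lambda>p. (p - 1) mod d" by (rule grid_square)
  let ?row = "\<lambda>p. (p - 1) div d" and ?col = "\<lambda>p. (p - 1) mod d"
  interpret F: alternating_class_function ?N d "alt_trace d ?N E"
    by (rule alternating_class_function_alt_trace) simp
  have one: "alt_tensor d ?N E [] ?N ?row ?col = 1"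
  proof -
    have "alt_tensor d ?N E [] ?N ?row ?col = (\<Sum>\<pi> | \<pi> permutes ?N. if \<pi> = id then 1 else 0)"
      unfolding alt_tensor_letters
    proof (intro sum.cong refl)
      fix \<pi> assume "\<pi> \<in> {\<pi>. \<pi> permutes ?N}"
      then have \<pi>: "\<pi> permutes ?N" by simp
      show "of_int (sign \<pi>) * (\<Prod>p\<in>?N. E (\<pi> p) (?row p) (?col p)) = (if \<pi> = id then 1 else 0)"
      proof (cases "\<pi> = id")
        case False
        then obtain p where "\<pi> p \<noteq> p" by (auto simp: fun_eq_iff)
        then have p: "p \<in> ?N" "\<pi> p \<in> ?N" using permutes_not_in[OF \<pi>] permutes_in_image[OF \<pi>] by metis+
        then have "\<not> (?row p = ?row (\<pi> p) \<and> ?col p = ?col (\<pi> p))"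
          using cell_eqI[of p "\<pi> p"] \<open>\<pi> p \<noteq> p\<close> by metis
        then have "E (\<pi> p) (?row p) (?col p) = 0" by (simp add: E_def matrix_units_def)
        then have "(\<Prod>p\<in>?N. E (\<pi> p) (?row p) (?col p)) = 0" using p(1) by (intro prod_zero) auto
        then show ?thesis using False by simp
      qed (simp add: E_def matrix_units_def)
    qed
    also have "\<dots> = 1" using permutes_id[of ?N] by (simp add: finite_permutations)
    finally show ?thesis .
  qed
  obtain \<sigma> where "bij_betw \<sigma> ?N ?N"
    "(\<Sum>u\<in>?N \<rightarrow>\<^sub>E {..<d}. alt_tensor d ?N E [] ?N u (u \<circ> \<sigma>)) \<noteq> 0"
    using perm_span_eq_zero_if_traces_zero[OF perm_span_alt_tensor, of d E ?row ?col] one row_col_less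
    by fastforce
  note \<sigma> = this
  obtain \<sigma>' where \<sigma>': "\<sigma>' permutes ?N" "\<And>p. p \<in> ?N \<Longrightarrow> \<sigma>' p = \<sigma> p"
    using permutes_of_bij_betw[OF \<sigma>(1)] by blast
  have "alt_trace d ?N E \<sigma>' = (\<Sum>u\<in>?N \<rightarrow>\<^sub>E {..<d}. alt_tensor d ?N E [] ?N u (u \<circ> \<sigma>))"
    unfolding alt_trace_def using \<sigma>'(2) by (intro sum.cong refl word_tensor_cong) auto
  then have nz: "alt_trace d ?N E \<sigma>' \<noteq> 0" using \<sigma>(2) by simp
  let ?b = "blow_up d id"
  have b: "?b permutes ?N" by (rule blow_up_permutes[OF permutes_id])
  have orbits_b: "orbit ?b ` ?N = (\<lambda>i. {block_start i..i\<^sup>2}) ` {1..d}"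
    unfolding orbit_blow_up_image[OF permutes_id] by (intro image_cong refl orbit_blow_up_id)
  have card_b: "bij_betw card (orbit ?b ` ?N) ((\<lambda>i. 2 * i - 1) ` {1..d})"
    unfolding orbits_b bij_betw_def image_image
  proof
    show "inj_on card ((\<lambda>i. {block_start i..i\<^sup>2}) ` {1..d})"
    proof (rule inj_onI)
      fix A B assume "A \<in> (\<lambda>i. {block_start i..i\<^sup>2}) ` {1..d}" "B \<in> (\<lambda>i. {block_start i..i\<^sup>2}) ` {1..d}"
        and eq: "card A = card B"
      then obtain i j where ij: "A = {block_start i..i\<^sup>2}" "i \<in> {1..d}" "B = {block_start j..j\<^sup>2}" "j \<in> {1..d}"
        by blast
      have "2 * i - 1 = 2 * j - 1" using eq card_block[of i] card_block[of j] ij by (simp only: atLeastAtMost_iff)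
      then have "i = j" using ij by auto
      then show "A = B" using ij by simp
    qed
    show "(\<lambda>i. card {block_start i..i\<^sup>2}) ` {1..d} = (\<lambda>i. 2 * i - 1) ` {1..d}"
      by (intro image_cong refl) (simp add: card_block del: card_atLeastAtMost)
  qed
  have card_\<sigma>: "bij_betw card (orbit \<sigma>' ` ?N) ((\<lambda>i. 2 * i - 1) ` {1..d})"
    by (rule F.orbit_cards[OF \<sigma>'(1) nz]) simp
  let ?F = "inv_into (orbit ?b ` ?N) card \<circ> card"
  have "bij_betw ?F (orbit \<sigma>' ` ?N) (orbit ?b ` ?N)"
    by (rule bij_betw_trans[OF card_\<sigma> bij_betw_inv_into[OF card_b]])
  moreover have "card (?F c) = card c" if c: "c \<in> orbit \<sigma>' ` ?N" for c
  proof -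
    have "card c \<in> (\<lambda>i. 2 * i - 1) ` {1..d}" using bij_betwE[OF card_\<sigma>] c by blast
    then show ?thesis using bij_betw_inv_into_right[OF card_b] by (simp only: comp_apply)
  qed
  ultimately obtain \<tau> where \<tau>: "\<tau> permutes ?N" "\<tau> \<circ> \<sigma>' = ?b \<circ> \<tau>"
    using conjugate_if_orbit_cards_eq[OF _ \<sigma>'(1) b, of ?F] by auto
  have "alt_trace d ?N E ?b = of_int (sign \<tau>) * alt_trace d ?N E \<sigma>'"
    by (rule F.conjugate[OF \<sigma>'(1) b \<tau>])
  then have "alt_trace d ?N E ?b \<noteq> 0" using nz by simp
  then show ?thesis
    using trace_mono_tensor_eq_alt_trace[OF permutes_id, of d E] trace_mono_tensor[OF permutes_id, of d E]
    by (simp add: E_def)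
qed

section \<open>Contracting two alternated products of monomials\<close>

text \<open>From here on the letters \<open>VX i\<close> and \<open>VY i\<close> name the monomials $m_i(X)$ and $m_i(Y)$.\<close>
definition block_vars :: "nat \<Rightarrow> var set" where
  "block_vars d = VX ` {1..d} \<union> VY ` {1..d}"

lemma block_vars_iff: "VX i \<in> block_vars d \<longleftrightarrow> i \<in> {1..d}" "VY i \<in> block_vars d \<longleftrightarrow> i \<in> {1..d}"
  by (auto simp: block_vars_def)

fun block_matrix ::
  "nat \<Rightarrow> (nat \<Rightarrow> nat \<Rightarrow> nat \<Rightarrow> rat) \<Rightarrow> (nat \<Rightarrow> nat \<Rightarrow> nat \<Rightarrow> rat) \<Rightarrow> (nat \<Rightarrow> nat) \<times> (nat \<Rightarrow> nat)
    \<Rightarrow> var \<Rightarrow> nat \<Rightarrow> nat \<Rightarrow> rat" where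
  "block_matrix d X Y \<pi> (VX i) = word_entry d (X \<circ> fst \<pi>) (m_idx i)"
| "block_matrix d X Y \<pi> (VY i) = word_entry d (Y \<circ> snd \<pi>) (m_idx i)"

abbreviation perm_pairs :: "nat \<Rightarrow> ((nat \<Rightarrow> nat) \<times> (nat \<Rightarrow> nat)) set" where
  "perm_pairs d \<equiv> {\<pi>. \<pi> permutes {1..d\<^sup>2}} \<times> {\<pi>. \<pi> permutes {1..d\<^sup>2}}"

abbreviation sign_pair :: "(nat \<Rightarrow> nat) \<times> (nat \<Rightarrow> nat) \<Rightarrow> rat" where
  "sign_pair \<pi> \<equiv> of_int (sign (fst \<pi>)) * of_int (sign (snd \<pi>))"

abbreviation block_tensors where
  "block_tensors d X Y \<equiv> word_tensor d (perm_pairs d) sign_pair (block_matrix d X Y)"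

lemma block_tensors_letters:
  "block_tensors d X Y [] (block_vars d) r c
    = mono_tensor d X (r \<circ> VX) (c \<circ> VX) * mono_tensor d Y (r \<circ> VY) (c \<circ> VY)"
proof -
  have prod: "(\<Prod>z\<in>block_vars d. f z) = (\<Prod>i=1..d. f (VX i)) * (\<Prod>i=1..d. f (VY i))" for f :: "var \<Rightarrow> rat"
    unfolding block_vars_def
    by (subst prod.union_disjoint) (auto simp: prod.reindex inj_on_def)
  have "block_tensors d X Y [] (block_vars d) r c
      = (\<Sum>\<pi>1 | \<pi>1 permutes {1..d\<^sup>2}. \<Sum>\<pi>2 | \<pi>2 permutes {1..d\<^sup>2}.
          (of_int (sign \<pi>1) * (\<Prod>i=1..d. word_entry d (X \<circ> \<pi>1) (m_idx i) ((r \<circ> VX) i) ((c \<circ> VX) i))) *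
          (of_int (sign \<pi>2) * (\<Prod>i=1..d. word_entry d (Y \<circ> \<pi>2) (m_idx i) ((r \<circ> VY) i) ((c \<circ> VY) i))))"
    unfolding word_tensor_def prod sum.cartesian_product
    by (intro sum.cong refl) (auto simp: mult_ac)
  then show ?thesis unfolding mono_tensor_def sum_product .
qed

lemma perm_span_block_tensors:
  "perm_span d (block_vars d) (block_vars d) (block_tensors d X Y [] (block_vars d))"
proof -
  have bij: "bij_betw VX {1..d} (VX ` {1..d})" "bij_betw VY {1..d} (VY ` {1..d})"
    by (auto intro!: inj_on_imp_bij_betw simp: inj_on_def)
  have "perm_span d (VX ` {1..d} \<union> VY ` {1..d}) (VX ` {1..d} \<union> VY ` {1..d})
      (\<lambda>r c. mono_tensor d X (r \<circ> VX) (c \<circ> VX) * mono_tensor d Y (r \<circ> VY) (c \<circ> VY))"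
    by (rule perm_span_mult[OF perm_span_rename[OF perm_span_mono_tensor bij(1) bij(1)]
        perm_span_rename[OF perm_span_mono_tensor bij(2) bij(2)]]) auto
  then show ?thesis
    unfolding block_tensors_letters[abs_def] by (simp only: block_vars_def)
qed

lemma sum_PiE_block_vars:
  "(\<Sum>u\<in>block_vars d \<rightarrow>\<^sub>E I. F (u \<circ> VX) (u \<circ> VY))
    = (\<Sum>x\<in>{1..d} \<rightarrow>\<^sub>E I. \<Sum>y\<in>{1..d} \<rightarrow>\<^sub>E I. F x y)"
proof -
  have "(\<Sum>u\<in>block_vars d \<rightarrow>\<^sub>E I. F (u \<circ> VX) (u \<circ> VY))
      = (\<Sum>(x, y)\<in>({1..d} \<rightarrow>\<^sub>E I) \<times> ({1..d} \<rightarrow>\<^sub>E I). F x y)"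
  proof (rule sum.reindex_bij_witness[of _ "\<lambda>(x, y). case_var x y" "\<lambda>u. (u \<circ> VX, u \<circ> VY)"])
    fix u assume u: "u \<in> block_vars d \<rightarrow>\<^sub>E I"
    show "(case (u \<circ> VX, u \<circ> VY) of (x, y) \<Rightarrow> case_var x y) = u"
      by (auto simp: fun_eq_iff split: var.split)
    show "(u \<circ> VX, u \<circ> VY) \<in> ({1..d} \<rightarrow>\<^sub>E I) \<times> ({1..d} \<rightarrow>\<^sub>E I)"
      using u by (auto simp: PiE_iff extensional_def block_vars_iff simp del: atLeastAtMost_iff)
    show "(case (u \<circ> VX, u \<circ> VY) of (x, y) \<Rightarrow> F x y) = F (u \<circ> VX) (u \<circ> VY)" by simp
  next
    fix xy assume xy: "xy \<in> ({1..d} \<rightarrow>\<^sub>E I) \<times> ({1..d} \<rightarrow>\<^sub>E I)"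
    obtain x y where [simp]: "xy = (x, y)" by fastforce
    show "(case xy of (x, y) \<Rightarrow> case_var x y) \<in> block_vars d \<rightarrow>\<^sub>E I"
      using xy by (auto simp: PiE_iff extensional_def block_vars_iff split: var.split
        simp del: atLeastAtMost_iff)
    show "((case xy of (x, y) \<Rightarrow> case_var x y) \<circ> VX, (case xy of (x, y) \<Rightarrow> case_var x y) \<circ> VY) = xy"
      by (simp add: comp_def)
  qed
  then show ?thesis by (simp add: sum.cartesian_product)
qed

text \<open>The slots of the tensor in $X$ are connected with those of the tensor in $Y$, along $a$ and along
$b$. Expanding the first tensor by the Weingarten formula leaves traces of the second one, of which
only that with $\sigma = b\, a$ survives.\<close>
lemma alternating_contraction:
  assumes a: "a permutes {1..d}" and b: "b permutes {1..d}"
  shows "(\<Sum>x\<in>{1..d} \<rightarrow>\<^sub>E {..<d}. \<Sum>y\<in>{1..d} \<rightarrow>\<^sub>E {..<d}.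
      mono_tensor d X x (y \<circ> a) * mono_tensor d Y y (x \<circ> b))
    = trace_form d X * trace_form d Y * Wg d (b \<circ> a)"
proof -
  let ?F = "{1..d} \<rightarrow>\<^sub>E {..<d}" and ?G = "{\<sigma>. \<sigma> permutes {1..d}}"
  have fin: "finite ?F" by (simp add: finite_PiE)
  have inner: "(\<Sum>y\<in>?F. mono_tensor d X x (y \<circ> a) * mono_tensor d Y y (x \<circ> b))
      = trace_form d X * (\<Sum>\<sigma>\<in>?G. Wg d \<sigma> * mono_tensor d Y (x \<circ> (\<sigma> \<circ> inv a)) (x \<circ> b))"
    if x: "x \<in> ?F" for x
  proof -
    have "(\<Sum>y\<in>?F. mono_tensor d X x (y \<circ> a) * mono_tensor d Y y (x \<circ> b))
        = (\<Sum>y\<in>?F. \<Sum>\<sigma>\<in>?G. trace_form d X * (Wg d \<sigma> *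
            (of_bool (\<forall>i\<in>{1..d}. (y \<circ> a) i = x (\<sigma> i)) * mono_tensor d Y y (x \<circ> b))))"
    proof (rule sum.cong[OF refl])
      fix y assume y: "y \<in> ?F"
      have "y \<circ> a \<in> ?F" by (rule PiE_comp_permutes[OF a y])
      then have "mono_tensor d X x (y \<circ> a)
          = trace_form d X * (\<Sum>\<sigma>\<in>?G. Wg d \<sigma> * of_bool (\<forall>i\<in>{1..d}. (y \<circ> a) i = x (\<sigma> i)))"
        using x by (intro mono_tensor_Wg) (auto simp: PiE_iff)
      then show "mono_tensor d X x (y \<circ> a) * mono_tensor d Y y (x \<circ> b)
        = (\<Sum>\<sigma>\<in>?G. trace_form d X * (Wg d \<sigma> *
            (of_bool (\<forall>i\<in>{1..d}. (y \<circ> a) i = x (\<sigma> i)) * mono_tensor d Y y (x \<circ> b))))"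
        by (simp only: sum_distrib_left sum_distrib_right mult.assoc)
    qed
    also have "\<dots> = trace_form d X * (\<Sum>\<sigma>\<in>?G. Wg d \<sigma> * (\<Sum>y\<in>?F.
            of_bool (\<forall>i\<in>{1..d}. (y \<circ> a) i = x (\<sigma> i)) * mono_tensor d Y y (x \<circ> b)))"
      by (subst sum.swap) (simp only: sum_distrib_left)
    also have "\<dots> = trace_form d X * (\<Sum>\<sigma>\<in>?G. Wg d \<sigma> * mono_tensor d Y (x \<circ> (\<sigma> \<circ> inv a)) (x \<circ> b))"
    proof (intro arg_cong2[where f = "(*)"] sum.cong refl)
      fix \<sigma> assume "\<sigma> \<in> ?G"
      then have \<sigma>: "(\<sigma> \<circ> inv a) permutes {1..d}" using a by (simp add: permutes_compose permutes_inv)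
      let ?y = "x \<circ> (\<sigma> \<circ> inv a)"
      have y: "?y \<in> ?F" by (rule PiE_comp_permutes[OF \<sigma> x])
      have iff: "(\<forall>i\<in>{1..d}. (y \<circ> a) i = x (\<sigma> i)) \<longleftrightarrow> y = ?y" if "y \<in> ?F" for y
      proof
        assume *: "\<forall>i\<in>{1..d}. (y \<circ> a) i = x (\<sigma> i)"
        show "y = ?y"
        proof (rule PiE_ext[OF that y])
          fix i assume "i \<in> {1..d}"
          then have "inv a i \<in> {1..d}" using permutes_in_image[OF permutes_inv[OF a]] by simp
          then have "(y \<circ> a) (inv a i) = x (\<sigma> (inv a i))" using * by blast
          then show "y i = ?y i" by (simp add: permutes_inverses[OF a])
        qed
      next
        assume "y = ?y"
        then show "\<forall>i\<in>{1..d}. (y \<circ> a) i = x (\<sigma> i)" by (simp add: permutes_inverses[OF a])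
      qed
      have "(\<Sum>y\<in>?F. of_bool (\<forall>i\<in>{1..d}. (y \<circ> a) i = x (\<sigma> i)) * mono_tensor d Y y (x \<circ> b))
          = (\<Sum>y\<in>?F. if y = ?y then mono_tensor d Y ?y (x \<circ> b) else 0)"
        by (intro sum.cong refl) (simp only: iff, simp)
      also have "\<dots> = mono_tensor d Y ?y (x \<circ> b)" using y fin by simp
      finally show "(\<Sum>y\<in>?F. of_bool (\<forall>i\<in>{1..d}. (y \<circ> a) i = x (\<sigma> i)) * mono_tensor d Y y (x \<circ> b))
          = mono_tensor d Y ?y (x \<circ> b)" .
    qed
    finally show ?thesis .
  qed
  have outer: "(\<Sum>x\<in>?F. mono_tensor d Y (x \<circ> (\<sigma> \<circ> inv a)) (x \<circ> b)) = of_bool (\<sigma> = b \<circ> a) * trace_form d Y"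
    if "\<sigma> \<in> ?G" for \<sigma>
  proof -
    have \<sigma>: "\<sigma> permutes {1..d}" using that by simp
    let ?\<tau> = "\<sigma> \<circ> inv a"
    have \<tau>: "?\<tau> permutes {1..d}" using a \<sigma> by (simp add: permutes_compose permutes_inv)
    have rest: "(inv ?\<tau> \<circ> b) permutes {1..d}" using b \<tau> by (simp add: permutes_compose permutes_inv)
    have "x \<circ> ?\<tau> \<circ> (inv ?\<tau> \<circ> b) = x \<circ> b" for x :: "nat \<Rightarrow> nat"
    proof -
      have "x \<circ> ?\<tau> \<circ> (inv ?\<tau> \<circ> b) = x \<circ> (?\<tau> \<circ> inv ?\<tau>) \<circ> b" by (simp only: comp_assoc)
      then show ?thesis by (simp only: permutes_inv_o[OF \<tau>] comp_id)
    qed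
    then have "(\<Sum>x\<in>?F. mono_tensor d Y (x \<circ> ?\<tau>) (x \<circ> b))
        = (\<Sum>x\<in>?F. mono_tensor d Y (x \<circ> ?\<tau>) (x \<circ> ?\<tau> \<circ> (inv ?\<tau> \<circ> b)))"
      by (simp only:)
    also have "\<dots> = (\<Sum>x\<in>?F. mono_tensor d Y x (x \<circ> (inv ?\<tau> \<circ> b)))"
      by (rule sum_PiE_permute[OF \<tau>])
    also have "\<dots> = of_bool (inv ?\<tau> \<circ> b = id) * trace_form d Y"
      by (rule trace_mono_tensor[OF rest])
    also have "inv ?\<tau> \<circ> b = id \<longleftrightarrow> \<sigma> = b \<circ> a"
    proof
      assume "inv ?\<tau> \<circ> b = id"
      then have "?\<tau> \<circ> (inv ?\<tau> \<circ> b) \<circ> a = ?\<tau> \<circ> id \<circ> a" by simp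
      moreover have "?\<tau> \<circ> (inv ?\<tau> \<circ> b) \<circ> a = b \<circ> a"
        by (simp only: comp_assoc[symmetric] permutes_inv_o[OF \<tau>] id_comp)
      moreover have "?\<tau> \<circ> id \<circ> a = \<sigma>" by (simp add: comp_assoc permutes_inv_o[OF a])
      ultimately show "\<sigma> = b \<circ> a" by simp
    next
      assume "\<sigma> = b \<circ> a"
      then have "?\<tau> = b" by (simp add: comp_assoc permutes_inv_o[OF a])
      then show "inv ?\<tau> \<circ> b = id" using permutes_inv_o[OF b] by simp
    qed
    finally show ?thesis .
  qed
  have "(\<Sum>x\<in>?F. \<Sum>y\<in>?F. mono_tensor d X x (y \<circ> a) * mono_tensor d Y y (x \<circ> b))
      = (\<Sum>x\<in>?F. \<Sum>\<sigma>\<in>?G. trace_form d X * (Wg d \<sigma> * mono_tensor d Y (x \<circ> (\<sigma> \<circ> inv a)) (x \<circ> b)))"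
  proof (rule sum.cong[OF refl])
    fix x assume x: "x \<in> ?F"
    show "(\<Sum>y\<in>?F. mono_tensor d X x (y \<circ> a) * mono_tensor d Y y (x \<circ> b))
      = (\<Sum>\<sigma>\<in>?G. trace_form d X * (Wg d \<sigma> * mono_tensor d Y (x \<circ> (\<sigma> \<circ> inv a)) (x \<circ> b)))"
      unfolding inner[OF x] sum_distrib_left ..
  qed
  also have "\<dots> = (\<Sum>\<sigma>\<in>?G. trace_form d X * (Wg d \<sigma> * (\<Sum>x\<in>?F. mono_tensor d Y (x \<circ> (\<sigma> \<circ> inv a)) (x \<circ> b))))"
    by (subst sum.swap) (simp only: sum_distrib_left)
  also have "\<dots> = (\<Sum>\<sigma>\<in>?G. if \<sigma> = b \<circ> a then trace_form d X * (Wg d (b \<circ> a) * trace_form d Y) else 0)"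
    by (intro sum.cong refl) (simp only: outer, simp)
  also have "\<dots> = trace_form d X * (Wg d (b \<circ> a) * trace_form d Y)"
    using permutes_compose[OF a b] by (simp add: finite_permutations)
  finally show ?thesis by (simp add: mult_ac)
qed

text \<open>All traces of the contraction are traces of \<open>mono_tensor\<close> against permutations that
send $d$ to $1$. None of these is the identity, so all of them vanish.\<close>
lemma mono_tensor_cyclic_contraction:
  assumes d: "d \<ge> 2" and r: "\<forall>i\<in>{2..d}. r i < d" and c: "\<forall>i\<in>{1..<d}. c i < d"
  shows "(\<Sum>z<d. mono_tensor d X (r(1 := z)) (c(d := z))) = 0"
proof -
  have ins: "{1..d} = insert 1 {2..d}" "{1..d} = insert d {1..<d}" using d by auto
  define g where "g r c = (\<Sum>z<d. mono_tensor d X (r(1 := z)) (c(d := z)))" for r c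
  have "perm_span d (insert 1 {2..d}) (insert d {1..<d}) (mono_tensor d X)"
    using perm_span_mono_tensor[of d X] ins by metis
  then have g: "perm_span d {2..d} {1..<d} g"
    unfolding g_def[abs_def] by (rule perm_span_contract) auto
  have "g r c = 0"
  proof (rule perm_span_eq_zero_if_traces_zero[OF g _ _ _ r c])
    fix \<sigma> :: "nat \<Rightarrow> nat" assume \<sigma>: "bij_betw \<sigma> {1..<d} {2..d}"
    \<comment> \<open>The contraction closes \<sigma> up to a permutation of all slots.\<close>
    define \<tau> where "\<tau> i = (if i \<in> {1..<d} then \<sigma> i else if i = d then 1 else i)" for i
    have "bij_betw \<tau> {1..<d} {2..d}" using \<sigma> by (subst bij_betw_cong[where g = \<sigma>]) (auto simp: \<tau>_def)
    moreover have "bij_betw \<tau> {d} {1}" by (simp add: \<tau>_def)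
    ultimately have "bij_betw \<tau> ({1..<d} \<union> {d}) ({2..d} \<union> {1})" by (rule bij_betw_combine) auto
    moreover have "{1..<d} \<union> {d} = {1..d}" "{2..d} \<union> {1} = {1..d}" using d by auto
    ultimately have "bij_betw \<tau> {1..d} {1..d}" by simp
    then have \<tau>: "\<tau> permutes {1..d}" by (rule bij_imp_permutes) (use d in \<open>auto simp: \<tau>_def\<close>)
    have "\<tau> d \<noteq> d" using d by (simp add: \<tau>_def)
    then have "\<tau> \<noteq> id" by auto
    then have "0 = (\<Sum>u\<in>insert 1 {2..d} \<rightarrow>\<^sub>E {..<d}. mono_tensor d X u (u \<circ> \<tau>))"
      using trace_mono_tensor[OF \<tau>, of X] ins(1) by simp
    also have "\<dots> = (\<Sum>u\<in>{2..d} \<rightarrow>\<^sub>E {..<d}. \<Sum>z<d. mono_tensor d X (u(1 := z)) (u(1 := z) \<circ> \<tau>))"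
      by (rule sum_PiE_insert) simp
    also have "\<dots> = (\<Sum>u\<in>{2..d} \<rightarrow>\<^sub>E {..<d}. g u (u \<circ> \<sigma>))"
      unfolding g_def
    proof (intro sum.cong refl mono_tensor_cong)
      fix u :: "nat \<Rightarrow> nat" and z i assume i: "i \<in> {1..d}"
      show "(u(1 := z) \<circ> \<tau>) i = ((u \<circ> \<sigma>)(d := z)) i"
      proof (cases "i = d")
        case True
        then show ?thesis by (simp add: \<tau>_def)
      next
        case False
        then have "i \<in> {1..<d}" using i by simp
        then have "\<sigma> i \<in> {2..d}" "\<tau> i = \<sigma> i" using bij_betwE[OF \<sigma>] by (auto simp: \<tau>_def)
        then show ?thesis using False by simp
      qed
    qed
    finally show "(\<Sum>u\<in>{2..d} \<rightarrow>\<^sub>E {..<d}. g u (u \<circ> \<sigma>)) = 0" by simp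
  qed simp_all
  then show ?thesis by (simp add: g_def)
qed

lemma perm_span_two_slots:
  assumes "perm_span d {p0, p1} {q0, q1} f" "p0 \<noteq> p1" "q0 \<noteq> q1"
  shows "\<exists>a b. \<forall>r c. r p0 < d \<longrightarrow> r p1 < d \<longrightarrow> c q0 < d \<longrightarrow> c q1 < d \<longrightarrow>
    f r c = a * of_bool (c q0 = r p0 \<and> c q1 = r p1) + b * of_bool (c q0 = r p1 \<and> c q1 = r p0)"
  using assms(1)
proof induction
  case (delta \<sigma> a)
  have "\<sigma> q0 \<in> {p0, p1}" "\<sigma> q1 \<in> {p0, p1}" "\<sigma> q0 \<noteq> \<sigma> q1"
    using delta assms(3) by (auto simp: bij_betw_def inj_on_def)
  then consider "\<sigma> q0 = p0" "\<sigma> q1 = p1" | "\<sigma> q0 = p1" "\<sigma> q1 = p0" by auto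
  then show ?case
  proof cases
    case 1
    then show ?thesis by (intro exI[of _ a] exI[of _ 0]) simp
  next
    case 2
    then show ?thesis by (intro exI[of _ 0] exI[of _ a]) simp
  qed
next
  case (add f g)
  then obtain a b a' b' where
    "\<forall>r c. r p0 < d \<longrightarrow> r p1 < d \<longrightarrow> c q0 < d \<longrightarrow> c q1 < d \<longrightarrow>
      f r c = a * of_bool (c q0 = r p0 \<and> c q1 = r p1) + b * of_bool (c q0 = r p1 \<and> c q1 = r p0)"
    "\<forall>r c. r p0 < d \<longrightarrow> r p1 < d \<longrightarrow> c q0 < d \<longrightarrow> c q1 < d \<longrightarrow>
      g r c = a' * of_bool (c q0 = r p0 \<and> c q1 = r p1) + b' * of_bool (c q0 = r p1 \<and> c q1 = r p0)"
    by blast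
  then show ?case
    by (intro exI[of _ "a + a'"] exI[of _ "b + b'"]) (simp add: algebra_simps)
next
  case (cong f g)
  then obtain a b where *: "\<forall>r c. r p0 < d \<longrightarrow> r p1 < d \<longrightarrow> c q0 < d \<longrightarrow> c q1 < d \<longrightarrow>
      f r c = a * of_bool (c q0 = r p0 \<and> c q1 = r p1) + b * of_bool (c q0 = r p1 \<and> c q1 = r p0)"
    by blast
  show ?case
  proof (rule exI[of _ a], rule exI[of _ b], intro allI impI)
    fix r c
    assume less: "r p0 < d" "r p1 < d" "c q0 < d" "c q1 < d"
    then have "f r c = g r c" by (intro cong.hyps(2)) auto
    then show "g r c = a * of_bool (c q0 = r p0 \<and> c q1 = r p1) + b * of_bool (c q0 = r p1 \<and> c q1 = r p0)"
      using * less by metis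
  qed
qed

section \<open>The two traces of a pair of words\<close>

definition blocksA :: "nat \<Rightarrow> var list" where
  "blocksA d = map (\<lambda>i. if odd i then VX i else VY i) [1..<d + 1]"

definition blocksB :: "nat \<Rightarrow> var list" where
  "blocksB d = map (\<lambda>i. if even i then VX i else VY i) (rev [1..<d + 1])"

definition blocksC :: "nat \<Rightarrow> var list" where
  "blocksC d = VY 1 # map (\<lambda>i. if even i then VX i else VY i) (rev [2..<d + 1])"

lemma length_blocks:
  "length (blocksA d) = d" "length (blocksB d) = d" "d \<ge> 1 \<Longrightarrow> length (blocksC d) = d"
  by (simp_all add: blocksA_def blocksB_def blocksC_def del: upt_Suc)

lemma rev_upt_nth: "k < n - m \<Longrightarrow> rev [m..<n] ! k = n - Suc k"
  by (simp add: rev_nth)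

lemma blocksA_nth: "k < d \<Longrightarrow> blocksA d ! k = (if odd (Suc k) then VX (Suc k) else VY (Suc k))"
  by (simp add: blocksA_def del: upt_Suc)

lemma blocksB_nth: "k < d \<Longrightarrow> blocksB d ! k = (if even (d - k) then VX (d - k) else VY (d - k))"
  by (simp add: blocksB_def rev_upt_nth del: upt_Suc)

lemma blocksC_nth:
  "Suc k < d \<Longrightarrow> blocksC d ! Suc k = (if even (d - k) then VX (d - k) else VY (d - k))"
  "blocksC d ! 0 = VY 1"
proof -
  assume k: "Suc k < d"
  then have "rev [2..<d + 1] ! k = d - k" by (subst rev_upt_nth) simp_all
  then show "blocksC d ! Suc k = (if even (d - k) then VX (d - k) else VY (d - k))"
    using k by (simp add: blocksC_def del: upt_Suc)
qed (simp add: blocksC_def)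

lemma set_blocks:
  "set (blocksA d) = VX ` {i \<in> {1..d}. odd i} \<union> VY ` {i \<in> {1..d}. even i}"
  "set (blocksB d) = VX ` {i \<in> {1..d}. even i} \<union> VY ` {i \<in> {1..d}. odd i}"
  "d \<ge> 1 \<Longrightarrow> set (blocksC d) = VX ` {i \<in> {1..d}. even i} \<union> VY ` {i \<in> {1..d}. odd i}"
proof -
  have [simp]: "set [1..<d + 1] = {1..d}" "set [2..<d + 1] = {2..d}" by auto
  show "set (blocksA d) = VX ` {i \<in> {1..d}. odd i} \<union> VY ` {i \<in> {1..d}. even i}"
    unfolding blocksA_def by (auto simp del: upt_Suc)
  show "set (blocksB d) = VX ` {i \<in> {1..d}. even i} \<union> VY ` {i \<in> {1..d}. odd i}"
    unfolding blocksB_def by (auto simp del: upt_Suc)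
  assume "d \<ge> 1"
  then have "{1..d} = insert 1 {2..d}" by auto
  then show "set (blocksC d) = VX ` {i \<in> {1..d}. even i} \<union> VY ` {i \<in> {1..d}. odd i}"
    unfolding blocksC_def by (auto simp del: upt_Suc)
qed

lemma distinct_blocks: "distinct (blocksA d)" "distinct (blocksB d)" "distinct (blocksC d)"
  by (auto simp: blocksA_def blocksB_def blocksC_def distinct_map inj_on_def simp del: upt_Suc split: if_splits)

text \<open>$B$ and $C$ consist of the monomials that do not occur in $A$.\<close>
definition complementary_word where
  "complementary_word d w \<longleftrightarrow> distinct w \<and> set w = VX ` {i \<in> {1..d}. even i} \<union> VY ` {i \<in> {1..d}. odd i} \<and> w \<noteq> []"

lemma complementary_blocks: "d \<ge> 1 \<Longrightarrow> complementary_word d (blocksB d)" "d \<ge> 1 \<Longrightarrow> complementary_word d (blocksC d)"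
  using length_blocks[of d] by (auto simp: complementary_word_def set_blocks distinct_blocks simp del: atLeastAtMost_iff)

lemma complementary_word_props:
  assumes "complementary_word d w" "d \<ge> 1"
  shows "distinct (concat [blocksA d, w])" "set (concat [blocksA d, w]) = block_vars d"
    "[] \<notin> set [blocksA d, w]" "hd (blocksA d) \<noteq> hd w" "last (blocksA d) \<noteq> last w"
proof -
  have "blocksA d \<noteq> []"
  proof
    assume "blocksA d = []"
    then show False using length_blocks(1)[of d] assms(2) by simp
  qed
  moreover have "w \<noteq> []" "distinct w"
    and set_w: "set w = VX ` {i \<in> {1..d}. even i} \<union> VY ` {i \<in> {1..d}. odd i}"
    using assms(1) unfolding complementary_word_def by blast+
  ultimately have ne: "blocksA d \<noteq> []" "w \<noteq> []" by simp_all
  then show "[] \<notin> set [blocksA d, w]" by auto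
  show dist: "distinct (concat [blocksA d, w])"
    using \<open>distinct w\<close> by (auto simp: set_w distinct_blocks set_blocks)
  show "set (concat [blocksA d, w]) = block_vars d"
    unfolding block_vars_def by (auto simp: set_w set_blocks simp del: atLeastAtMost_iff)
  have "set (blocksA d) \<inter> set w = {}" using dist by simp
  moreover have "hd (blocksA d) \<in> set (blocksA d)" "hd w \<in> set w"
    "last (blocksA d) \<in> set (blocksA d)" "last w \<in> set w" using ne by simp_all
  ultimately show "hd (blocksA d) \<noteq> hd w" "last (blocksA d) \<noteq> last w" by auto
qed

lemma block_tensors_trace:
  assumes "complementary_word d w" "d \<ge> 1"
    and "s ` {last (blocksA d), last w} \<subseteq> {hd (blocksA d), hd w}"
    and "\<And>k. Suc k < d \<Longrightarrow> s (blocksA d ! k) = blocksA d ! Suc k"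
    and "\<And>k. Suc k < length w \<Longrightarrow> s (w ! k) = w ! Suc k"
  shows "(\<Sum>u\<in>{hd (blocksA d), hd w} \<rightarrow>\<^sub>E {..<d}. block_tensors d X Y [blocksA d, w] {} u (u \<circ> s))
    = (\<Sum>u\<in>block_vars d \<rightarrow>\<^sub>E {..<d}. block_tensors d X Y [] (block_vars d) u (u \<circ> s))"
proof -
  have "(\<Sum>u\<in>({} \<union> hd ` set [blocksA d, w]) \<rightarrow>\<^sub>E {..<d}. block_tensors d X Y [blocksA d, w] {} u (u \<circ> s))
    = (\<Sum>u\<in>block_vars d \<rightarrow>\<^sub>E {..<d}. block_tensors d X Y [] (block_vars d) u (u \<circ> s))"
    by (rule trace_word_tensor)
      (use assms complementary_word_props[OF assms(1,2)] length_blocks(1)[of d] in auto)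
  then show ?thesis by simp
qed

text \<open>A trace connects the output slot of each monomial with the input slot of its successor. In
$A$ and $B$ the successors of monomials in $X$ are monomials in $Y$ and vice versa.\<close>
fun closing :: "(nat \<Rightarrow> nat) \<Rightarrow> (nat \<Rightarrow> nat) \<Rightarrow> var \<Rightarrow> var" where
  "closing f g (VX i) = VY (f i)"
| "closing f g (VY i) = VX (g i)"

lemma block_tensors_closing:
  assumes "f permutes {1..d}" "g permutes {1..d}"
  shows "(\<Sum>u\<in>block_vars d \<rightarrow>\<^sub>E {..<d}. block_tensors d X Y [] (block_vars d) u (u \<circ> closing f g))
    = trace_form d X * trace_form d Y * Wg d (g \<circ> f)"
proof -
  have "(\<Sum>u\<in>block_vars d \<rightarrow>\<^sub>E {..<d}. block_tensors d X Y [] (block_vars d) u (u \<circ> closing f g))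
    = (\<Sum>u\<in>block_vars d \<rightarrow>\<^sub>E {..<d}. mono_tensor d X (u \<circ> VX) ((u \<circ> VY) \<circ> f) * mono_tensor d Y (u \<circ> VY) ((u \<circ> VX) \<circ> g))"
    unfolding block_tensors_letters by (simp add: comp_def)
  also have "\<dots> = (\<Sum>x\<in>{1..d} \<rightarrow>\<^sub>E {..<d}. \<Sum>y\<in>{1..d} \<rightarrow>\<^sub>E {..<d}.
      mono_tensor d X x (y \<circ> f) * mono_tensor d Y y (x \<circ> g))"
    by (rule sum_PiE_block_vars)
  finally show ?thesis using alternating_contraction[OF assms] by simp
qed

text \<open>The product of two words is a combination of the identity and the swap, with $\mathrm{tr} = d^2$
and $\mathrm{tr} = d$. Closing up each word by itself, or both words to one cycle, gives two linear
equations for the coefficients.\<close>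
lemma two_word_form:
  assumes w: "complementary_word d w" "d \<ge> 1"
  obtains a b where
    "\<And>i j k l. \<lbrakk>i < d; j < d; k < d; l < d\<rbrakk> \<Longrightarrow>
      (\<Sum>\<pi>\<in>perm_pairs d. sign_pair \<pi> * (word_entry d (block_matrix d X Y \<pi>) (blocksA d) i k *
        word_entry d (block_matrix d X Y \<pi>) w j l))
      = a * of_bool (k = i \<and> l = j) + b * of_bool (k = j \<and> l = i)"
    "\<And>s. s (last (blocksA d)) = hd (blocksA d) \<Longrightarrow> s (last w) = hd w \<Longrightarrow>
      (\<Sum>u\<in>{hd (blocksA d), hd w} \<rightarrow>\<^sub>E {..<d}. block_tensors d X Y [blocksA d, w] {} u (u \<circ> s))
      = (of_nat d)\<^sup>2 * a + of_nat d * b"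
    "\<And>s. s (last (blocksA d)) = hd w \<Longrightarrow> s (last w) = hd (blocksA d) \<Longrightarrow>
      (\<Sum>u\<in>{hd (blocksA d), hd w} \<rightarrow>\<^sub>E {..<d}. block_tensors d X Y [blocksA d, w] {} u (u \<circ> s))
      = of_nat d * a + (of_nat d)\<^sup>2 * b"
proof -
  let ?A = "blocksA d"
  let ?p0 = "hd ?A" and ?p1 = "hd w" and ?q0 = "last ?A" and ?q1 = "last w"
  let ?T = "block_tensors d X Y [?A, w] {}"
  note props = complementary_word_props[OF w]
  have "perm_span d ({} \<union> hd ` set [?A, w]) ({} \<union> last ` set [?A, w]) ?T"
    by (rule perm_span_word_tensor[OF perm_span_block_tensors]) (use props in auto)
  then have "perm_span d {?p0, ?p1} {?q0, ?q1} ?T" by simp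
  from perm_span_two_slots[OF this props(4,5)] obtain a b where ab:
    "\<And>r c. r ?p0 < d \<Longrightarrow> r ?p1 < d \<Longrightarrow> c ?q0 < d \<Longrightarrow> c ?q1 < d \<Longrightarrow>
      ?T r c = a * of_bool (c ?q0 = r ?p0 \<and> c ?q1 = r ?p1) + b * of_bool (c ?q0 = r ?p1 \<and> c ?q1 = r ?p0)"
    by blast
  have sums: "(\<Sum>u\<in>{?p0, ?p1} \<rightarrow>\<^sub>E {..<d}. ?T u (u \<circ> s)) =
      (\<Sum>i<d. \<Sum>j<d. a * of_bool ((if s ?q0 = ?p0 then i else j) = i \<and> (if s ?q1 = ?p0 then i else j) = j)
        + b * of_bool ((if s ?q0 = ?p0 then i else j) = j \<and> (if s ?q1 = ?p0 then i else j) = i))"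
    if s: "s ?q0 \<in> {?p0, ?p1}" "s ?q1 \<in> {?p0, ?p1}" for s
  proof -
    have "(\<Sum>u\<in>{?p0, ?p1} \<rightarrow>\<^sub>E {..<d}. ?T u (u \<circ> s)) =
      (\<Sum>u\<in>{?p1} \<rightarrow>\<^sub>E {..<d}. \<Sum>i<d. ?T (u(?p0 := i)) (u(?p0 := i) \<circ> s))"
      by (rule sum_PiE_insert) (use props(4) in simp)
    also have "\<dots> = (\<Sum>u\<in>{} \<rightarrow>\<^sub>E {..<d}. \<Sum>j<d. \<Sum>i<d. ?T (u(?p1 := j, ?p0 := i)) (u(?p1 := j, ?p0 := i) \<circ> s))"
      by (rule sum_PiE_insert) simp
    also have "\<dots> = (\<Sum>j<d. \<Sum>i<d. a * of_bool ((if s ?q0 = ?p0 then i else j) = i \<and> (if s ?q1 = ?p0 then i else j) = j)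
        + b * of_bool ((if s ?q0 = ?p0 then i else j) = j \<and> (if s ?q1 = ?p0 then i else j) = i))"
    proof -
      have "?T (u(?p1 := j, ?p0 := i)) (u(?p1 := j, ?p0 := i) \<circ> s)
        = a * of_bool ((if s ?q0 = ?p0 then i else j) = i \<and> (if s ?q1 = ?p0 then i else j) = j)
        + b * of_bool ((if s ?q0 = ?p0 then i else j) = j \<and> (if s ?q1 = ?p0 then i else j) = i)"
        if "i < d" "j < d" for u i j
        using that s props(4) by (subst ab) auto
      then show ?thesis by simp
    qed
    also have "\<dots> = (\<Sum>i<d. \<Sum>j<d. a * of_bool ((if s ?q0 = ?p0 then i else j) = i \<and> (if s ?q1 = ?p0 then i else j) = j)
        + b * of_bool ((if s ?q0 = ?p0 then i else j) = j \<and> (if s ?q1 = ?p0 then i else j) = i))"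
      by (rule sum.swap)
    finally show ?thesis .
  qed
  have diag: "(\<Sum>i<d. \<Sum>j<d. a * 1 + b * of_bool (i = j)) = (of_nat d)\<^sup>2 * a + of_nat d * b" for a b :: rat
    by (simp add: sum.distrib of_bool_def if_distrib[of "\<lambda>x. b * x"] power2_eq_square distrib_left
        mult.assoc cong: if_cong)
  show thesis
  proof (rule that[of a b])
    fix i j k l assume less: "i < d" "j < d" "k < d" "l < d"
    have "?T ((\<lambda>_. j)(?p0 := i)) ((\<lambda>_. l)(?q0 := k))
      = a * of_bool (k = i \<and> l = j) + b * of_bool (k = j \<and> l = i)"
      using less props(4,5) by (subst ab) auto
    moreover have "?T ((\<lambda>_. j)(?p0 := i)) ((\<lambda>_. l)(?q0 := k))
      = (\<Sum>\<pi>\<in>perm_pairs d. sign_pair \<pi> * (word_entry d (block_matrix d X Y \<pi>) (blocksA d) i k *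
        word_entry d (block_matrix d X Y \<pi>) w j l))"
      unfolding word_tensor_def using props(4,5) by simp
    ultimately show "(\<Sum>\<pi>\<in>perm_pairs d. sign_pair \<pi> * (word_entry d (block_matrix d X Y \<pi>) (blocksA d) i k *
        word_entry d (block_matrix d X Y \<pi>) w j l))
      = a * of_bool (k = i \<and> l = j) + b * of_bool (k = j \<and> l = i)" by simp
  next
    fix s assume s: "s ?q0 = ?p0" "s ?q1 = ?p1"
    have "(\<Sum>u\<in>{?p0, ?p1} \<rightarrow>\<^sub>E {..<d}. ?T u (u \<circ> s)) = (\<Sum>i<d. \<Sum>j<d. a * 1 + b * of_bool (i = j))"
      by (subst sums) (use s props(4) in \<open>auto intro!: sum.cong\<close>)
    then show "(\<Sum>u\<in>{?p0, ?p1} \<rightarrow>\<^sub>E {..<d}. ?T u (u \<circ> s)) = (of_nat d)\<^sup>2 * a + of_nat d * b"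
      using diag by simp
  next
    fix s assume s: "s ?q0 = ?p1" "s ?q1 = ?p0"
    have "(\<Sum>u\<in>{?p0, ?p1} \<rightarrow>\<^sub>E {..<d}. ?T u (u \<circ> s)) = (\<Sum>i<d. \<Sum>j<d. b * 1 + a * of_bool (i = j))"
      by (subst sums) (use s props(4) in \<open>auto intro!: sum.cong\<close>)
    then show "(\<Sum>u\<in>{?p0, ?p1} \<rightarrow>\<^sub>E {..<d}. ?T u (u \<circ> s)) = of_nat d * a + (of_nat d)\<^sup>2 * b"
      using diag[of b a] by simp
  qed
qed

text \<open>The successor of $m_i(X)$ in $A$, if $i$ is odd, or in $B$, if $i$ is even.\<close>
definition succX :: "nat \<Rightarrow> nat \<Rightarrow> nat" where
  "succX d i = (if i \<notin> {1..d} then i else if odd i then i + 1 else i - 1)"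

text \<open>The successor of $m_j(Y)$ in $A$ or in $B$, when each of the two words is closed up to a cycle:
$A$ ends with $m_d(Y)$ and starts with $m_1(X)$, and $B$ ends with $m_1(Y)$ and starts with $m_d(X)$.\<close>
definition succY :: "nat \<Rightarrow> nat \<Rightarrow> nat" where
  "succY d j = (if j \<notin> {1..d} then j else if even j then (if j = d then 1 else j + 1)
     else (if j = 1 then d else j - 1))"

text \<open>As before, but now $A B$ is closed up to one cycle.\<close>
definition succY' :: "nat \<Rightarrow> nat \<Rightarrow> nat" where
  "succY' d j = (if j \<notin> {1..d} then j else if even j then (if j = d then d else j + 1)
     else (if j = 1 then 1 else j - 1))"

lemma permutes_if_involution:
  assumes "\<And>x. f (f x) = x" "\<And>x. x \<notin> S \<Longrightarrow> f x = x"
  shows "f permutes S"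
proof (rule bij_imp_permutes[OF bij_betw_byWitness[where f' = f]])
  have "f x \<in> S" if "x \<in> S" for x
  proof (rule ccontr)
    assume "f x \<notin> S"
    then have "f (f x) = f x" by (rule assms(2))
    then show False using assms(1)[of x] that \<open>f x \<notin> S\<close> by simp
  qed
  then show "f ` S \<subseteq> S" "f ` S \<subseteq> S" by auto
qed (use assms in simp_all)

lemma succ_permutes:
  assumes "even d"
  shows "succX d permutes {1..d}" "succY d permutes {1..d}" "succY' d permutes {1..d}"
proof -
  show "succX d permutes {1..d}"
  proof (rule permutes_if_involution)
    show "succX d (succX d i) = i" for i
      using assms by (cases "odd i") (auto simp: succX_def elim!: oddE evenE, presburger)
  qed (simp add: succX_def)
  show "succY d permutes {1..d}"
  proof (rule permutes_if_involution)
    show "succY d (succY d i) = i" for i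
      using assms by (cases "odd i") (auto simp: succY_def elim!: oddE evenE)
  qed (simp add: succY_def)
  show "succY' d permutes {1..d}"
  proof (rule permutes_if_involution)
    show "succY' d (succY' d i) = i" for i
      using assms by (cases "odd i") (auto simp: succY'_def elim!: oddE evenE)
  qed (simp add: succY'_def)
qed

lemma hd_last_blocks:
  assumes "even d" "d \<ge> 2"
  shows "hd (blocksA d) = VX 1" "last (blocksA d) = VY d"
    "hd (blocksB d) = VX d" "last (blocksB d) = VY 1"
    "hd (blocksC d) = VY 1" "last (blocksC d) = VX 2"
proof -
  have ne: "blocksA d \<noteq> []" "blocksB d \<noteq> []" "blocksC d \<noteq> []"
    using length_blocks[of d] assms(2) by (metis (no_types) list.size(3) not_numeral_le_zero le_trans one_le_numeral)+
  have len: "length (blocksA d) = d" "length (blocksB d) = d" "length (blocksC d) = d"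
    using length_blocks[of d] assms(2) by simp_all
  show "hd (blocksA d) = VX 1" using blocksA_nth[of 0 d] assms by (simp add: hd_conv_nth[OF ne(1)])
  show "last (blocksA d) = VY d"
    using blocksA_nth[of "d - 1" d] assms by (simp add: last_conv_nth[OF ne(1)] len)
  show "hd (blocksB d) = VX d" using blocksB_nth[of 0 d] assms by (simp add: hd_conv_nth[OF ne(2)])
  show "last (blocksB d) = VY 1"
    using blocksB_nth[of "d - 1" d] assms by (simp add: last_conv_nth[OF ne(2)] len)
  show "hd (blocksC d) = VY 1" by (simp add: blocksC_def)
  show "last (blocksC d) = VX 2"
    using blocksC_nth(1)[of "d - 2" d] assms by (simp add: last_conv_nth[OF ne(3)] len numeral_2_eq_2 Suc_diff_Suc)
qed

lemma consecutive_blocks: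
  assumes d: "even d" "d \<ge> 2" and g: "g = succY d \<or> g = succY' d"
  shows "Suc k < d \<Longrightarrow> closing (succX d) g (blocksA d ! k) = blocksA d ! Suc k"
    "Suc k < d \<Longrightarrow> closing (succX d) g (blocksB d ! k) = blocksB d ! Suc k"
    "Suc k < d \<Longrightarrow> closing (succX d) (succY d) (blocksC d ! k) = blocksC d ! Suc k"
proof -
  show "closing (succX d) g (blocksA d ! k) = blocksA d ! Suc k" if k: "Suc k < d"
    using k g by (auto simp: blocksA_nth succX_def succY_def succY'_def)
  have step: "closing (succX d) g (if even i then VX i else VY i)
      = (if even (i - 1) then VX (i - 1) else VY (i - 1))"
    if "1 < i" "i \<le> d" for i
    using that g by (auto simp: succX_def succY_def succY'_def)
  show "closing (succX d) g (blocksB d ! k) = blocksB d ! Suc k" if k: "Suc k < d"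
    using step[of "d - k"] k by (simp add: blocksB_nth)
  show "closing (succX d) (succY d) (blocksC d ! k) = blocksC d ! Suc k" if k: "Suc k < d"
  proof (cases k)
    case 0
    then show ?thesis using blocksC_nth(1)[of 0 d] k d by (simp add: blocksC_nth(2) succY_def)
  next
    case (Suc l)
    have "closing (succX d) (succY d) (if even (d - l) then VX (d - l) else VY (d - l))
      = (if even (d - l - 1) then VX (d - l - 1) else VY (d - l - 1))"
      using k Suc by (auto simp: succX_def succY_def)
    then show ?thesis using Suc k blocksC_nth(1)[of l d] blocksC_nth(1)[of "Suc l" d] by simp
  qed
qed

text \<open>$C$ is a rotation of $B$, so both words have the same closed form and the same successors.\<close>
lemma trace_separate:
  assumes d: "even d" "d \<ge> 2" and w: "w = blocksB d \<or> w = blocksC d"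
  shows "(\<Sum>u\<in>{hd (blocksA d), hd w} \<rightarrow>\<^sub>E {..<d}.
      block_tensors d X Y [blocksA d, w] {} u (u \<circ> closing (succX d) (succY d)))
    = trace_form d X * trace_form d Y * Wg d (succY d \<circ> succX d)"
    "closing (succX d) (succY d) (last (blocksA d)) = hd (blocksA d)"
    "closing (succX d) (succY d) (last w) = hd w"
proof -
  note hl = hd_last_blocks[OF d]
  have d1: "d \<ge> 1" using d(2) by simp
  show 1: "closing (succX d) (succY d) (last (blocksA d)) = hd (blocksA d)"
    unfolding hl using d by (simp add: succY_def)
  show 2: "closing (succX d) (succY d) (last w) = hd w"
    using w d by (auto simp: hl succY_def succX_def)
  have pair: "complementary_word d w" using w complementary_blocks[OF d1] by blast
  have len: "length w = d" using w length_blocks[of d] d1 by auto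
  have "(\<Sum>u\<in>{hd (blocksA d), hd w} \<rightarrow>\<^sub>E {..<d}.
      block_tensors d X Y [blocksA d, w] {} u (u \<circ> closing (succX d) (succY d)))
    = (\<Sum>u\<in>block_vars d \<rightarrow>\<^sub>E {..<d}. block_tensors d X Y [] (block_vars d) u (u \<circ> closing (succX d) (succY d)))"
    by (rule block_tensors_trace[OF pair d1])
      (use 1 2 w len consecutive_blocks[OF d, of "succY d"] in auto)
  then show "(\<Sum>u\<in>{hd (blocksA d), hd w} \<rightarrow>\<^sub>E {..<d}.
      block_tensors d X Y [blocksA d, w] {} u (u \<circ> closing (succX d) (succY d)))
    = trace_form d X * trace_form d Y * Wg d (succY d \<circ> succX d)"
    using block_tensors_closing[OF succ_permutes(1,2)[OF d(1)]] by simp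
qed

lemma trace_joint_B:
  assumes d: "even d" "d \<ge> 2"
  shows "(\<Sum>u\<in>{hd (blocksA d), hd (blocksB d)} \<rightarrow>\<^sub>E {..<d}.
      block_tensors d X Y [blocksA d, blocksB d] {} u (u \<circ> closing (succX d) (succY' d)))
    = trace_form d X * trace_form d Y * Wg d (succY' d \<circ> succX d)"
    "closing (succX d) (succY' d) (last (blocksA d)) = hd (blocksB d)"
    "closing (succX d) (succY' d) (last (blocksB d)) = hd (blocksA d)"
proof -
  note hl = hd_last_blocks[OF d]
  have d1: "d \<ge> 1" using d(2) by simp
  show 1: "closing (succX d) (succY' d) (last (blocksA d)) = hd (blocksB d)"
    unfolding hl using d by (simp add: succY'_def)
  show 2: "closing (succX d) (succY' d) (last (blocksB d)) = hd (blocksA d)"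
    unfolding hl using d by (simp add: succY'_def)
  have "(\<Sum>u\<in>{hd (blocksA d), hd (blocksB d)} \<rightarrow>\<^sub>E {..<d}.
      block_tensors d X Y [blocksA d, blocksB d] {} u (u \<circ> closing (succX d) (succY' d)))
    = (\<Sum>u\<in>block_vars d \<rightarrow>\<^sub>E {..<d}. block_tensors d X Y [] (block_vars d) u (u \<circ> closing (succX d) (succY' d)))"
    by (rule block_tensors_trace[OF complementary_blocks(1)[OF d1] d1])
      (use 1 2 length_blocks[of d] consecutive_blocks[OF d, of "succY' d"] in auto)
  then show "(\<Sum>u\<in>{hd (blocksA d), hd (blocksB d)} \<rightarrow>\<^sub>E {..<d}.
      block_tensors d X Y [blocksA d, blocksB d] {} u (u \<circ> closing (succX d) (succY' d)))
    = trace_form d X * trace_form d Y * Wg d (succY' d \<circ> succX d)"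
    using block_tensors_closing[OF succ_permutes(1,3)[OF d(1)]] by simp
qed

text \<open>The successors when $A C$ is closed up to one cycle. Here $m_1(Y)$ follows $m_d(Y)$, and $m_1(X)$
follows $m_2(X)$.\<close>
fun closing_C :: "nat \<Rightarrow> var \<Rightarrow> var" where
  "closing_C d (VX i) = (if i = 2 then VX 1 else VY (succX d i))"
| "closing_C d (VY i) = (if i = d then VY 1 else VX (succY d i))"

text \<open>The output slot $d$ of the tensor in $Y$ is connected with its input slot $1$, and this
contraction is zero.\<close>
lemma trace_joint_C:
  assumes d: "even d" "d \<ge> 2"
  shows "(\<Sum>u\<in>{hd (blocksA d), hd (blocksC d)} \<rightarrow>\<^sub>E {..<d}.
      block_tensors d X Y [blocksA d, blocksC d] {} u (u \<circ> closing_C d)) = 0"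
    "closing_C d (last (blocksA d)) = hd (blocksC d)"
    "closing_C d (last (blocksC d)) = hd (blocksA d)"
proof -
  note hl = hd_last_blocks[OF d]
  have d1: "d \<ge> 1" using d(2) by simp
  show 1: "closing_C d (last (blocksA d)) = hd (blocksC d)" unfolding hl by simp
  show 2: "closing_C d (last (blocksC d)) = hd (blocksA d)" unfolding hl by simp
  have agree: "closing_C d z = closing (succX d) (succY d) z" if "z \<noteq> VX 2" "z \<noteq> VY d" for z
    using that by (cases z) auto
  have A: "closing_C d (blocksA d ! k) = blocksA d ! Suc k" if k: "Suc k < d" for k
  proof -
    have "blocksA d ! k \<noteq> VX 2 \<and> blocksA d ! k \<noteq> VY d" using k d by (auto simp: blocksA_nth)
    then show ?thesis using agree consecutive_blocks(1)[OF d _ k, of "succY d"] by simp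
  qed
  have C: "closing_C d (blocksC d ! k) = blocksC d ! Suc k" if k: "Suc k < d" for k
  proof -
    have "blocksC d ! k \<noteq> VX 2 \<and> blocksC d ! k \<noteq> VY d"
    proof (cases k)
      case 0
      then show ?thesis using d by (simp add: blocksC_nth(2))
    next
      case (Suc l)
      then show ?thesis using k d blocksC_nth(1)[of l d] by (cases l) auto
    qed
    then show ?thesis using agree consecutive_blocks(3)[OF d _ k, of "succY d"] by simp
  qed
  have "(\<Sum>u\<in>{hd (blocksA d), hd (blocksC d)} \<rightarrow>\<^sub>E {..<d}.
      block_tensors d X Y [blocksA d, blocksC d] {} u (u \<circ> closing_C d))
    = (\<Sum>u\<in>block_vars d \<rightarrow>\<^sub>E {..<d}. block_tensors d X Y [] (block_vars d) u (u \<circ> closing_C d))"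
    by (rule block_tensors_trace[OF complementary_blocks(2)[OF d1] d1])
      (use 1 2 length_blocks(3)[OF d1] A C in auto)
  also have "\<dots> = (\<Sum>u\<in>block_vars d \<rightarrow>\<^sub>E {..<d}.
      mono_tensor d X (u \<circ> VX) (\<lambda>i. if i = 2 then (u \<circ> VX) 1 else (u \<circ> VY) (succX d i)) *
      mono_tensor d Y (u \<circ> VY) (\<lambda>j. if j = d then (u \<circ> VY) 1 else (u \<circ> VX) (succY d j)))"
    unfolding block_tensors_letters
    by (intro sum.cong refl arg_cong2[where f = "(*)"] mono_tensor_cong) simp_all
  also have "\<dots> = (\<Sum>x\<in>{1..d} \<rightarrow>\<^sub>E {..<d}. \<Sum>y\<in>{1..d} \<rightarrow>\<^sub>E {..<d}.
      mono_tensor d X x (\<lambda>i. if i = 2 then x 1 else y (succX d i)) *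
      mono_tensor d Y y (\<lambda>j. if j = d then y 1 else x (succY d j)))"
    by (rule sum_PiE_block_vars)
  also have "\<dots> = (\<Sum>x\<in>{1..d} \<rightarrow>\<^sub>E {..<d}. 0)"
  proof (rule sum.cong[OF refl])
    fix x assume x: "x \<in> {1..d} \<rightarrow>\<^sub>E {..<d}"
    have ins: "{1..d} = insert 1 {2..d}" using d by auto
    have "(\<Sum>y\<in>insert 1 {2..d} \<rightarrow>\<^sub>E {..<d}.
        mono_tensor d X x (\<lambda>i. if i = 2 then x 1 else y (succX d i)) *
        mono_tensor d Y y (\<lambda>j. if j = d then y 1 else x (succY d j)))
      = (\<Sum>y\<in>{2..d} \<rightarrow>\<^sub>E {..<d}. \<Sum>z<d.
        mono_tensor d X x (\<lambda>i. if i = 2 then x 1 else (y(1 := z)) (succX d i)) *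
        mono_tensor d Y (y(1 := z)) (\<lambda>j. if j = d then (y(1 := z)) 1 else x (succY d j)))"
      by (rule sum_PiE_insert) simp
    also have "\<dots> = (\<Sum>y\<in>{2..d} \<rightarrow>\<^sub>E {..<d}. \<Sum>z<d.
        mono_tensor d X x (\<lambda>i. if i = 2 then x 1 else y (succX d i)) *
        mono_tensor d Y (y(1 := z)) ((\<lambda>j. x (succY d j))(d := z)))"
    proof -
      have "mono_tensor d X x (\<lambda>i. if i = 2 then x 1 else (y(1 := z)) (succX d i))
        = mono_tensor d X x (\<lambda>i. if i = 2 then x 1 else y (succX d i))" for y z
        by (rule mono_tensor_cong) (auto simp: succX_def)
      moreover have "(\<lambda>j. if j = d then (y(1 := z)) 1 else x (succY d j)) = (\<lambda>j. x (succY d j))(d := z)"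
        for y :: "nat \<Rightarrow> nat" and z by (simp add: fun_eq_iff)
      ultimately show ?thesis by (simp only:)
    qed
    also have "\<dots> = 0"
    proof (rule sum.neutral, rule ballI)
      fix y assume y: "y \<in> {2..d} \<rightarrow>\<^sub>E {..<d}"
      have "\<forall>j\<in>{1..<d}. x (succY d j) < d"
        using x permutes_in_image[OF succ_permutes(2)[OF d(1)]] by (auto simp: PiE_iff)
      then have "(\<Sum>z<d. mono_tensor d Y (y(1 := z)) ((\<lambda>j. x (succY d j))(d := z))) = 0"
        using y by (intro mono_tensor_cyclic_contraction[OF d(2)]) (auto simp: PiE_iff)
      then show "(\<Sum>z<d. mono_tensor d X x (\<lambda>i. if i = 2 then x 1 else y (succX d i)) *
        mono_tensor d Y (y(1 := z)) ((\<lambda>j. x (succY d j))(d := z))) = 0"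
        by (simp only: sum_distrib_left[symmetric] mult_zero_right)
    qed
    finally show "(\<Sum>y\<in>{1..d} \<rightarrow>\<^sub>E {..<d}.
        mono_tensor d X x (\<lambda>i. if i = 2 then x 1 else y (succX d i)) *
        mono_tensor d Y y (\<lambda>j. if j = d then y 1 else x (succY d j))) = 0"
      unfolding ins .
  qed
  finally show "(\<Sum>u\<in>{hd (blocksA d), hd (blocksC d)} \<rightarrow>\<^sub>E {..<d}.
      block_tensors d X Y [blocksA d, blocksC d] {} u (u \<circ> closing_C d)) = 0" by simp
qed

section \<open>The cycle types of the two traces\<close>

lemma Wg_eq_if_orbit_cards:
  assumes "f permutes {1..d}" "g permutes {1..d}"
    and "card (orbit f ` {1..d}) = card (orbit g ` {1..d})"
    and "\<And>c. c \<in> orbit f ` {1..d} \<Longrightarrow> card c = m" "\<And>c. c \<in> orbit g ` {1..d} \<Longrightarrow> card c = m"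
  shows "Wg d f = Wg d g"
proof -
  obtain F where F: "bij_betw F (orbit f ` {1..d}) (orbit g ` {1..d})"
    using finite_same_card_bij[of "orbit f ` {1..d}" "orbit g ` {1..d}"] assms(3) by auto
  have "card (F c) = card c" if c: "c \<in> orbit f ` {1..d}" for c
  proof -
    have "F c \<in> orbit g ` {1..d}" using bij_betwE[OF F] c by blast
    then show ?thesis using assms(4)[OF c] assms(5) by simp
  qed
  then obtain \<tau> where "\<tau> permutes {1..d}" "\<tau> \<circ> f = g \<circ> \<tau>"
    using conjugate_if_orbit_cards_eq[OF _ assms(1,2) F] by auto
  then show ?thesis using Wg_conj assms(1,2) by blast
qed

text \<open>Going from one $X$-monomial to the next one in the closed words leads from $i$ to $i + 2$ in $A$
and from $i$ to $i - 2$ in $B$: the odd numbers form one cycle, the even ones another.\<close>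
lemma orbits_separate:
  assumes d: "d = 2 * h" "h \<ge> 1"
  defines "f \<equiv> succY d \<circ> succX d"
  shows "card (orbit f ` {1..d}) = 2" "\<And>c. c \<in> orbit f ` {1..d} \<Longrightarrow> card c = h"
proof -
  have pf: "permutation f"
    unfolding f_def using d by (intro permutes_imp_permutation[OF _ permutes_compose[OF succ_permutes(1,2)]]) auto
  have odd: "f (2 * k + 1) = (if Suc k = h then 1 else 2 * Suc k + 1)" if "k < h" for k
    using that d by (auto simp: f_def succX_def succY_def)
  have even: "f (d - 2 * k) = (if Suc k = h then d else d - 2 * Suc k)" if "k < h" for k
    using that d by (auto simp: f_def succX_def succY_def)
  have pow1: "(f ^^ k) 1 = 2 * k + 1" if "k < h" for k
    using that
  proof (induction k)
    case (Suc k)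
    then show ?case using odd[of k] by simp
  qed simp
  have powd: "(f ^^ k) d = d - 2 * k" if "k < h" for k
    using that
  proof (induction k)
    case (Suc k)
    then show ?case using even[of k] by simp
  qed simp
  obtain h' where h': "h = Suc h'" using d(2) by (cases h) auto
  have "(f ^^ h) 1 = 1" "(f ^^ h) d = d"
    unfolding h' using pow1[of h'] powd[of h'] odd[of h'] even[of h'] h' by simp_all
  then have "orbit f 1 = (\<lambda>k. (f ^^ k) 1) ` {..<h}" "orbit f d = (\<lambda>k. (f ^^ k) d) ` {..<h}"
    using d(2) by (auto simp: orbit_altdef_bounded)
  then have orb: "orbit f 1 = (\<lambda>k. 2 * k + 1) ` {..<h}" "orbit f d = (\<lambda>k. d - 2 * k) ` {..<h}"
    using pow1 powd by auto
  have card1: "card (orbit f 1) = h" unfolding orb by (subst card_image) (auto simp: inj_on_def)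
  have cardd: "card (orbit f d) = h" unfolding orb using d by (subst card_image) (auto simp: inj_on_def)
  have each: "orbit f i \<in> {orbit f 1, orbit f d}" if i: "i \<in> {1..d}" for i
  proof (cases "odd i")
    case True
    then obtain k where k: "i = 2 * k + 1" by (auto elim: oddE)
    then have "k < h" using i d by auto
    then have "i \<in> orbit f 1" unfolding orb using k by blast
    then show ?thesis using orbit_eq_if_in_orbit[OF pf] by blast
  next
    case False
    then obtain k where k: "i = 2 * k" by (auto elim: evenE)
    then have "i = d - 2 * (h - k)" "h - k < h" using i d by auto
    then have "i \<in> orbit f d" unfolding orb by blast
    then show ?thesis using orbit_eq_if_in_orbit[OF pf] by blast
  qed
  have "1 \<in> {1..d}" "d \<in> {1..d}" using d by auto
  then have orbits: "orbit f ` {1..d} = {orbit f 1, orbit f d}" using each by blast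
  have "1 \<in> orbit f 1" by (rule permutation_self_in_orbit[OF pf])
  moreover have "1 \<notin> orbit f d" unfolding orb using d by auto
  ultimately have "orbit f 1 \<noteq> orbit f d" by blast
  then show "card (orbit f ` {1..d}) = 2" unfolding orbits by simp
  show "card c = h" if "c \<in> orbit f ` {1..d}" for c
    using that card1 cardd unfolding orbits by blast
qed

text \<open>In the cycle of $A B$ the last odd number $d - 1$ is followed by $d$, and $2$ is followed by $1$.\<close>
lemma orbits_joint:
  assumes d: "d = 2 * h" "h \<ge> 1"
  shows "orbit (succY' d \<circ> succX d) ` {1..d} = {{1..d}}"
proof -
  define f where "f = succY' d \<circ> succX d"
  have perm: "f permutes {1..d}"
    unfolding f_def using d by (intro permutes_compose[OF succ_permutes(1,3)]) auto
  have pf: "permutation f" by (rule permutes_imp_permutation[OF _ perm]) simp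
  have odd: "f (2 * k + 1) = (if Suc k = h then d else 2 * Suc k + 1)" if "k < h" for k
    using that d by (auto simp: f_def succX_def succY'_def)
  have even: "f (d - 2 * k) = (if Suc k = h then 1 else d - 2 * Suc k)" if "k < h" for k
    using that d by (auto simp: f_def succX_def succY'_def)
  have pow1: "(f ^^ k) 1 = 2 * k + 1" if "k < h" for k
    using that
  proof (induction k)
    case (Suc k)
    then show ?case using odd[of k] by simp
  qed simp
  have powd: "(f ^^ k) d = d - 2 * k" if "k < h" for k
    using that
  proof (induction k)
    case (Suc k)
    then show ?case using even[of k] by simp
  qed simp
  obtain h' where h': "h = Suc h'" using d(2) by (cases h) auto
  have "(f ^^ h) 1 = d" unfolding h' using pow1[of h'] odd[of h'] h' by simp
  then have d_in: "d \<in> orbit f 1" using in_orbit_funpow_iff[OF pf] by metis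
  have "i \<in> orbit f 1" if i: "i \<in> {1..d}" for i
  proof (cases "odd i")
    case True
    then obtain k where k: "i = 2 * k + 1" by (auto elim: oddE)
    then have "k < h" using i d by auto
    then show ?thesis using pow1[of k] k in_orbit_funpow_iff[OF pf] by metis
  next
    case False
    then obtain k where k: "i = 2 * k" by (auto elim: evenE)
    then have "i = d - 2 * (h - k)" "h - k < h" using i d by auto
    then have "i = (f ^^ (h - k)) d" using powd[of "h - k"] by simp
    then have "i \<in> orbit f d" using in_orbit_funpow_iff[OF pf] by blast
    then show ?thesis using orbit_eq_if_in_orbit[OF pf d_in] by simp
  qed
  moreover have "1 \<in> {1..d}" using d by simp
  moreover have "orbit f 1 \<subseteq> {1..d}" by (rule permutes_orbit_subset[OF perm]) (use d in simp)
  ultimately have one: "orbit f 1 = {1..d}" by blast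
  have "orbit f i = {1..d}" if "i \<in> {1..d}" for i
    using orbit_eq_if_in_orbit[OF pf, of i 1] that one by simp
  then have "orbit f ` {1..d} = {{1..d}}" using \<open>1 \<in> {1..d}\<close> by (auto intro!: image_eqI[of _ _ 1])
  then show ?thesis unfolding f_def .
qed

lemma Wg_separate:
  assumes d: "d = 2 * h" "d \<ge> 2" and \<kappa>: "\<kappa> permutes {1..d}" "card (cycles d \<kappa>) = 2" "\<forall>c\<in>cycles d \<kappa>. card c = h"
  shows "Wg d (succY d \<circ> succX d) = Wg d \<kappa>"
proof (rule Wg_eq_if_orbit_cards[where m = h])
  have h: "h \<ge> 1" using d by simp
  show "(succY d \<circ> succX d) permutes {1..d}" using d by (intro permutes_compose succ_permutes) auto
  show "card (orbit (succY d \<circ> succX d) ` {1..d}) = card (orbit \<kappa> ` {1..d})"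
    using orbits_separate(1)[OF d(1) h] \<kappa>(2) by (simp add: cycles_def)
  show "\<And>c. c \<in> orbit (succY d \<circ> succX d) ` {1..d} \<Longrightarrow> card c = h"
    by (rule orbits_separate(2)[OF d(1) h])
  show "\<And>c. c \<in> orbit \<kappa> ` {1..d} \<Longrightarrow> card c = h" using \<kappa>(3) unfolding cycles_def by blast
qed (rule \<kappa>(1))

lemma Wg_joint:
  assumes d: "d = 2 * h" "d \<ge> 2" and \<rho>: "\<rho> permutes {1..d}" "card (cycles d \<rho>) = 1"
  shows "Wg d (succY' d \<circ> succX d) = Wg d \<rho>"
proof (rule Wg_eq_if_orbit_cards[where m = d])
  have h: "h \<ge> 1" using d by simp
  show "(succY' d \<circ> succX d) permutes {1..d}" using d by (intro permutes_compose succ_permutes) auto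
  show "card (orbit (succY' d \<circ> succX d) ` {1..d}) = card (orbit \<rho> ` {1..d})"
    using \<rho>(2) unfolding orbits_joint[OF d(1) h] cycles_def by simp
  show "\<And>c. c \<in> orbit (succY' d \<circ> succX d) ` {1..d} \<Longrightarrow> card c = d"
    unfolding orbits_joint[OF d(1) h] by simp
  fix c assume c: "c \<in> orbit \<rho> ` {1..d}"
  have "card (orbit \<rho> ` {1..d}) = 1" using \<rho>(2) unfolding cycles_def .
  then obtain c' where "orbit \<rho> ` {1..d} = {c'}" by (rule card_1_singletonE)
  then show "card c = d" using partition_by_orbits[OF \<rho>(1)] c by simp
qed (rule \<rho>(1))

section \<open>Evaluation of tensor polynomials\<close>

lemma keys_sum_linear:
  assumes g: "\<And>k a b. g k (a + b) = g k a + g k b" "\<And>k. g k 0 = (0 :: 'b :: ab_group_add)"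
  shows "(\<Sum>k\<in>Poly_Mapping.keys (s + t). g k (Poly_Mapping.lookup (s + t) k))
    = (\<Sum>k\<in>Poly_Mapping.keys s. g k (Poly_Mapping.lookup s k))
    + (\<Sum>k\<in>Poly_Mapping.keys t. g k (Poly_Mapping.lookup t k))"
proof -
  let ?K = "Poly_Mapping.keys s \<union> Poly_Mapping.keys t"
  have ext: "(\<Sum>k\<in>Poly_Mapping.keys p. g k (Poly_Mapping.lookup p k)) = (\<Sum>k\<in>?K. g k (Poly_Mapping.lookup p k))"
    if "Poly_Mapping.keys p \<subseteq> ?K" for p
    using that g(2) by (intro sum.mono_neutral_left) (auto simp: in_keys_iff)
  show ?thesis
    unfolding ext[OF keys_add] using ext[of s] ext[of t] by (simp add: lookup_add g(1) sum.distrib)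
qed

lemma rename_add: "rename f (s + t) = rename f s + rename f t"
  unfolding rename_def
  using keys_sum_linear[of "\<lambda>(u, v). Poly_Mapping.single (map f u, map f v)" s t]
  by (simp add: case_prod_unfold single_add)

lemma rename_zero: "rename f 0 = 0"
  by (simp add: rename_def)

lemma rename_sum: "rename f (sum t I) = (\<Sum>i\<in>I. rename f (t i))"
  by (induction I rule: infinite_finite_induct) (simp_all add: rename_add rename_zero)

lemma rename_single:
  "rename f (Poly_Mapping.single (u, v) c) = Poly_Mapping.single (map f u, map f v) c"
  by (cases "c = 0") (simp_all add: rename_def)

lemma lookup_tscale: "Poly_Mapping.lookup (tscale c t) k = c * Poly_Mapping.lookup t k"
  by (simp add: tscale_def Poly_Mapping.map.rep_eq when_def)

lemma tscale_sum: "tscale c (sum t I) = (\<Sum>i\<in>I. tscale c (t i))"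
  by (rule poly_mapping_eqI) (simp add: lookup_tscale lookup_sum sum_distrib_left)

lemma tscale_single: "tscale c (Poly_Mapping.single k x) = Poly_Mapping.single k (c * x)"
  by (rule poly_mapping_eqI) (simp add: lookup_tscale lookup_single when_def)

lemma tens_single_ncmono: "tens (Poly_Mapping.single u c) (ncmono v) = Poly_Mapping.single (u, v) c"
  by (cases "c = 0") (simp_all add: tens_def ncmono_def)

definition permute_letters :: "(nat \<Rightarrow> nat) \<times> (nat \<Rightarrow> nat) \<Rightarrow> var \<Rightarrow> var" where
  "permute_letters \<pi> = permX (fst \<pi>) \<circ> permY (snd \<pi>)"

lemma alternation_of_words:
  "AltX d (AltY d (tens (ncmono u) (ncmono v))) = (\<Sum>\<pi>\<in>perm_pairs d.
     Poly_Mapping.single (map (permute_letters \<pi>) u, map (permute_letters \<pi>) v) (sign_pair \<pi>))"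
proof -
  have "AltX d (AltY d (tens (ncmono u) (ncmono v))) = (\<Sum>\<sigma> | \<sigma> permutes {1..d\<^sup>2}. \<Sum>\<tau> | \<tau> permutes {1..d\<^sup>2}.
      Poly_Mapping.single (map (permute_letters (\<sigma>, \<tau>)) u, map (permute_letters (\<sigma>, \<tau>)) v) (sign_pair (\<sigma>, \<tau>)))"
    unfolding AltX_def AltY_def ncmono_def tens_single_ncmono[unfolded ncmono_def]
    by (simp add: rename_sum rename_single tscale_sum tscale_single permute_letters_def)
  then show ?thesis unfolding sum.cartesian_product by (simp add: case_prod_unfold)
qed

lemma teval_carrier: "teval d X Y t \<in> carrier_mat (d * d) (d * d)"
  by (simp add: teval_def)

lemma teval_entry:
  assumes "r < d * d" "c < d * d"
  shows "teval d X Y t $$ (r, c) = (\<Sum>k\<in>Poly_Mapping.keys t. Poly_Mapping.lookup t k *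
     kron d (eval_word d X Y (fst k)) (eval_word d X Y (snd k)) $$ (r, c))"
  using assms by (simp add: teval_def case_prod_unfold)

lemma teval_add:
  assumes "r < d * d" "c < d * d"
  shows "teval d X Y (s + t) $$ (r, c) = teval d X Y s $$ (r, c) + teval d X Y t $$ (r, c)"
  unfolding teval_entry[OF assms]
  by (rule keys_sum_linear[of "\<lambda>k x. x * kron d (eval_word d X Y (fst k)) (eval_word d X Y (snd k)) $$ (r, c)"])
    (simp_all add: distrib_right)

lemma teval_sum:
  assumes "r < d * d" "c < d * d"
  shows "teval d X Y (sum t I) $$ (r, c) = (\<Sum>i\<in>I. teval d X Y (t i) $$ (r, c))"
proof (induction I rule: infinite_finite_induct)
  case (insert i I)
  then show ?case by (simp add: teval_add[OF assms])
qed (simp_all add: teval_entry[OF assms])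

lemma teval_single:
  assumes "r < d * d" "c < d * d"
  shows "teval d X Y (Poly_Mapping.single (u, v) x) $$ (r, c)
    = x * kron d (eval_word d X Y u) (eval_word d X Y v) $$ (r, c)"
  by (cases "x = 0") (simp_all add: teval_entry[OF assms])

lemma teval_tscale:
  assumes "r < d * d" "c < d * d"
  shows "teval d X Y (tscale x t) $$ (r, c) = x * teval d X Y t $$ (r, c)"
proof -
  have "(\<Sum>k\<in>Poly_Mapping.keys (tscale x t). Poly_Mapping.lookup (tscale x t) k *
      kron d (eval_word d X Y (fst k)) (eval_word d X Y (snd k)) $$ (r, c))
    = (\<Sum>k\<in>Poly_Mapping.keys t. Poly_Mapping.lookup (tscale x t) k *
      kron d (eval_word d X Y (fst k)) (eval_word d X Y (snd k)) $$ (r, c))"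
    by (intro sum.mono_neutral_left) (auto simp: in_keys_iff lookup_tscale)
  then show ?thesis
    unfolding teval_entry[OF assms] by (simp add: lookup_tscale sum_distrib_left mult.assoc)
qed

definition entries :: "(nat \<Rightarrow> rat mat) \<Rightarrow> nat \<Rightarrow> nat \<Rightarrow> nat \<Rightarrow> rat" where
  "entries X p i j = X p $$ (i, j)"

lemma mprod_carrier:
  assumes "\<And>a. a \<in> set w \<Longrightarrow> M a \<in> carrier_mat d d"
  shows "mprod d (map M w) \<in> carrier_mat d d"
  using assms
proof (induction w)
  case (Cons a w)
  have "M a \<in> carrier_mat d d" "mprod d (map M w) \<in> carrier_mat d d"
    using Cons by simp_all
  then show ?case unfolding mprod_def list.map foldr.simps comp_apply by (rule mult_carrier_mat)
qed (simp add: mprod_def)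

lemma mprod_entry:
  assumes "\<And>a. a \<in> set w \<Longrightarrow> M a \<in> carrier_mat d d" "i < d" "j < d"
  shows "mprod d (map M w) $$ (i, j) = word_entry d (\<lambda>a i j. M a $$ (i, j)) w i j"
  using assms
proof (induction w arbitrary: i)
  case Nil
  then show ?case by (simp add: mprod_def)
next
  case (Cons a w)
  have car: "M a \<in> carrier_mat d d" "mprod d (map M w) \<in> carrier_mat d d"
    using Cons.prems(1) by (simp_all add: mprod_carrier)
  have "mprod d (map M (a # w)) $$ (i, j) = (M a * mprod d (map M w)) $$ (i, j)"
    by (simp add: mprod_def)
  also have "\<dots> = (\<Sum>k<d. M a $$ (i, k) * mprod d (map M w) $$ (k, j))"
    using carrier_matD[OF car(1)] carrier_matD[OF car(2)] Cons.prems(2,3)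
    by (simp add: scalar_prod_def atLeast0LessThan)
  also have "\<dots> = (\<Sum>k<d. M a $$ (i, k) * word_entry d (\<lambda>a i j. M a $$ (i, j)) w k j)"
    using Cons.IH Cons.prems by (intro sum.cong refl) simp
  finally show ?case by simp
qed

lemma tr_mprod:
  assumes "\<And>a. a \<in> set w \<Longrightarrow> M a \<in> carrier_mat d d"
  shows "tr (mprod d (map M w)) = (\<Sum>z<d. word_entry d (\<lambda>a i j. M a $$ (i, j)) w z z)"
  using carrier_matD(1)[OF mprod_carrier[of w M d, OF assms]] mprod_entry[of w M d, OF assms]
  by (simp add: tr_def)

lemma Td_eq_trace_form:
  assumes "matrices d X"
  shows "Td d X = trace_form d (entries X)"
  unfolding Td_def alt_fun_def trace_form_def
proof (intro sum.cong refl arg_cong2[where f = "(*)"] prod.cong)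
  fix \<sigma> :: "nat \<Rightarrow> nat" and i
  have "(\<lambda>a i j. (X \<circ> \<sigma>) a $$ (i, j)) = entries X \<circ> \<sigma>" by (simp add: entries_def fun_eq_iff)
  then show "tr (mprod d (map (X \<circ> \<sigma>) (m_idx i))) = (\<Sum>z<d. word_entry d (entries X \<circ> \<sigma>) (m_idx i) z z)"
    using tr_mprod[of "m_idx i" "X \<circ> \<sigma>" d] assms by (simp add: matrices_def)
qed

fun block_word :: "var \<Rightarrow> var list" where
  "block_word (VX i) = mX i"
| "block_word (VY i) = mY i"

text \<open>Reading the words as words in monomials separates the alternation from the order of the
monomials.\<close>
lemma words_as_blocks:
  "wordA d = concat (map block_word (blocksA d))"
  "wordB d = concat (map block_word (blocksB d))"
  "wordC d = concat (map block_word (blocksC d))"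
  unfolding wordA_def wordB_def wordC_def blocksA_def blocksB_def blocksC_def
  by (simp_all add: comp_def if_distrib[of block_word] del: upt_Suc cong: if_cong)

lemma eval_word_entry:
  assumes X: "matrices d X" and Y: "matrices d Y" and ij: "i < d" "j < d"
  shows "eval_word d X Y (map (permute_letters \<pi>) (concat (map block_word bs))) $$ (i, j)
    = word_entry d (block_matrix d (entries X) (entries Y) \<pi>) bs i j"
proof -
  let ?L = "\<lambda>z. case permute_letters \<pi> z of VX i \<Rightarrow> X i | VY i \<Rightarrow> Y i"
  let ?Z = "\<lambda>z i j. ?L z $$ (i, j)"
  have "?L z \<in> carrier_mat d d" for z
    using X Y by (simp add: matrices_def split: var.split)
  then have "eval_word d X Y (map (permute_letters \<pi>) (concat (map block_word bs))) $$ (i, j)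
      = word_entry d ?Z (concat (map block_word bs)) i j"
    using mprod_entry[of "concat (map block_word bs)" ?L d i j] ij
    by (simp add: eval_word_def comp_def)
  also have "\<dots> = word_entry d (\<lambda>b. word_entry d ?Z (block_word b)) bs i j"
    by (rule word_entry_concat[OF ij(1)])
  also have "(\<lambda>b. word_entry d ?Z (block_word b)) = block_matrix d (entries X) (entries Y) \<pi>"
  proof
    fix b
    show "word_entry d ?Z (block_word b) = block_matrix d (entries X) (entries Y) \<pi> b"
    proof (cases b)
      case (VX i)
      have eq: "?Z \<circ> VX = entries X \<circ> fst \<pi>" by (simp add: fun_eq_iff entries_def permute_letters_def)
      show ?thesis
        unfolding VX block_word.simps mX_def block_matrix.simps
        by (intro ext) (simp only: word_entry_map eq)
    next
      case (VY i)
      have eq: "?Z \<circ> VY = entries Y \<circ> snd \<pi>" by (simp add: fun_eq_iff entries_def permute_letters_def)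
      show ?thesis
        unfolding VY block_word.simps mY_def block_matrix.simps
        by (intro ext) (simp only: word_entry_map eq)
    qed
  qed
  finally show ?thesis .
qed

lemma teval_alternation_entry:
  assumes X: "matrices d X" and Y: "matrices d Y" and rc: "r < d * d" "c < d * d"
  shows "teval d X Y (AltX d (AltY d (tens (ncmono (concat (map block_word bs)))
      (ncmono (concat (map block_word bs')))))) $$ (r, c)
    = (\<Sum>\<pi>\<in>perm_pairs d. sign_pair \<pi> *
        (word_entry d (block_matrix d (entries X) (entries Y) \<pi>) bs (r div d) (c div d) *
         word_entry d (block_matrix d (entries X) (entries Y) \<pi>) bs' (r mod d) (c mod d)))"
proof -
  have "d > 0" using rc by (cases d) auto
  then have less: "r div d < d" "c div d < d" "r mod d < d" "c mod d < d"
    using rc by (simp_all add: less_mult_imp_div_less)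
  show ?thesis
    unfolding alternation_of_words teval_sum[OF rc] teval_single[OF rc] kron_def
    using rc less by (simp add: eval_word_entry[OF X Y])
qed

text \<open>The unknown coefficients $a$ and $b$ satisfy $d^2 a + d b = T A$ and $d a + d^2 b = T B$, where
$T = \mathcal{T}_d(X) \mathcal{T}_d(Y)$. The determinant of this system is $d\,(d^3 - d)$.\<close>
lemma teval_alternation:
  assumes X: "matrices d X" and Y: "matrices d Y" and d: "even d" "d \<ge> 2"
    and w: "w = blocksB d \<and> B = Wg d (succY' d \<circ> succX d) \<or> w = blocksC d \<and> B = 0"
  defines "A \<equiv> Wg d (succY d \<circ> succX d)" and "D \<equiv> (of_nat d :: rat)"
  shows "teval d X Y (AltX d (AltY d (tens (ncmono (wordA d)) (ncmono (concat (map block_word w))))))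
    = (Td d X * Td d Y) \<cdot>\<^sub>m (((D * A - B) / (D ^ 3 - D)) \<cdot>\<^sub>m 1\<^sub>m (d * d)
        + ((D * B - A) / (D ^ 3 - D)) \<cdot>\<^sub>m swap_mat d)"
proof -
  let ?X = "entries X" and ?Y = "entries Y"
  let ?T = "Td d X * Td d Y"
  have d1: "d \<ge> 1" using d(2) by simp
  have pair: "complementary_word d w" using w complementary_blocks[OF d1] by blast
  obtain a b where entry: "\<And>i j k l. \<lbrakk>i < d; j < d; k < d; l < d\<rbrakk> \<Longrightarrow>
      (\<Sum>\<pi>\<in>perm_pairs d. sign_pair \<pi> * (word_entry d (block_matrix d ?X ?Y \<pi>) (blocksA d) i k *
        word_entry d (block_matrix d ?X ?Y \<pi>) w j l))
      = a * of_bool (k = i \<and> l = j) + b * of_bool (k = j \<and> l = i)"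
    and tr1: "\<And>s. s (last (blocksA d)) = hd (blocksA d) \<Longrightarrow> s (last w) = hd w \<Longrightarrow>
      (\<Sum>u\<in>{hd (blocksA d), hd w} \<rightarrow>\<^sub>E {..<d}. block_tensors d ?X ?Y [blocksA d, w] {} u (u \<circ> s))
      = D\<^sup>2 * a + D * b"
    and tr2: "\<And>s. s (last (blocksA d)) = hd w \<Longrightarrow> s (last w) = hd (blocksA d) \<Longrightarrow>
      (\<Sum>u\<in>{hd (blocksA d), hd w} \<rightarrow>\<^sub>E {..<d}. block_tensors d ?X ?Y [blocksA d, w] {} u (u \<circ> s))
      = D * a + D\<^sup>2 * b"
    unfolding D_def using two_word_form[OF pair d1] by blast
  have T: "?T = trace_form d ?X * trace_form d ?Y"
    using Td_eq_trace_form X Y by simp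
  have "w = blocksB d \<or> w = blocksC d" using w by blast
  note sep = trace_separate[OF d this]
  have 1: "D\<^sup>2 * a + D * b = ?T * A"
    using tr1[OF sep(2,3)] sep(1)[of ?X ?Y] by (simp add: T A_def)
  have 2: "D * a + D\<^sup>2 * b = ?T * B"
    using w
  proof
    assume w: "w = blocksB d \<and> B = Wg d (succY' d \<circ> succX d)"
    then show ?thesis
      using tr2[of "closing (succX d) (succY' d)"] trace_joint_B(1)[OF d, of ?X ?Y] trace_joint_B(2,3)[OF d] by (simp add: T)
  next
    assume w: "w = blocksC d \<and> B = 0"
    then show ?thesis
      using tr2[of "closing_C d"] trace_joint_C(1)[OF d, of ?X ?Y] trace_joint_C(2,3)[OF d] by simp
  qed
  have "D \<ge> 2" using d(2) by (simp add: D_def)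
  moreover have "D ^ 3 - D = D * (D - 1) * (D + 1)"
    by (simp add: algebra_simps power3_eq_cube)
  ultimately have nz: "D ^ 3 - D \<noteq> 0" by auto
  have "(D ^ 3 - D) * a = D * (D\<^sup>2 * a + D * b) - (D * a + D\<^sup>2 * b)"
    "(D ^ 3 - D) * b = D * (D * a + D\<^sup>2 * b) - (D\<^sup>2 * a + D * b)"
    by (simp_all add: algebra_simps power2_eq_square power3_eq_cube)
  then have ab: "a = ?T * ((D * A - B) / (D ^ 3 - D))" "b = ?T * ((D * B - A) / (D ^ 3 - D))"
    unfolding 1 2 using nz by (simp_all add: field_simps)
  show ?thesis
  proof (rule eq_matI)
    fix r c assume "r < dim_row (?T \<cdot>\<^sub>m (((D * A - B) / (D ^ 3 - D)) \<cdot>\<^sub>m 1\<^sub>m (d * d)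
        + ((D * B - A) / (D ^ 3 - D)) \<cdot>\<^sub>m swap_mat d))"
      "c < dim_col (?T \<cdot>\<^sub>m (((D * A - B) / (D ^ 3 - D)) \<cdot>\<^sub>m 1\<^sub>m (d * d)
        + ((D * B - A) / (D ^ 3 - D)) \<cdot>\<^sub>m swap_mat d))"
    then have rc: "r < d * d" "c < d * d" by (simp_all add: swap_mat_def)
    then have less: "r div d < d" "c div d < d" "r mod d < d" "c mod d < d"
      using d1 by (simp_all add: less_mult_imp_div_less)
    have "c div d = r div d \<and> c mod d = r mod d \<longleftrightarrow> r = c"
      by (metis div_mult_mod_eq)
    then show "teval d X Y (AltX d (AltY d (tens (ncmono (wordA d)) (ncmono (concat (map block_word w)))))) $$ (r, c)
      = (?T \<cdot>\<^sub>m (((D * A - B) / (D ^ 3 - D)) \<cdot>\<^sub>m 1\<^sub>m (d * d)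
        + ((D * B - A) / (D ^ 3 - D)) \<cdot>\<^sub>m swap_mat d)) $$ (r, c)"
      unfolding words_as_blocks(1) teval_alternation_entry[OF X Y rc] entry[OF less(1,3,2,4)]
      using rc by (auto simp: swap_mat_def ab algebra_simps)
  qed (simp_all add: teval_def swap_mat_def)
qed

definition word_length :: "nat \<Rightarrow> tpoly \<Rightarrow> bool" where
  "word_length n t \<longleftrightarrow> (\<forall>(u, v)\<in>Poly_Mapping.keys t. length u = n \<and> length v = n)"

lemma word_length_add: "word_length n s \<Longrightarrow> word_length n t \<Longrightarrow> word_length n (s + t)"
  unfolding word_length_def using keys_add[of s t] by blast

lemma word_length_tscale: "word_length n t \<Longrightarrow> word_length n (tscale c t)"
  unfolding word_length_def by (auto simp: in_keys_iff lookup_tscale)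

lemma word_length_sum: "(\<And>i. i \<in> I \<Longrightarrow> word_length n (t i)) \<Longrightarrow> word_length n (sum t I)"
proof (induction I rule: infinite_finite_induct)
  case (insert i I)
  then show ?case by (simp add: word_length_add)
qed (simp_all add: word_length_def)

lemma balanced_if_word_length:
  assumes "word_length n t"
  shows "balanced t"
proof -
  obtain ks where ks: "set ks = Poly_Mapping.keys t" "distinct ks"
    using finite_distinct_list[of "Poly_Mapping.keys t"] by auto
  define ABs where "ABs = map (\<lambda>k. (Poly_Mapping.single (fst k) (Poly_Mapping.lookup t k), ncmono (snd k))) ks"
  have "(\<Sum>(A, B)\<leftarrow>ABs. tens A B) = (\<Sum>k\<leftarrow>ks. Poly_Mapping.single k (Poly_Mapping.lookup t k))"
    unfolding ABs_def map_map by (simp add: comp_def tens_single_ncmono)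
  also have "\<dots> = (\<Sum>k\<in>Poly_Mapping.keys t. Poly_Mapping.single k (Poly_Mapping.lookup t k))"
    using ks by (simp add: sum_list_distinct_conv_sum_set)
  also have "\<dots> = t"
    by (rule poly_mapping_eqI) (auto simp: lookup_sum lookup_single when_def in_keys_iff)
  finally have "t = (\<Sum>(A, B)\<leftarrow>ABs. tens A B)" ..
  moreover have "\<forall>(A, B)\<in>set ABs. homogeneous n A \<and> homogeneous n B"
    using assms ks(1) unfolding ABs_def word_length_def homogeneous_def ncmono_def by auto
  ultimately show ?thesis unfolding balanced_def by blast
qed

lemma length_words:
  "length (wordA d) = d\<^sup>2" "length (wordB d) = d\<^sup>2" "d \<ge> 1 \<Longrightarrow> length (wordC d) = d\<^sup>2"
proof -
  have total: "sum_list (map (\<lambda>i. length (m_idx i)) [1..<d + 1]) = d\<^sup>2"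
    using arg_cong[OF concat_m_idx[of d], of length] by (simp add: length_concat comp_def del: upt_Suc)
  show "length (wordA d) = d\<^sup>2"
    unfolding words_as_blocks blocksA_def length_concat map_map comp_def
    using total by (simp add: if_distrib[of block_word] if_distrib[of length] mX_def mY_def del: upt_Suc cong: if_cong)
  show "length (wordB d) = d\<^sup>2"
    unfolding words_as_blocks blocksB_def length_concat map_map comp_def
    using total by (simp add: if_distrib[of block_word] if_distrib[of length] mX_def mY_def rev_map[symmetric] sum_list_rev del: upt_Suc cong: if_cong)
  assume "d \<ge> 1"
  then have "[1..<d + 1] = 1 # [2..<d + 1]" by (simp add: upt_conv_Cons numeral_2_eq_2)
  then show "length (wordC d) = d\<^sup>2"
    unfolding words_as_blocks blocksC_def length_concat list.map map_map comp_def
    using total by (simp add: if_distrib[of block_word] if_distrib[of length] mX_def mY_def rev_map[symmetric] sum_list_rev del: upt_Suc cong: if_cong)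
qed

lemma word_length_G:
  assumes "d \<ge> 1"
  shows "word_length (d\<^sup>2) (G1 d)" "word_length (d\<^sup>2) (G2 d)"
  unfolding G1_def G2_def alternation_of_words
  by (intro word_length_sum; simp add: word_length_def length_words length_words(3)[OF assms])+

lemma exists_Td_nonzero:
  assumes "d \<ge> 1"
  obtains X where "matrices d X" "Td d X \<noteq> 0"
proof
  define X where "X p = mat d d (\<lambda>(i, j). matrix_units d p i j)" for p
  show X: "matrices d X" by (simp add: matrices_def X_def)
  have "word_entry d (entries X \<circ> \<pi>) w i j = word_entry d (matrix_units d \<circ> \<pi>) w i j"
    if "i < d" "j < d" for \<pi> w i j
    using that by (induction w arbitrary: i) (simp_all add: entries_def X_def)
  then have "trace_form d (entries X) = trace_form d (matrix_units d)"
    unfolding trace_form_def by (intro sum.cong refl arg_cong2[where f = "(*)"] prod.cong) simp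
  then show "Td d X \<noteq> 0" using Td_eq_trace_form[OF X] trace_form_nonzero by simp
qed

lemma id_swap_independent:
  assumes d: "d \<ge> 2" and T: "T \<noteq> (0::rat)"
    and eq: "T \<cdot>\<^sub>m (\<alpha> \<cdot>\<^sub>m 1\<^sub>m (d * d) + \<beta> \<cdot>\<^sub>m swap_mat d) = T \<cdot>\<^sub>m (\<alpha>' \<cdot>\<^sub>m 1\<^sub>m (d * d) + \<beta>' \<cdot>\<^sub>m swap_mat d)"
  shows "\<alpha> = \<alpha>'" "\<beta> = \<beta>'"
proof -
  have less: "1 < d * d" "d < d * d" using d mult_le_mono[OF d d] by simp_all
  have "(T \<cdot>\<^sub>m (\<alpha> \<cdot>\<^sub>m 1\<^sub>m (d * d) + \<beta> \<cdot>\<^sub>m swap_mat d)) $$ (1, 1)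
      = (T \<cdot>\<^sub>m (\<alpha>' \<cdot>\<^sub>m 1\<^sub>m (d * d) + \<beta>' \<cdot>\<^sub>m swap_mat d)) $$ (1, 1)" using eq by simp
  then show "\<alpha> = \<alpha>'" using less d T by (simp add: swap_mat_def)
  have "(T \<cdot>\<^sub>m (\<alpha> \<cdot>\<^sub>m 1\<^sub>m (d * d) + \<beta> \<cdot>\<^sub>m swap_mat d)) $$ (1, d)
      = (T \<cdot>\<^sub>m (\<alpha>' \<cdot>\<^sub>m 1\<^sub>m (d * d) + \<beta>' \<cdot>\<^sub>m swap_mat d)) $$ (1, d)" using eq by simp
  then show "\<beta> = \<beta>'" using less d T by (simp add: swap_mat_def)
qed

text \<open>The coefficients are unique because $\mathcal{T}_d$ does not vanish identically.\<close>
lemma id_swap_coeffs_eq: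
  assumes d: "d \<ge> 2" and G: "has_coeffs d G \<alpha> \<beta>"
  shows "id_swap_coeffs d G = (\<alpha>, \<beta>)"
  unfolding id_swap_coeffs_def
proof (rule the_equality)
  show "case (\<alpha>, \<beta>) of (\<alpha>, \<beta>) \<Rightarrow> has_coeffs d G \<alpha> \<beta>" using G by simp
  fix p assume p: "case p of (\<alpha>, \<beta>) \<Rightarrow> has_coeffs d G \<alpha> \<beta>"
  obtain \<alpha>' \<beta>' where [simp]: "p = (\<alpha>', \<beta>')" by fastforce
  obtain X where X: "matrices d X" "Td d X \<noteq> 0" using exists_Td_nonzero[of d] d by auto
  have "(Td d X * Td d X) \<cdot>\<^sub>m (\<alpha>' \<cdot>\<^sub>m 1\<^sub>m (d * d) + \<beta>' \<cdot>\<^sub>m swap_mat d)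
      = (Td d X * Td d X) \<cdot>\<^sub>m (\<alpha> \<cdot>\<^sub>m 1\<^sub>m (d * d) + \<beta> \<cdot>\<^sub>m swap_mat d)"
    using p G X(1) unfolding has_coeffs_def by simp
  from id_swap_independent[OF d _ this] show "p = (\<alpha>, \<beta>)" using X(2) by simp
qed

section \<open>The swap polynomial\<close>

lemma teval_combination:
  assumes X: "matrices d X" and Y: "matrices d Y"
    and G: "has_coeffs d G \<alpha> \<beta>" and H: "has_coeffs d H \<alpha>' \<beta>'"
  shows "teval d X Y (tscale x G + tscale y H)
    = (Td d X * Td d Y) \<cdot>\<^sub>m ((x * \<alpha> + y * \<alpha>') \<cdot>\<^sub>m 1\<^sub>m (d * d) + (x * \<beta> + y * \<beta>') \<cdot>\<^sub>m swap_mat d)"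
proof (rule eq_matI)
  let ?T = "Td d X * Td d Y"
  fix r c
  assume "r < dim_row (?T \<cdot>\<^sub>m ((x * \<alpha> + y * \<alpha>') \<cdot>\<^sub>m 1\<^sub>m (d * d) + (x * \<beta> + y * \<beta>') \<cdot>\<^sub>m swap_mat d))"
    "c < dim_col (?T \<cdot>\<^sub>m ((x * \<alpha> + y * \<alpha>') \<cdot>\<^sub>m 1\<^sub>m (d * d) + (x * \<beta> + y * \<beta>') \<cdot>\<^sub>m swap_mat d))"
  then have rc: "r < d * d" "c < d * d" by (simp_all add: swap_mat_def)
  have "teval d X Y G = ?T \<cdot>\<^sub>m (\<alpha> \<cdot>\<^sub>m 1\<^sub>m (d * d) + \<beta> \<cdot>\<^sub>m swap_mat d)"
    "teval d X Y H = ?T \<cdot>\<^sub>m (\<alpha>' \<cdot>\<^sub>m 1\<^sub>m (d * d) + \<beta>' \<cdot>\<^sub>m swap_mat d)"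
    using G H X Y by (auto simp: has_coeffs_def)
  then show "teval d X Y (tscale x G + tscale y H) $$ (r, c)
      = (?T \<cdot>\<^sub>m ((x * \<alpha> + y * \<alpha>') \<cdot>\<^sub>m 1\<^sub>m (d * d) + (x * \<beta> + y * \<beta>') \<cdot>\<^sub>m swap_mat d)) $$ (r, c)"
    using rc by (simp add: teval_add[OF rc] teval_tscale[OF rc] swap_mat_def algebra_simps)
qed (simp_all add: teval_def swap_mat_def)

lemma has_coeffs_G:
  assumes d: "d = 2 * h" "d \<ge> 2"
    and \<rho>: "\<rho> permutes {1..d}" "card (cycles d \<rho>) = 1"
    and \<kappa>: "\<kappa> permutes {1..d}" "card (cycles d \<kappa>) = 2" "\<forall>c\<in>cycles d \<kappa>. card c = h"
  defines "D \<equiv> (of_nat d :: rat)"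
  shows "has_coeffs d (G1 d) ((D * Wg d \<kappa> - Wg d \<rho>) / (D ^ 3 - D)) ((D * Wg d \<rho> - Wg d \<kappa>) / (D ^ 3 - D))"
    "has_coeffs d (G2 d) (D * Wg d \<kappa> / (D ^ 3 - D)) (- Wg d \<kappa> / (D ^ 3 - D))"
proof -
  have even: "even d" using d by simp
  note Wg = Wg_separate[OF d \<kappa>] Wg_joint[OF d \<rho>]
  show "has_coeffs d (G1 d) ((D * Wg d \<kappa> - Wg d \<rho>) / (D ^ 3 - D)) ((D * Wg d \<rho> - Wg d \<kappa>) / (D ^ 3 - D))"
    unfolding has_coeffs_def G1_def words_as_blocks(2) D_def
    using teval_alternation[OF _ _ even d(2), of _ _ "blocksB d" "Wg d \<rho>"] Wg by simp
  show "has_coeffs d (G2 d) (D * Wg d \<kappa> / (D ^ 3 - D)) (- Wg d \<kappa> / (D ^ 3 - D))"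
    unfolding has_coeffs_def G2_def words_as_blocks(3) D_def
    using teval_alternation[OF _ _ even d(2), of _ _ "blocksC d" 0] Wg by simp
qed

theorem theorem4p14:
  fixes d h :: nat and \<rho> \<kappa> :: "nat \<Rightarrow> nat" and a_d a_hh :: rat
  assumes "d = 2 * h" and "d \<ge> 2"
    and "\<rho> permutes {1..d}" and "card (cycles d \<rho>) = 1"
    and "\<kappa> permutes {1..d}" and "card (cycles d \<kappa>) = 2" and "\<forall>c\<in>cycles d \<kappa>. card c = h"
    and "a_d = Wg d \<rho>" and "a_hh = Wg d \<kappa>"
  shows "has_coeffs d (G1 d) (\<alpha>1 d) (\<beta>1 d) \<and>
     has_coeffs d (G2 d) (\<alpha>2 d) (\<beta>2 d) \<and>
     balanced (tscale (- \<alpha>2 d) (G1 d) + tscale (\<alpha>1 d) (G2 d)) \<and>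
     swap_polynomial d (tscale (- \<alpha>2 d) (G1 d) + tscale (\<alpha>1 d) (G2 d)) \<and>
     (\<forall>X Y. matrices d X \<and> matrices d Y \<longrightarrow>
      teval d X Y (tscale (- \<alpha>2 d) (G1 d) + tscale (\<alpha>1 d) (G2 d))
        = (Td d X * Td d Y * (- \<alpha>2 d * \<beta>1 d + \<alpha>1 d * \<beta>2 d)) \<cdot>\<^sub>m swap_mat d) \<and>
     (\<forall>X Y. matrices d X \<and> matrices d Y \<longrightarrow>
      (of_nat d * a_hh) \<cdot>\<^sub>m teval d X Y (G1 d) + (a_d - of_nat d * a_hh) \<cdot>\<^sub>m teval d X Y (G2 d)
        = (a_hh * a_d / of_nat d * Td d X * Td d Y) \<cdot>\<^sub>m swap_mat d)"
proof -
  define D where "D = (of_nat d :: rat)"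
  note G = has_coeffs_G[OF assms(1-7), folded assms(8,9) D_def]
  note coeffs = id_swap_coeffs_eq[OF assms(2) G(1)] id_swap_coeffs_eq[OF assms(2) G(2)]
  have \<alpha>\<beta>: "\<alpha>1 d = (D * a_hh - a_d) / (D ^ 3 - D)" "\<beta>1 d = (D * a_d - a_hh) / (D ^ 3 - D)"
    "\<alpha>2 d = D * a_hh / (D ^ 3 - D)" "\<beta>2 d = - a_hh / (D ^ 3 - D)"
    by (simp_all add: \<alpha>1_def \<beta>1_def \<alpha>2_def \<beta>2_def coeffs)
  have G: "has_coeffs d (G1 d) (\<alpha>1 d) (\<beta>1 d)" "has_coeffs d (G2 d) (\<alpha>2 d) (\<beta>2 d)"
    using G unfolding \<alpha>\<beta> .
  have "D \<ge> 2" using assms(2) by (simp add: D_def)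
  have cube: "D ^ 3 - D = D * (D - 1) * (D + 1)" by (simp add: algebra_simps power3_eq_cube)
  have D: "D \<noteq> 0" "D - 1 \<noteq> 0" "D + 1 \<noteq> 0" "D ^ 3 - D \<noteq> 0"
    using \<open>D \<ge> 2\<close> by (auto simp: cube)
  let ?P = "tscale (- \<alpha>2 d) (G1 d) + tscale (\<alpha>1 d) (G2 d)"
  let ?\<gamma> = "- \<alpha>2 d * \<beta>1 d + \<alpha>1 d * \<beta>2 d"
  have multiple: "teval d X Y ?P = (Td d X * Td d Y * ?\<gamma>) \<cdot>\<^sub>m swap_mat d"
    if "matrices d X" "matrices d Y" for X Y
    unfolding teval_combination[OF that G]
    by (rule eq_matI) (simp_all add: swap_mat_def mult.assoc)
  have \<gamma>: "?\<gamma> = - (a_hh * a_d) * (D\<^sup>2 - 1) / (D ^ 3 - D)\<^sup>2"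
    unfolding \<alpha>\<beta> using D(4) by (simp add: divide_simps) (simp add: algebra_simps power2_eq_square)
  \<comment> \<open>By the sign rule for the Weingarten function no value of it vanishes.\<close>
  have "a_hh \<noteq> 0" "a_d \<noteq> 0" using Wg_nonzero assms(3,5,8,9) by simp_all
  moreover have sq: "D\<^sup>2 - 1 = (D - 1) * (D + 1)" by (simp add: algebra_simps power2_eq_square)
  ultimately have \<gamma>_nz: "?\<gamma> \<noteq> 0" unfolding \<gamma> using D by simp
  have "swap_polynomial d ?P"
    unfolding swap_polynomial_def
  proof (intro conjI allI impI)
    obtain X where X: "matrices d X" "Td d X \<noteq> 0" using exists_Td_nonzero[of d] assms(2) by auto
    have "teval d X X ?P $$ (0, 0) = Td d X * Td d X * ?\<gamma>"
      unfolding multiple[OF X(1) X(1)] using assms(2) by (simp add: swap_mat_def)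
    also have "\<dots> \<noteq> 0" using X(2) \<gamma>_nz by simp
    finally have "teval d X X ?P \<noteq> 0\<^sub>m (d * d) (d * d)" using assms(2) by auto
    then show "\<exists>X Y. matrices d X \<and> matrices d Y \<and> teval d X Y ?P \<noteq> 0\<^sub>m (d * d) (d * d)"
      using X(1) by blast
    show "\<exists>c. teval d X Y ?P = c \<cdot>\<^sub>m swap_mat d" if "matrices d X \<and> matrices d Y" for X Y
      using multiple that by blast
  qed
  moreover have "balanced ?P"
    using assms(2)
    by (intro balanced_if_word_length[of "d\<^sup>2"] word_length_add word_length_tscale word_length_G) simp_all
  moreover have "(of_nat d * a_hh) \<cdot>\<^sub>m teval d X Y (G1 d) + (a_d - of_nat d * a_hh) \<cdot>\<^sub>m teval d X Y (G2 d)
      = (a_hh * a_d / of_nat d * Td d X * Td d Y) \<cdot>\<^sub>m swap_mat d"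
    if XY: "matrices d X" "matrices d Y" for X Y
  proof -
    have "(D * a_hh) \<cdot>\<^sub>m teval d X Y (G1 d) + (a_d - D * a_hh) \<cdot>\<^sub>m teval d X Y (G2 d)
        = (- (D ^ 3 - D)) \<cdot>\<^sub>m teval d X Y ?P"
    proof (rule eq_matI)
      fix r c assume "r < dim_row ((- (D ^ 3 - D)) \<cdot>\<^sub>m teval d X Y ?P)"
        "c < dim_col ((- (D ^ 3 - D)) \<cdot>\<^sub>m teval d X Y ?P)"
      then have rc: "r < d * d" "c < d * d" by (simp_all add: teval_def)
      \<comment> \<open>The factor D ^ 3 - D clears the common denominator of the coefficients.\<close>
      define K where "K = D ^ 3 - D"
      have K: "D * a_hh = K * \<alpha>2 d" "a_d - D * a_hh = - (K * \<alpha>1 d)"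
        unfolding \<alpha>\<beta> K_def using D(4) by simp_all
      have P: "teval d X Y ?P $$ (r, c)
          = - \<alpha>2 d * teval d X Y (G1 d) $$ (r, c) + \<alpha>1 d * teval d X Y (G2 d) $$ (r, c)"
        by (simp only: teval_add[OF rc] teval_tscale[OF rc])
      have "((D * a_hh) \<cdot>\<^sub>m teval d X Y (G1 d) + (a_d - D * a_hh) \<cdot>\<^sub>m teval d X Y (G2 d)) $$ (r, c)
          = D * a_hh * teval d X Y (G1 d) $$ (r, c) + (a_d - D * a_hh) * teval d X Y (G2 d) $$ (r, c)"
        using rc teval_carrier[of d X Y "G1 d"] teval_carrier[of d X Y "G2 d"] by simp
      also have "\<dots> = - K * teval d X Y ?P $$ (r, c)"
        unfolding K(2) unfolding K(1) P by (simp add: algebra_simps)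
      also have "\<dots> = (- K \<cdot>\<^sub>m teval d X Y ?P) $$ (r, c)"
        using rc teval_carrier[of d X Y ?P] by simp
      finally show "((D * a_hh) \<cdot>\<^sub>m teval d X Y (G1 d) + (a_d - D * a_hh) \<cdot>\<^sub>m teval d X Y (G2 d)) $$ (r, c)
          = ((- (D ^ 3 - D)) \<cdot>\<^sub>m teval d X Y ?P) $$ (r, c)"
        unfolding K_def .
    qed (simp_all add: teval_def)
    also have "\<dots> = (- (D ^ 3 - D) * (Td d X * Td d Y * ?\<gamma>)) \<cdot>\<^sub>m swap_mat d"
      unfolding multiple[OF XY] by (rule eq_matI) simp_all
    also have "- (D ^ 3 - D) * (Td d X * Td d Y * ?\<gamma>) = a_hh * a_d / D * Td d X * Td d Y"
    proof -
      have "- E * (- v * w / E\<^sup>2) = v * w / E" if "E \<noteq> 0" for E v w :: rat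
        using that by (simp add: power2_eq_square)
      then have "- (D ^ 3 - D) * ?\<gamma> = a_hh * a_d * (D\<^sup>2 - 1) / (D ^ 3 - D)"
        unfolding \<gamma> using D(4) by blast
      also have "a_hh * a_d * (D\<^sup>2 - 1) / (D ^ 3 - D) = a_hh * a_d * (D\<^sup>2 - 1) / (D * (D\<^sup>2 - 1))" by (simp add: algebra_simps power3_eq_cube power2_eq_square)
      also have "a_hh * a_d * (D\<^sup>2 - 1) / (D * (D\<^sup>2 - 1)) = a_hh * a_d / D"
        using D(1,2,3) sq by simp
      finally have "- (D ^ 3 - D) * ?\<gamma> * (Td d X * Td d Y) = a_hh * a_d / D * (Td d X * Td d Y)" by simp
      then show ?thesis by (simp only: mult_ac)
    qed
    finally show ?thesis by (simp add: D_def)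
  qed
  ultimately show ?thesis using G multiple by blast
qed

end
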